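(* Let $f:\mathbb{R}^n\to\mathbb{R}^n$ be of class $\mathcal{C}^2$ with $\dot x=f(x)$ forward complete, and suppose the system is contracting: there exist a uniformly bounded $M:\mathbb{R}^n\to\mathbb{R}^{n\times n}_{\succ0}$ and $\rho>0$ with $\partial_fM(x)+F(x)^\top M(x)+M(x)F(x)\preceq-\rho M(x)$ for all $x$, where $F=\partial f/\partial x$. Then there exist a finite integer $N\ge n$, a mapping $\phi:\mathbb{R}^n\to\mathbb{R}^N$ and a Hurwitz matrix $A\in\mathbb{R}^{N\times N}$ such that $\frac{\partial\phi}{\partial x}(x)$ has full column rank $n$ for every $x\in\mathbb{R}^n$ and $\frac{\partial\phi}{\partial x}(x)f(x)=A\phi(x)$ for every $x\in\mathbb{R}^n$.
   Context: $\partial_fM(x):=\sum_i\frac{\partial M}{\partial x_i}(x)f_i(x)$. Uniformly bounded: $a_1I\preceq M(x)\preceq a_2I$ for all $x$ with constants $a_2\ge a_1>0$. Forward complete: unique solutions exist on $[0,\infty)$ from every initial condition. *)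

theory Defs
  imports "HOL-Analysis.Analysis"
begin

definition C2 :: "(real^'n \<Rightarrow> real^'m) \<Rightarrow> bool" where
  "C2 f \<longleftrightarrow> (\<exists>f' :: real^'n \<Rightarrow> ((real^'n) \<Rightarrow>\<^sub>L (real^'m)).
              \<exists>f'' :: real^'n \<Rightarrow> ((real^'n) \<Rightarrow>\<^sub>L ((real^'n) \<Rightarrow>\<^sub>L (real^'m))).
     (\<forall>x. (f has_derivative blinfun_apply (f' x)) (at x)) \<and>
     (\<forall>x. (f' has_derivative blinfun_apply (f'' x)) (at x)) \<and>
     continuous_on UNIV f'')"

definition is_solution :: "(real^'n \<Rightarrow> real^'n) \<Rightarrow> (real \<Rightarrow> real^'n) \<Rightarrow> bool" where
  "is_solution f s \<longleftrightarrow> (\<forall>t\<ge>0. (s has_vector_derivative f (s t)) (at t within {0..}))"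

definition forward_complete :: "(real^'n \<Rightarrow> real^'n) \<Rightarrow> bool" where
  "forward_complete f \<longleftrightarrow> (\<forall>x0. \<exists>s. s 0 = x0 \<and> is_solution f s \<and>
      (\<forall>s'. s' 0 = x0 \<and> is_solution f s' \<longrightarrow> (\<forall>t\<ge>0. s' t = s t)))"

definition loewner_le :: "real^'n^'n \<Rightarrow> real^'n^'n \<Rightarrow> bool" where
  "loewner_le A B \<longleftrightarrow> (\<forall>v. v \<bullet> (A *v v) \<le> v \<bullet> (B *v v))"

definition hurwitz :: "nat \<Rightarrow> (nat \<Rightarrow> nat \<Rightarrow> real) \<Rightarrow> bool" where
  "hurwitz N A \<longleftrightarrow> (\<forall>(lam::complex) (v::nat \<Rightarrow> complex).
      (\<exists>i<N. v i \<noteq> 0) \<and> (\<forall>i<N. (\<Sum>j<N. complex_of_real (A i j) * v j) = lam * v i)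
      \<longrightarrow> Re lam < 0)"

end

theory Submission
  imports Defs "HOL-Computational_Algebra.Fundamental_Theorem_Algebra"
begin

text \<open>
  Along a trajectory \<open>f(X)\<close> decays exponentially in the metric \<open>M\<close>, so every trajectory converges to an
  equilibrium. Each equilibrium has an open basin of attraction and the space is connected, so there is
  only one; move it to \<open>0\<close>. With \<open>P = M(0)\<close>, the function \<open>V(x) = x \<bullet> P x\<close> is a Lyapunov function near \<open>0\<close>,
  and each \<open>x \<noteq> 0\<close> lies on exactly one trajectory through the level set \<open>V = c\<close>: call \<open>base x\<close> its
  crossing point and \<open>tau x\<close> the time from \<open>base x\<close> to \<open>x\<close>. Both depend differentiably on \<open>x \<noteq> 0\<close>.

  Since \<open>N\<close> may exceed \<open>n\<close>, full rank away from the equilibrium is easily arranged: the coordinates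
  \<open>exp (- K tau)\<close> and \<open>exp (- K tau) base\<close> form an immersion off \<open>0\<close>, evolve linearly, and have derivative
  \<open>0\<close> at \<open>0\<close> when \<open>K\<close> is large. At \<open>0\<close> itself it suffices to find, for each generalized left eigenvector
  \<open>u\<close> of the Jacobian \<open>F(0)\<close>, a linearly evolving function of the form \<open>u(x) + o(\<bar>x\<bar>)\<close> that is
  differentiable everywhere; no continuity of its derivative at \<open>0\<close> is needed.

  Such a function is determined by its values on \<open>V = c\<close>. The natural candidate is the limit of
  \<open>u (exp (- k F(0)) X(y, k))\<close>, which need not exist. Its increment at step \<open>k\<close> is therefore kept only as
  long as the trajectory still satisfies \<open>\<bar>X(y, k)\<bar> \<lesssim> exp (- sig k)\<close>, where \<open>sig\<close> lies below the
  decay rate of \<open>u\<close> by less than the contraction rate \<open>r\<close>; this is done by a smooth cutoff, so the sum converges to a differentiable function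
  of \<open>y\<close>. A discarded increment belongs to a slow trajectory. If no eigenvalue has real part \<open>- sig\<close>, an
  indefinite quadratic Lyapunov function shows that a slow trajectory remains slow, and then the discarded
  increments are \<open>o(\<bar>x\<bar>)\<close>.
\<close>

section \<open>Scalar differential inequalities and Picard iteration\<close>

text \<open>The obstacle is spectral spread. The nonlinear part of \<open>f\<close> is quadratic, so
  along a general trajectory it is only known to decay like exp (- 2 r k), while exp (- k F(0))
  amplifies it by about exp (- Re lam k); if - Re lam exceeds 2 r, nothing forces convergence. The
  derivative in y of a kept increment is of order exp (- Re lam k) |X| |DX|, hence of order exp (-
  (sig + r + Re lam) k), which is summable once sig > - Re lam - r. A discarded increment belongs to
  a trajectory with |X(y, k)| of order at most exp (sig (t - k)) |x|, where x = X(y, t), so its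
  contribution at x carries the factor exp ((Re lam + sig) (t - k)); this asks for sig < - Re lam.
  The two conditions leave a nonempty open interval, in which only finitely many points have to be
  avoided for hyperbolicity. The flow runs forward only. What would need backward time is replaced
  by lower bounds on the distance of trajectories, by invariance of domain, and by one backward
  solution near the equilibrium.\<close>

lemma nonincreasing_within:
  fixes h h' :: "real \<Rightarrow> real"
  assumes ab: "a \<le> b"
    and der: "\<And>s. s \<in> {a..b} \<Longrightarrow> (h has_real_derivative h' s) (at s within {a..b})"
    and le: "\<And>s. a < s \<Longrightarrow> s < b \<Longrightarrow> h' s \<le> 0"
  shows "h b \<le> h a"
proof (rule DERIV_nonpos_imp_decreasing_open[OF ab])
  fix s assume s: "a < s" "s < b"
  then have "(h has_real_derivative h' s) (at s)"
    using der[of s] at_within_Icc_at[of a s b] by auto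
  then show "\<exists>y. (h has_real_derivative y) (at s) \<and> y \<le> 0" using le s by blast
next
  show "continuous_on {a..b} h"
    by (rule DERIV_continuous_on[OF der]) 
qed

text \<open>Gronwall's inequality by the integrating factor exp (- k s). The sign of
  \<open>k\<close> is free, so the same statement serves for growth bounds and for exponential
  decay.\<close>

lemma growth_le:
  fixes w w' :: "real \<Rightarrow> real"
  assumes ab: "a \<le> b"
    and der: "\<And>s. s \<in> {a..b} \<Longrightarrow> (w has_real_derivative w' s) (at s within {a..b})"
    and le: "\<And>s. a < s \<Longrightarrow> s < b \<Longrightarrow> w' s \<le> k * w s"
  shows "w b \<le> exp (k * (b - a)) * w a"
proof -
  have "exp (- k * b) * w b \<le> exp (- k * a) * w a"
  proof (rule nonincreasing_within[OF ab])
    show "((\<lambda>s. exp (- k * s) * w s) has_real_derivative exp (- k * s) * (w' s - k * w s)) (at s within {a..b})"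
      if "s \<in> {a..b}" for s
      by (auto intro!: derivative_eq_intros der[OF that] simp: algebra_simps)
    show "exp (- k * s) * (w' s - k * w s) \<le> 0" if "a < s" "s < b" for s
      using le[OF that] by (simp add: mult_le_0_iff)
  qed
  then have "exp (k * b) * (exp (- k * b) * w b) \<le> exp (k * b) * (exp (- k * a) * w a)" by simp
  moreover have "exp (k * b) * exp (- k * b) = 1" by (simp flip: exp_add)
  moreover have "exp (k * b) * exp (- k * a) = exp (k * (b - a))"
    by (simp add: right_diff_distrib flip: exp_add)
  ultimately show ?thesis by (simp only: mult.assoc[symmetric])
qed

lemma growth_ge:
  fixes w w' :: "real \<Rightarrow> real"
  assumes ab: "a \<le> b"
    and der: "\<And>s. s \<in> {a..b} \<Longrightarrow> (w has_real_derivative w' s) (at s within {a..b})"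
    and le: "\<And>s. a < s \<Longrightarrow> s < b \<Longrightarrow> k * w s \<le> w' s"
  shows "exp (k * (b - a)) * w a \<le> w b"
proof -
  have "- w b \<le> exp (k * (b - a)) * (- w a)"
    by (rule growth_le[OF ab DERIV_minus[OF der]]) (use le in auto)
  then show ?thesis by simp
qed

lemma growth_le_affine:
  fixes w w' :: "real \<Rightarrow> real"
  assumes T: "0 \<le> T" and k: "0 \<le> k" and c: "0 \<le> c"
    and der: "\<And>s. s \<in> {0..T} \<Longrightarrow> (w has_real_derivative w' s) (at s within {0..T})"
    and le: "\<And>s. 0 < s \<Longrightarrow> s < T \<Longrightarrow> w' s \<le> k * w s + c"
  shows "w T \<le> exp (k * T) * (w 0 + c * T)"
proof -
  have "exp (- k * T) * w T - c * T \<le> exp (- k * 0) * w 0 - c * 0"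
  proof (rule nonincreasing_within[OF T])
    show "((\<lambda>s. exp (- k * s) * w s - c * s) has_real_derivative exp (- k * s) * (w' s - k * w s) - c)
        (at s within {0..T})" if "s \<in> {0..T}" for s
      by (auto intro!: derivative_eq_intros der[OF that] simp: algebra_simps)
    show "exp (- k * s) * (w' s - k * w s) - c \<le> 0" if s: "0 < s" "s < T" for s
    proof -
      have "exp (- k * s) * (w' s - k * w s) \<le> exp (- k * s) * c"
        using le[OF s] by (intro mult_left_mono) auto
      also have "\<dots> \<le> 1 * c" using k s c by (intro mult_right_mono) auto
      finally show ?thesis by simp
    qed
  qed
  then have "exp (k * T) * (exp (- k * T) * w T) \<le> exp (k * T) * (w 0 + c * T)" by simp
  moreover have "exp (k * T) * exp (- k * T) = 1" by (simp flip: exp_add)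
  ultimately show ?thesis by (simp only: mult.assoc[symmetric])
qed

lemma first_time_above:
  fixes w :: "real \<Rightarrow> real"
  assumes cont: "continuous_on {0..T} w" and ex: "\<exists>s\<in>{0..T}. c \<le> w s"
  obtains t where "t \<in> {0..T}" "c \<le> w t" "\<And>s. s \<in> {0..T} \<Longrightarrow> c \<le> w s \<Longrightarrow> t \<le> s"
proof -
  define A where "A = {s \<in> {0..T}. c \<le> w s}"
  have "closed A" unfolding A_def
    by (rule continuous_on_closed_Collect_le[OF continuous_on_const cont closed_real_atLeastAtMost])
  moreover have "bounded A" by (rule bounded_subset[OF bounded_closed_interval]) (auto simp: A_def)
  ultimately have "compact A" by (simp add: compact_eq_bounded_closed)
  moreover have "A \<noteq> {}" using ex by (auto simp: A_def)
  ultimately obtain t where "t \<in> A" "\<And>s. s \<in> A \<Longrightarrow> t \<le> s" using compact_attains_inf by metis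
  then show ?thesis using that by (auto simp: A_def)
qed

text \<open>Continuity argument for a priori bounds: at the first time where \<open>w\<close> is at
  least \<open>c\<close>, the hypothesis \<open>step\<close> applies, because all earlier values are
  below \<open>c\<close>. At t = 0 the premise of \<open>step\<close> is vacuous, so the bound on
  the initial value is part of \<open>step\<close>.\<close>

lemma first_exit:
  fixes w :: "real \<Rightarrow> real"
  assumes cont: "continuous_on {0..T} w"
    and step: "\<And>t. t \<in> {0..T} \<Longrightarrow> (\<And>s. 0 \<le> s \<Longrightarrow> s < t \<Longrightarrow> w s < c) \<Longrightarrow> w t < c"
    and t: "t \<in> {0..T}"
  shows "w t < c"
proof (rule ccontr)
  assume "\<not> w t < c"
  then obtain m where m: "m \<in> {0..T}" "c \<le> w m" "\<And>s. s \<in> {0..T} \<Longrightarrow> c \<le> w s \<Longrightarrow> m \<le> s"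
    using first_time_above[OF cont] t by (metis not_less)
  have "w m < c"
  proof (rule step[OF m(1)])
    show "w s < c" if "0 \<le> s" "s < m" for s using m(1) m(3)[of s] that by (cases "c \<le> w s") auto
  qed
  then show False using m(2) by simp
qed

text \<open>Picard iteration, made uniformly convergent on the whole of \<open>[0,T]\<close> at once by the weight
  \<open>exp (2 L t)\<close>.\<close>

lemma picard:
  fixes g :: "real \<Rightarrow> 'a::banach \<Rightarrow> 'a"
  assumes T: "0 \<le> T" and L: "0 < L"
    and lip: "\<And>t x y. t \<in> {0..T} \<Longrightarrow> norm (g t x - g t y) \<le> L * norm (x - y)"
    and cont: "\<And>u. continuous_on {0..T} u \<Longrightarrow> continuous_on {0..T} (\<lambda>t. g t (u t))"
  obtains u where "u 0 = x0" "\<And>t. t \<in> {0..T} \<Longrightarrow> (u has_vector_derivative g t (u t)) (at t within {0..T})"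
proof -
  define P where "P u t = x0 + integral {0..t} (\<lambda>s. g s (u s))" for u t
  define U where "U n = (P ^^ n) (\<lambda>_. x0)" for n
  have U0: "U 0 = (\<lambda>_. x0)" and US: "U (Suc n) = P (U n)" for n by (auto simp: U_def)
  have UP: "U (Suc n) t = x0 + integral {0..t} (\<lambda>s. g s (U n s))" for n t by (simp add: US P_def)
  have Pder: "(P u has_vector_derivative g t (u t)) (at t within {0..T})"
    if "continuous_on {0..T} u" "t \<in> {0..T}" for u t
    unfolding P_def[abs_def]
    by (auto intro!: derivative_eq_intros integral_has_vector_derivative cont that)
  have contU: "continuous_on {0..T} (U n)" for n
  proof (induction n)
    case (Suc n)
    show ?case unfolding US by (rule continuous_on_vector_derivative[OF Pder[OF Suc]])
  qed (simp add: U0)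
  have "bounded ((\<lambda>t. norm (g t x0)) ` {0..T})"
    by (intro compact_imp_bounded compact_continuous_image continuous_on_norm cont) auto
  then obtain B where B: "\<forall>t\<in>{0..T}. norm (g t x0) \<le> B" unfolding bounded_iff by auto
  define C where "C = (\<bar>B\<bar> + 1) / L"
  have C: "C > 0" using L by (auto simp: C_def add_nonneg_pos)
  have CL: "norm (g t x0) \<le> C * L" if "t \<in> {0..T}" for t
    using L B[rule_format, OF that] by (simp add: C_def)
  have diff: "norm (U (Suc n) t - U n t) \<le> C * (1/2)^n * exp (2 * L * t)" if "t \<in> {0..T}" for n t
    using that
  proof (induction n arbitrary: t)
    case 0
    have "norm (integral {0..t} (\<lambda>s. g s x0)) \<le> integral {0..t} (\<lambda>s. C * L)"
      using 0 CL continuous_on_subset[OF cont[of "\<lambda>_. x0"]]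
      by (intro integral_norm_bound_integral integrable_continuous_real) auto
    also have "\<dots> = C * (L * t)" using 0 by simp
    also have "\<dots> \<le> C * exp (2 * L * t)"
    proof -
      have "L * t \<le> 1 + 2 * L * t" using L 0 by auto
      also have "\<dots> \<le> exp (2 * L * t)" by (rule exp_ge_add_one_self)
      finally show ?thesis using C by auto
    qed
    finally show ?case by (simp add: US U0 P_def)
  next
    case (Suc n)
    have sub: "{0..t} \<subseteq> {0..T}" using Suc by auto
    have int: "(\<lambda>s. g s (U k s)) integrable_on {0..t}" for k
      by (intro integrable_continuous_real continuous_on_subset[OF cont[OF contU] sub])
    have hi: "((\<lambda>s. C * (1/2)^n * L * exp (2 * L * s)) has_integral
        C * (1/2)^Suc n * exp (2 * L * t) - C * (1/2)^Suc n * exp (2 * L * 0)) {0..t}"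
      using Suc.prems L
      by (intro fundamental_theorem_of_calculus)
         (auto intro!: derivative_eq_intros simp flip: has_real_derivative_iff_has_vector_derivative)
    have "norm (U (Suc (Suc n)) t - U (Suc n) t)
        = norm (integral {0..t} (\<lambda>s. g s (U (Suc n) s) - g s (U n s)))"
      unfolding UP[of "Suc n" t] UP[of n t] using int by (simp add: Henstock_Kurzweil_Integration.integral_diff)
    also have "\<dots> \<le> integral {0..t} (\<lambda>s. C * (1/2)^n * L * exp (2 * L * s))"
    proof (intro integral_norm_bound_integral)
      show "norm (g s (U (Suc n) s) - g s (U n s)) \<le> C * (1/2)^n * L * exp (2 * L * s)" if "s \<in> {0..t}" for s
      proof -
        have "norm (g s (U (Suc n) s) - g s (U n s)) \<le> L * norm (U (Suc n) s - U n s)"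
          using sub that by (intro lip) auto
        also have "\<dots> \<le> L * (C * (1/2)^n * exp (2 * L * s))"
          using sub that L by (intro mult_left_mono Suc.IH) auto
        finally show ?thesis by (simp add: mult_ac)
      qed
    qed (use hi int in \<open>auto intro!: integrable_diff\<close>)
    also have "\<dots> = C * (1/2)^Suc n * exp (2 * L * t) - C * (1/2)^Suc n" using integral_unique[OF hi] by simp
    also have "\<dots> \<le> C * (1/2)^Suc n * exp (2 * L * t)" using C by simp
    finally show ?case .
  qed
  define M where "M = C * exp (2 * L * T)"
  have "uniform_limit {0..T} (\<lambda>n t. \<Sum>i<n. U (Suc i) t - U i t) (\<lambda>t. suminf (\<lambda>i. U (Suc i) t - U i t)) sequentially"
  proof (rule Weierstrass_m_test)
    show "norm (U (Suc n) t - U n t) \<le> M * (1/2)^n" if "t \<in> {0..T}" for n t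
    proof -
      have "C * (1/2)^n * exp (2 * L * t) \<le> C * (1/2)^n * exp (2 * L * T)"
        using that C L by (intro mult_left_mono) auto
      then show ?thesis using diff[OF that, of n] by (simp add: M_def mult_ac)
    qed
    show "summable (\<lambda>n. M * (1/2)^n)" by (intro summable_mult summable_geometric) auto
  qed
  moreover define u where "u t = x0 + suminf (\<lambda>i. U (Suc i) t - U i t)" for t
  moreover have "(\<Sum>i<n. U (Suc i) t - U i t) = U n t - x0" for n t
    using sum_lessThan_telescope[of "\<lambda>i. U i t" n] by (simp add: U0)
  ultimately have lim: "uniform_limit {0..T} U u sequentially"
    by (simp add: uniform_limit_iff dist_norm algebra_simps)
  have contu: "continuous_on {0..T} u"
    by (rule uniform_limit_theorem[OF _ lim]) (auto simp: contU)
  have fixpt: "u t = P u t" if t: "t \<in> {0..T}" for t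
  proof -
    have sub: "{0..t} \<subseteq> {0..T}" using t by auto
    have "uniform_limit {0..t} (\<lambda>n s. g s (U n s)) (\<lambda>s. g s (u s)) sequentially"
    proof (rule uniform_limitI)
      fix e :: real assume e: "0 < e"
      have "\<forall>\<^sub>F n in sequentially. \<forall>x\<in>{0..T}. dist (U n x) (u x) < e / L"
        using lim e L by (auto simp: uniform_limit_iff)
      then show "\<forall>\<^sub>F n in sequentially. \<forall>x\<in>{0..t}. dist (g x (U n x)) (g x (u x)) < e"
      proof eventually_elim
        case (elim n)
        show ?case
        proof
          fix x assume "x \<in> {0..t}"
          then have x: "x \<in> {0..T}" using sub by auto
          have "dist (g x (U n x)) (g x (u x)) \<le> L * dist (U n x) (u x)" using lip[OF x] by (simp add: dist_norm)
          also have "\<dots> < e" using elim x L by (auto simp: field_simps)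
          finally show "dist (g x (U n x)) (g x (u x)) < e" .
        qed
      qed
    qed
    then have "((\<lambda>n. g s (U n s)) \<longlonglongrightarrow> g s (u s))" if "s \<in> {0..t}" for s
      using that by (rule tendsto_uniform_limitI)
    have "(\<lambda>n. integral {0..t} (\<lambda>s. g s (U n s))) \<longlonglongrightarrow> integral {0..t} (\<lambda>s. g s (u s))"
    proof -
      obtain I J where I: "\<And>n. ((\<lambda>s. g s (U n s)) has_integral I n) {0..t}" and J: "((\<lambda>s. g s (u s)) has_integral J) {0..t}"
        and "(I \<longlongrightarrow> J) sequentially"
        by (rule uniform_limit_integral[OF \<open>uniform_limit {0..t} _ _ _\<close>])
           (auto intro: continuous_on_subset[OF cont[OF contU] sub])
      then show ?thesis using integral_unique[OF I] integral_unique[OF J] by simp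
    qed
    then have "(\<lambda>n. U (Suc n) t) \<longlonglongrightarrow> P u t" unfolding US P_def by (intro tendsto_intros)
    moreover have "(\<lambda>n. U (Suc n) t) \<longlonglongrightarrow> u t"
      using tendsto_uniform_limitI[OF lim t] LIMSEQ_Suc by blast
    ultimately show ?thesis using LIMSEQ_unique by blast
  qed
  show ?thesis
  proof (rule that[of u])
    show "u 0 = x0" using fixpt[of 0] T by (simp add: P_def)
    show "(u has_vector_derivative g t (u t)) (at t within {0..T})" if "t \<in> {0..T}" for t
      by (rule has_vector_derivative_transform[OF that _ Pder[OF contu that]]) (simp add: fixpt)
  qed
qed

text \<open>Serves to bound derivatives of the flow, and of increments along it, by comparing nearby
  trajectories instead of estimating solutions of the variational equation.\<close>

lemma lipschitz_imp_derivative_bound: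
  fixes g :: "'a::real_normed_vector \<Rightarrow> 'b::real_normed_vector"
  assumes der: "(g has_derivative D) (at x)" and d: "0 < d"
    and lip: "\<And>y. norm (y - x) < d \<Longrightarrow> norm (g y - g x) \<le> B * norm (y - x)"
  shows "norm (D h) \<le> B * norm h"
proof -
  interpret D: bounded_linear D using der by (rule has_derivative_bounded_linear)
  show ?thesis
  proof (cases "h = 0")
    case False
    have "norm (D h) \<le> B * norm h + e" if e: "0 < e" for e
    proof -
      define e' where "e' = e / norm h"
      have "e' > 0" using e False by (simp add: e'_def)
      then obtain d' where d': "d' > 0"
        "\<And>y. norm (y - x) < d' \<Longrightarrow> norm (g y - g x - D (y - x)) \<le> e' * norm (y - x)"
        using der unfolding has_derivative_at_alt by blast
      define t where "t = min d d' / 2 / norm h"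
      have t: "t > 0" "t * norm h < d" "t * norm h < d'"
        using d d' False by (auto simp: t_def min_def)
      let ?y = "x + t *\<^sub>R h"
      have "norm (D (t *\<^sub>R h)) \<le> norm (g ?y - g x) + norm (g ?y - g x - D (t *\<^sub>R h))"
        by (metis norm_minus_commute norm_triangle_sub add.commute)
      also have "\<dots> \<le> B * (t * norm h) + e' * (t * norm h)"
        using d'(2)[of ?y] lip[of ?y] t by auto
      finally have "t * norm (D h) \<le> t * (B * norm h + e)"
        using t False by (simp add: D.scaleR e'_def algebra_simps)
      then show ?thesis using t by simp
    qed
    then show ?thesis by (rule field_le_epsilon)
  qed (simp add: D.zero)
qed

section \<open>Smooth flows\<close>

text \<open>With a positive \<open>c\<close> this gives injectivity of the derivative of the
  flow.\<close>

lemma lower_bound_imp_derivative_bound: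
  fixes g :: "'a::real_normed_vector \<Rightarrow> 'b::real_normed_vector"
  assumes der: "(g has_derivative D) (at x)" and d: "0 < d"
    and low: "\<And>y. norm (y - x) < d \<Longrightarrow> c * norm (y - x) \<le> norm (g y - g x)"
  shows "c * norm h \<le> norm (D h)"
proof -
  interpret D: bounded_linear D using der by (rule has_derivative_bounded_linear)
  show ?thesis
  proof (cases "h = 0")
    case False
    have "c * norm h \<le> norm (D h) + e" if e: "0 < e" for e
    proof -
      define e' where "e' = e / norm h"
      have "e' > 0" using e False by (simp add: e'_def)
      then obtain d' where d': "d' > 0"
        "\<And>y. norm (y - x) < d' \<Longrightarrow> norm (g y - g x - D (y - x)) \<le> e' * norm (y - x)"
        using der unfolding has_derivative_at_alt by blast
      define t where "t = min d d' / 2 / norm h"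
      have t: "t > 0" "t * norm h < d" "t * norm h < d'"
        using d d' False by (auto simp: t_def min_def)
      let ?y = "x + t *\<^sub>R h"
      have "c * (t * norm h) \<le> norm (g ?y - g x)" using low[of ?y] t by auto
      also have "\<dots> \<le> norm (D (t *\<^sub>R h)) + norm (g ?y - g x - D (t *\<^sub>R h))"
        by (metis norm_triangle_sub)
      also have "\<dots> \<le> norm (D (t *\<^sub>R h)) + e' * (t * norm h)"
        using d'(2)[of ?y] t by auto
      finally have "t * (c * norm h) \<le> t * (norm (D h) + e)"
        using t False by (simp add: D.scaleR e'_def algebra_simps)
      then show ?thesis using t by simp
    qed
    then show ?thesis by (rule field_le_epsilon)
  qed (simp add: D.zero)
qed

text \<open>The usual route to differentiability below: since the derivative of \<open>f\<close> is
  locally Lipschitz, the linearization errors of the flow and of the section coordinates are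
  quadratic.\<close>

lemma quadratic_error_imp_has_derivative:
  assumes lin: "bounded_linear D" and d: "0 < d"
    and quad: "\<And>y. norm (y - x) < d \<Longrightarrow> norm (g y - g x - D (y - x)) \<le> E * (norm (y - x))\<^sup>2"
  shows "(g has_derivative D) (at x)"
  unfolding has_derivative_at_alt
proof (intro conjI allI impI)
  fix e :: real assume e: "0 < e"
  have E: "E * y \<le> \<bar>E\<bar> * y" if "0 \<le> y" for y using that by (intro mult_right_mono) auto
  show "\<exists>d>0. \<forall>y. norm (y - x) < d \<longrightarrow> norm (g y - g x - D (y - x)) \<le> e * norm (y - x)"
  proof (intro exI[of _ "min d (e / (\<bar>E\<bar> + 1))"] conjI allI impI)
    fix y assume y: "norm (y - x) < min d (e / (\<bar>E\<bar> + 1))"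
    then have "norm (y - x) * (\<bar>E\<bar> + 1) < e" by (auto simp: pos_less_divide_eq)
    then have "E * norm (y - x) \<le> e"
      using E[of "norm (y - x)"] by (simp add: algebra_simps del: norm_ge_zero) (smt (verit) norm_ge_zero)
    then have "E * norm (y - x)^2 \<le> e * norm (y - x)"
      by (simp add: power2_eq_square mult.assoc[symmetric] mult_right_mono)
    then show "norm (g y - g x - D (y - x)) \<le> e * norm (y - x)" using quad[of y] y by auto
  qed (use e d in auto)
qed (rule lin)

lemma mean_value_norm:
  fixes g :: "real \<Rightarrow> 'a::real_normed_vector"
  assumes ab: "a \<le> b"
    and der: "\<And>t. t \<in> {a..b} \<Longrightarrow> (g has_vector_derivative g' t) (at t within {a..b})"
    and B: "\<And>t. t \<in> {a..b} \<Longrightarrow> norm (g' t) \<le> B"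
  shows "norm (g b - g a) \<le> B * (b - a)"
proof -
  have "norm (g b - g a) \<le> B * norm (b - a)"
  proof (rule differentiable_bound[of "{a..b}" _ "\<lambda>t h. h *\<^sub>R g' t"])
    show "onorm (\<lambda>h. h *\<^sub>R g' t) \<le> B" if "t \<in> {a..b}" for t
      using B[OF that] by (simp add: onorm_scaleR_left[OF bounded_linear_ident] onorm_id)
  qed (use ab der in \<open>auto simp: has_vector_derivative_def\<close>)
  then show ?thesis using ab by simp
qed

text \<open>The Lipschitz property of \<open>f'\<close> on balls is what C2 contributes; it yields
  quadratic Taylor remainders. \<open>X\<close> is constrained for nonnegative times only, and its
  derivative at time 0 is one-sided.\<close>

locale smooth_flow =
  fixes f :: "'a::euclidean_space \<Rightarrow> 'a" and f' :: "'a \<Rightarrow> 'a \<Rightarrow>\<^sub>L 'a" and X :: "'a \<Rightarrow> real \<Rightarrow> 'a"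
  assumes f_der: "(f has_derivative blinfun_apply (f' x)) (at x)"
    and f'_lip: "\<exists>L. \<forall>x\<in>cball 0 R. \<forall>y\<in>cball 0 R. norm (f' x - f' y) \<le> L * norm (x - y)"
    and X_0 [simp]: "X x 0 = x"
    and X_der: "0 \<le> t \<Longrightarrow> (X x has_vector_derivative f (X x t)) (at t within {0..})"
begin

lemma f_cont: "continuous_on S f"
  by (rule has_derivative_continuous_on[OF has_derivative_at_withinI[OF f_der]])

lemma f'_cont: "continuous_on (cball 0 R) f'"
proof -
  obtain L where L: "norm (f' x - f' y) \<le> L * norm (x - y)" if "x \<in> cball 0 R" "y \<in> cball 0 R" for x y
    using f'_lip[of R] by blast
  have "dist (f' x) (f' y) \<le> \<bar>L\<bar> * dist x y" if "x \<in> cball 0 R" "y \<in> cball 0 R" for x y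
    unfolding dist_norm by (rule order_trans[OF L[OF that] mult_right_mono]) auto
  then have "\<bar>L\<bar>-lipschitz_on (cball 0 R) f'" by (intro lipschitz_onI) auto
  then show ?thesis by (rule lipschitz_on_continuous_on)
qed

lemma f'_bound: obtains B where "0 < B" "\<And>x. x \<in> cball 0 R \<Longrightarrow> norm (f' x) \<le> B"
proof -
  have "compact (f' ` cball 0 R)" by (intro compact_continuous_image f'_cont) auto
  then obtain B where "0 < B" "\<forall>y\<in>f' ` cball 0 R. norm y \<le> B"
    using compact_imp_bounded bounded_pos by blast
  then show ?thesis using that by blast
qed

lemma f_lip:
  obtains L where "0 < L"
    "\<And>x y. x \<in> cball 0 R \<Longrightarrow> y \<in> cball 0 R \<Longrightarrow> norm (f x - f y) \<le> L * norm (x - y)"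
proof -
  obtain B where B: "0 < B" "\<And>x. x \<in> cball 0 R \<Longrightarrow> norm (f' x) \<le> B" using f'_bound by blast
  have "norm (f x - f y) \<le> B * norm (x - y)" if "x \<in> cball 0 R" "y \<in> cball 0 R" for x y
    by (rule differentiable_bound[OF convex_cball has_derivative_at_withinI[OF f_der] _ that])
      (use B in \<open>simp add: norm_blinfun.rep_eq[symmetric]\<close>)
  then show ?thesis using that B by blast
qed

lemma f_taylor:
  obtains C where "0 < C" "\<And>x y. x \<in> cball 0 R \<Longrightarrow> y \<in> cball 0 R \<Longrightarrow>
    norm (f x - f y - f' y (x - y)) \<le> C * norm (x - y)^2"
proof -
  obtain L where L: "\<And>x y. x \<in> cball 0 R \<Longrightarrow> y \<in> cball 0 R \<Longrightarrow> norm (f' x - f' y) \<le> L * norm (x - y)"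
    using f'_lip by blast
  define C where "C = \<bar>L\<bar> + 1"
  have "norm (f x - f y - f' y (x - y)) \<le> C * norm (x - y)^2"
    if xy: "x \<in> cball 0 R" "y \<in> cball 0 R" for x y
  proof -
    have seg: "y + t *\<^sub>R (x - y) \<in> cball 0 R" if "t \<in> {0..1}" for t
      using convexD_alt[OF convex_cball xy(2,1), of t] that by (simp add: algebra_simps)
    have "norm (f x - f y - f' y (x - y)) \<le> norm (x - y) * (C * norm (x - y))"
    proof (rule differentiable_bound_linearization[where S="(\<lambda>t. y + t *\<^sub>R (x - y)) ` {0..1}" and f'="\<lambda>x. blinfun_apply (f' x)"])
      show "onorm (blinfun_apply (f' z) - blinfun_apply (f' y)) \<le> C * norm (x - y)"
        if z: "z \<in> (\<lambda>t. y + t *\<^sub>R (x - y)) ` {0..1}" for z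
      proof -
        obtain t where t: "t \<in> {0..1}" "z = y + t *\<^sub>R (x - y)" using z by blast
        have "norm (f' z - f' y) \<le> L * norm (z - y)" using L seg t xy by blast
        also have "\<dots> \<le> C * norm (x - y)" using t(1)
          by (intro mult_mono) (auto simp: t(2) C_def mult_left_le_one_le)
        finally show ?thesis by (simp add: norm_blinfun.rep_eq fun_diff_def blinfun.diff_left[abs_def])
      qed
    qed (auto intro: has_derivative_at_withinI f_der)
    then show ?thesis by (simp add: power2_eq_square mult_ac)
  qed
  then show ?thesis using that[of C] by (auto simp: C_def)
qed

text \<open>The nonlinear part of \<open>f\<close> has a Lipschitz constant proportional to the
  distance from 0: Taylor expansion at \<open>y\<close> leaves a quadratic error, and
  \<open>f' y - f' 0\<close> is of order |y|. The factor \<open>norm x + norm y\<close> later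
  supplies one of the two decaying factors of an increment.\<close>

lemma remainder_lip_ball:
  assumes R: "0 \<le> R"
  obtains C where "0 < C" "\<And>x y. x \<in> cball 0 R \<Longrightarrow> y \<in> cball 0 R \<Longrightarrow>
    norm ((f x - f' 0 x) - (f y - f' 0 y)) \<le> C * (norm x + norm y) * norm (x - y)"
proof -
  obtain C where C: "0 < C" "\<And>x y. x \<in> cball 0 R \<Longrightarrow> y \<in> cball 0 R \<Longrightarrow>
    norm (f x - f y - f' y (x - y)) \<le> C * norm (x - y)^2" using f_taylor by blast
  obtain L where L: "\<forall>x\<in>cball 0 R. \<forall>y\<in>cball 0 R. norm (f' x - f' y) \<le> L * norm (x - y)"
    using f'_lip by blast
  show ?thesis
  proof (rule that[of "C + \<bar>L\<bar>"])
    fix x y :: 'a assume b: "x \<in> cball 0 R" "y \<in> cball 0 R"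
    have "norm (f x - f y - f' y (x - y)) \<le> C * norm (x - y)^2" by (rule C(2)[OF b])
    also have "\<dots> \<le> C * ((norm x + norm y) * norm (x - y))"
      using C(1) norm_triangle_ineq4[of x y] unfolding power2_eq_square by (intro mult_left_mono mult_right_mono) auto
    finally have 1: "norm (f x - f y - f' y (x - y)) \<le> C * ((norm x + norm y) * norm (x - y))" .
    have "norm (f' y - f' 0) \<le> L * norm (y - 0)" by (rule L[rule_format]) (use b R in auto)
    also have "\<dots> \<le> \<bar>L\<bar> * (norm x + norm y)" by (intro mult_mono) auto
    finally have "norm ((f' y - f' 0) (x - y)) \<le> \<bar>L\<bar> * (norm x + norm y) * norm (x - y)"
      using norm_blinfun[of "f' y - f' 0" "x - y"] by (meson mult_right_mono norm_ge_zero order_trans)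
    from norm_triangle_mono[OF 1 this]
    have "norm (f x - f y - f' y (x - y) + (f' y - f' 0) (x - y)) \<le> (C + \<bar>L\<bar>) * (norm x + norm y) * norm (x - y)"
      by (simp add: algebra_simps)
    moreover have "f x - f y - f' y (x - y) + (f' y - f' 0) (x - y) = (f x - f' 0 x) - (f y - f' 0 y)"
      by (simp add: blinfun.diff_left blinfun.diff_right)
    ultimately show "norm ((f x - f' 0 x) - (f y - f' 0 y)) \<le> (C + \<bar>L\<bar>) * (norm x + norm y) * norm (x - y)"
      by simp
  qed (use C in auto)
qed

lemma linear_f'0: "linear (blinfun_apply (f' 0))"
  using blinfun.bounded_linear_right bounded_linear.linear by blast

section \<open>Comparison of solution curves and the flow map\<close>

definition curve :: "(real \<Rightarrow> 'a) \<Rightarrow> real \<Rightarrow> bool" where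
  "curve u T \<longleftrightarrow> (\<forall>s\<in>{0..T}. (u has_vector_derivative f (u s)) (at s within {0..T}))"

lemma curveD: "curve u T \<Longrightarrow> s \<in> {0..T} \<Longrightarrow> (u has_vector_derivative f (u s)) (at s within {0..T})"
  by (simp add: curve_def)

lemma curve_subset: "curve u T \<Longrightarrow> t \<le> T \<Longrightarrow> curve u t"
  unfolding curve_def
proof
  fix s assume u: "\<forall>s\<in>{0..T}. (u has_vector_derivative f (u s)) (at s within {0..T})" and "t \<le> T" "s \<in> {0..t}"
  then have "(u has_vector_derivative f (u s)) (at s within {0..T})" by auto
  then show "(u has_vector_derivative f (u s)) (at s within {0..t})"
    by (rule has_vector_derivative_within_subset) (use \<open>t \<le> T\<close> in auto)
qed

lemma curve_continuous: "curve u T \<Longrightarrow> continuous_on {0..T} u"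
  by (rule continuous_on_vector_derivative[OF curveD])

lemma X_shift_der:
  assumes "0 \<le> a" "0 \<le> s"
  shows "((\<lambda>s. X x (a + s)) has_vector_derivative f (X x (a + s))) (at s within {0..})"
proof -
  have "((X x \<circ> (\<lambda>s. a + s)) has_vector_derivative 1 *\<^sub>R f (X x (a + s))) (at s within {0..})"
    using assms
    by (intro vector_diff_chain_within has_vector_derivative_within_subset[OF X_der])
       (auto intro!: derivative_eq_intros)
  then show ?thesis by (simp add: o_def)
qed

lemma curve_X_shift: "0 \<le> a \<Longrightarrow> curve (\<lambda>s. X x (a + s)) T"
  unfolding curve_def by (auto intro!: has_vector_derivative_within_subset[OF X_shift_der])

lemma curve_X: "curve (X x) T" using curve_X_shift[of 0 x T] by simp

lemma X_cont_time: "continuous_on {0..T} (X x)" by (rule curve_continuous[OF curve_X])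

lemma sq_dist_der:
  assumes "curve u T" "curve v T" "s \<in> {0..T}"
  shows "((\<lambda>s. (norm (u s - v s))\<^sup>2) has_real_derivative 2 * ((u s - v s) \<bullet> (f (u s) - f (v s))))
    (at s within {0..T})"
  unfolding power2_norm_eq_inner has_real_derivative_iff_has_vector_derivative
  by (rule has_vector_derivative_eq_rhs,
      rule bounded_bilinear.has_vector_derivative[OF bounded_bilinear_inner],
      (rule has_vector_derivative_diff curveD assms)+) (simp add: inner_commute)

text \<open>Gronwall for the squared distance, which is differentiable also where the curves meet.
  The lower bound is as important as the upper one: it stands in for backward solutions.\<close>

lemma curves_close:
  assumes u: "curve u T" and v: "curve v T" and T: "0 \<le> T"
    and lip: "\<And>s. 0 < s \<Longrightarrow> s < T \<Longrightarrow> norm (f (u s) - f (v s)) \<le> L * norm (u s - v s)"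
  shows "norm (u T - v T) \<le> exp (L * T) * norm (u 0 - v 0)"
    and "exp (- L * T) * norm (u 0 - v 0) \<le> norm (u T - v T)"
proof -
  have *: "\<bar>2 * ((u s - v s) \<bullet> (f (u s) - f (v s)))\<bar> \<le> 2 * L * (norm (u s - v s))\<^sup>2"
    if "0 < s" "s < T" for s
  proof -
    have "\<bar>(u s - v s) \<bullet> (f (u s) - f (v s))\<bar> \<le> norm (u s - v s) * (L * norm (u s - v s))"
      by (rule order_trans[OF Cauchy_Schwarz_ineq2 mult_left_mono[OF lip[OF that]]]) auto
    then show ?thesis by (simp add: power2_eq_square mult_ac abs_mult)
  qed
  have "(norm (u T - v T))\<^sup>2 \<le> exp (2 * L * (T - 0)) * (norm (u 0 - v 0))\<^sup>2"
    by (rule growth_le[OF T sq_dist_der[OF u v]]) (use * in \<open>auto simp: abs_le_iff\<close>)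
  also have "\<dots> = (exp (L * T) * norm (u 0 - v 0))\<^sup>2"
    by (simp add: power_mult_distrib exp_double[symmetric] mult.assoc)
  finally show "norm (u T - v T) \<le> exp (L * T) * norm (u 0 - v 0)" by (rule power2_le_imp_le) auto
  have "exp (- 2 * L * (T - 0)) * (norm (u 0 - v 0))\<^sup>2 \<le> (norm (u T - v T))\<^sup>2"
  proof (rule growth_ge[OF T sq_dist_der[OF u v]])
    show "- 2 * L * (norm (u s - v s))\<^sup>2 \<le> 2 * ((u s - v s) \<bullet> (f (u s) - f (v s)))" if "0 < s" "s < T" for s
      using *[OF that] by linarith
  qed
  also have "exp (- 2 * L * (T - 0)) * (norm (u 0 - v 0))\<^sup>2 = (exp (- L * T) * norm (u 0 - v 0))\<^sup>2"
    by (simp add: power_mult_distrib exp_double[symmetric] mult.assoc)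
  finally show "exp (- L * T) * norm (u 0 - v 0) \<le> norm (u T - v T)" by (rule power2_le_imp_le) auto
qed

lemma curve_bounded:
  assumes "curve u T"
  obtains R where "\<And>s. s \<in> {0..T} \<Longrightarrow> norm (u s) \<le> R"
proof -
  have "bounded (u ` {0..T})"
    by (intro compact_imp_bounded compact_continuous_image curve_continuous assms) auto
  then obtain R where "\<forall>x\<in>u ` {0..T}. norm x \<le> R" unfolding bounded_iff by blast
  then show ?thesis by (intro that[of R]) auto
qed

text \<open>Equality at one end forces equality at the other. Applied to trajectories, their time
  shifts, the constant solution 0 and a reversed backward solution, it yields the semigroup law,
  injectivity of the flow and the passage backward to the section.\<close>

lemma curves_eq_iff:
  assumes u: "curve u T" and v: "curve v T" and T: "0 \<le> T"
  shows "u T = v T \<longleftrightarrow> u 0 = v 0"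
proof -
  obtain R1 where R1: "\<And>s. s \<in> {0..T} \<Longrightarrow> norm (u s) \<le> R1" using curve_bounded[OF u] by blast
  obtain R2 where R2: "\<And>s. s \<in> {0..T} \<Longrightarrow> norm (v s) \<le> R2" using curve_bounded[OF v] by blast
  obtain L where L: "\<And>x y. x \<in> cball 0 (max R1 R2) \<Longrightarrow> y \<in> cball 0 (max R1 R2) \<Longrightarrow>
      norm (f x - f y) \<le> L * norm (x - y)" using f_lip by blast
  have "norm (f (u s) - f (v s)) \<le> L * norm (u s - v s)" if "0 < s" "s < T" for s
    using R1[of s] R2[of s] that by (intro L) (auto simp: le_max_iff_disj)
  from curves_close[OF u v T this] show ?thesis by (auto simp: mult_le_0_iff)
qed

lemma X_add: "0 \<le> s \<Longrightarrow> 0 \<le> t \<Longrightarrow> X (X x s) t = X x (s + t)"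
  using curves_eq_iff[OF curve_X[of "X x s" t] curve_X_shift[of s x t]] by simp

lemma X_inj: "0 \<le> t \<Longrightarrow> X x t = X y t \<longleftrightarrow> x = y"
  using curves_eq_iff[OF curve_X[of x t] curve_X[of y t]] by simp

text \<open>The Lipschitz constant of \<open>f\<close> is local, so neighbouring trajectories are
  first confined to distance 1 from the reference trajectory; only then does the two-sided
  comparison apply.\<close>

lemma X_near:
  assumes T: "0 \<le> T"
  obtains d R K c where "0 < d" "0 < K" "0 < c"
    "\<And>y s. norm (y - x) < d \<Longrightarrow> s \<in> {0..T} \<Longrightarrow> X y s \<in> cball 0 R"
    "\<And>y s. norm (y - x) < d \<Longrightarrow> s \<in> {0..T} \<Longrightarrow> norm (X y s - X x s) \<le> K * norm (y - x)"
    "\<And>y. norm (y - x) < d \<Longrightarrow> c * norm (y - x) \<le> norm (X y T - X x T)"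
proof -
  obtain R where R: "\<And>s. s \<in> {0..T} \<Longrightarrow> norm (X x s) \<le> R" using curve_bounded[OF curve_X] by blast
  obtain L where L: "0 < L" "\<And>x y. x \<in> cball 0 (R+1) \<Longrightarrow> y \<in> cball 0 (R+1) \<Longrightarrow>
      norm (f x - f y) \<le> L * norm (x - y)" using f_lip by blast
  \<comment> \<open>With this radius the bound exp (L T) |y - x| stays below 1, which closes the
    continuity argument.\<close>
  define d where "d = exp (- L * T)"
  have near: "norm (X y t - X x t) < 1" if y: "norm (y - x) < d" and t: "t \<in> {0..T}" for y t
  proof (rule first_exit[OF _ _ t])
    show "continuous_on {0..T} (\<lambda>t. norm (X y t - X x t))" by (intro continuous_intros X_cont_time)
    fix t assume t: "t \<in> {0..T}" and less: "\<And>s. 0 \<le> s \<Longrightarrow> s < t \<Longrightarrow> norm (X y s - X x s) < 1"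
    have "norm (X y t - X x t) \<le> exp (L * t) * norm (X y 0 - X x 0)"
    proof (rule curves_close(1)[OF curve_X curve_X])
      fix s assume s: "0 < s" "s < t"
      have "norm (X y s) \<le> norm (X x s) + norm (X y s - X x s)" by (rule norm_triangle_sub)
      then show "norm (f (X y s) - f (X x s)) \<le> L * norm (X y s - X x s)"
        using R[of s] less[of s] s t by (intro L) auto
    qed (use t in auto)
    also have "\<dots> \<le> exp (L * T) * norm (y - x)" using t L by (intro mult_mono) auto
    also have "\<dots> < exp (L * T) * d" using y by simp
    also have "\<dots> = 1" by (simp add: d_def flip: exp_add)
    finally show "norm (X y t - X x t) < 1" .
  qed
  have ball: "X y s \<in> cball 0 (R+1)" if "norm (y - x) < d" "s \<in> {0..T}" for y s
    using near[OF that] R[OF that(2)] norm_triangle_sub[of "X y s" "X x s"] by auto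
  have lip: "norm (f (X y s) - f (X x s)) \<le> L * norm (X y s - X x s)"
    if "norm (y - x) < d" "s \<in> {0..T}" for y s
    by (rule L(2)[OF ball[OF that] ball]) (use that in \<open>auto simp: d_def\<close>)
  show ?thesis
  proof (rule that[of d "exp (L * T)" "exp (- L * T)" "R + 1"])
    show "norm (X y s - X x s) \<le> exp (L * T) * norm (y - x)" if y: "norm (y - x) < d" and s: "s \<in> {0..T}" for y s
    proof -
      have "norm (X y s - X x s) \<le> exp (L * s) * norm (X y 0 - X x 0)"
        using s by (intro curves_close(1)[OF curve_X curve_X] lip[OF y]) auto
      also have "\<dots> \<le> exp (L * T) * norm (y - x)" using s L by (intro mult_mono) auto
      finally show ?thesis .
    qed
    show "exp (- L * T) * norm (y - x) \<le> norm (X y T - X x T)" if y: "norm (y - x) < d" for y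
      using curves_close(2)[OF curve_X[of y] curve_X[of x] T lip[OF y]] by auto
  qed (use ball in \<open>auto simp: d_def\<close>)
qed

text \<open>\<open>W\<close> solves the variational equation in the space of bounded operators. The
  deviation of \<open>X y\<close> from the linear prediction obeys the same equation with a
  quadratic inhomogeneity, so it is quadratic by Gronwall. Injectivity comes from the lower distance
  bound.\<close>

lemma X_diff:
  assumes T: "0 \<le> T"
  obtains D where "((\<lambda>y. X y T) has_derivative D) (at x)" "inj D"
proof -
  obtain d R K c where d: "0 < d" "0 < K" "0 < c"
    and ball: "\<And>y s. norm (y - x) < d \<Longrightarrow> s \<in> {0..T} \<Longrightarrow> X y s \<in> cball 0 R"
    and up: "\<And>y s. norm (y - x) < d \<Longrightarrow> s \<in> {0..T} \<Longrightarrow> norm (X y s - X x s) \<le> K * norm (y - x)"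
    and low: "\<And>y. norm (y - x) < d \<Longrightarrow> c * norm (y - x) \<le> norm (X y T - X x T)"
    using X_near[OF T, of x] by metis
  have ballx: "X x s \<in> cball 0 R" if "s \<in> {0..T}" for s using ball[of x] d that by simp
  obtain B where B: "0 < B" "\<And>x. x \<in> cball 0 R \<Longrightarrow> norm (f' x) \<le> B" using f'_bound by blast
  obtain C where C: "0 < C" "\<And>x y. x \<in> cball 0 R \<Longrightarrow> y \<in> cball 0 R \<Longrightarrow>
    norm (f x - f y - f' y (x - y)) \<le> C * norm (x - y)^2" using f_taylor by blast
  obtain W where W0: "W 0 = (id_blinfun :: 'a \<Rightarrow>\<^sub>L 'a)"
    and W: "\<And>s. s \<in> {0..T} \<Longrightarrow> (W has_vector_derivative f' (X x s) o\<^sub>L W s) (at s within {0..T})"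
  proof (rule picard[OF T B(1), of "\<lambda>s w. f' (X x s) o\<^sub>L w" id_blinfun])
    show "norm ((f' (X x t) o\<^sub>L v) - (f' (X x t) o\<^sub>L w)) \<le> B * norm (v - w)"
      if "t \<in> {0..T}" for t and v w :: "'a \<Rightarrow>\<^sub>L 'a"
    proof -
      have "norm (f' (X x t) o\<^sub>L (v - w)) \<le> norm (f' (X x t)) * norm (v - w)"
        by (rule norm_blinfun_compose)
      also have "\<dots> \<le> B * norm (v - w)" using B(2)[OF ballx[OF that]] by (intro mult_right_mono) auto
      finally show ?thesis by (simp add: bounded_bilinear.diff_right[OF bounded_bilinear_blinfun_compose])
    qed
    show "continuous_on {0..T} (\<lambda>t. f' (X x t) o\<^sub>L u t)" if "continuous_on {0..T} u" for u :: "real \<Rightarrow> 'a \<Rightarrow>\<^sub>L 'a"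
      by (intro bounded_bilinear.continuous_on[OF bounded_bilinear_blinfun_compose] that
          continuous_on_compose2[OF f'_cont[of R] X_cont_time]) (use ballx in auto)
  qed blast
  \<comment> \<open>Square root of the Gronwall bound for the squared error. The summand 1 next to 2
    B pays for the cross term: 2 |e| r \<le> |e|^2 + r^2.\<close>
  define E where "E = sqrt (exp ((2 * B + 1) * T) * T) * (C * K^2)"
  have main: "norm (X y T - X x T - W T (y - x)) \<le> E * norm (y - x)^2" if y: "norm (y - x) < d" for y
  proof -
    define e where "e s = X y s - X x s - W s (y - x)" for s
    define r where "r = C * (K * norm (y - x))^2"
    have r: "0 \<le> r" using C by (simp add: r_def)
    let ?e' = "\<lambda>s. f (X y s) - f (X x s) - f' (X x s) (W s (y - x))"
    have eder: "(e has_vector_derivative ?e' s) (at s within {0..T})" if s: "s \<in> {0..T}" for s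
      unfolding e_def[abs_def] using W[OF s]
      by (intro has_vector_derivative_diff curveD[OF curve_X s])
         (auto dest!: bounded_linear.has_vector_derivative[OF blinfun.bounded_linear_left, of W _ _ "y - x"])
    have "(norm (e T))\<^sup>2 \<le> exp ((2 * B + 1) * T) * ((norm (e 0))\<^sup>2 + r\<^sup>2 * T)"
    proof (rule growth_le_affine[OF T, where w' = "\<lambda>s. 2 * (e s \<bullet> ?e' s)"])
      show "((\<lambda>s. (norm (e s))\<^sup>2) has_real_derivative 2 * (e s \<bullet> ?e' s)) (at s within {0..T})"
        if s: "s \<in> {0..T}" for s
        unfolding power2_norm_eq_inner has_real_derivative_iff_has_vector_derivative
        by (rule has_vector_derivative_eq_rhs,
            rule bounded_bilinear.has_vector_derivative[OF bounded_bilinear_inner eder[OF s] eder[OF s]])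
           (simp add: inner_commute)
      fix s assume "0 < s" "s < T"
      then have s: "s \<in> {0..T}" by auto
      let ?q = "f (X y s) - f (X x s) - f' (X x s) (X y s - X x s)"
      have "norm ?q \<le> C * norm (X y s - X x s)^2" using ball[OF y s] ballx[OF s] by (intro C)
      also have "\<dots> \<le> r" unfolding r_def using up[OF y s] C by (intro mult_left_mono power_mono) auto
      finally have q: "norm ?q \<le> r" .
      have "norm (f' (X x s) (e s)) \<le> B * norm (e s)"
        by (rule order_trans[OF norm_blinfun mult_right_mono[OF B(2)[OF ballx[OF s]]]]) simp
      moreover have "?e' s = ?q + f' (X x s) (e s)" by (simp add: e_def blinfun.diff_right)
      ultimately have "norm (?e' s) \<le> r + B * norm (e s)" using q norm_triangle_mono by metis
      then have "e s \<bullet> ?e' s \<le> norm (e s) * (r + B * norm (e s))"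
        by (rule order_trans[OF norm_cauchy_schwarz mult_left_mono]) auto
      moreover have "2 * (norm (e s) * r) \<le> (norm (e s))\<^sup>2 + r\<^sup>2"
        using sum_squares_bound[of "norm (e s)" r] by (simp add: mult.assoc)
      ultimately show "2 * (e s \<bullet> ?e' s) \<le> (2 * B + 1) * (norm (e s))\<^sup>2 + r\<^sup>2"
        by (simp add: power2_eq_square algebra_simps)
    qed (use B in auto)
    moreover have "e 0 = 0" by (simp add: e_def W0)
    moreover have "(E * norm (y - x)^2)^2 = exp ((2 * B + 1) * T) * (r\<^sup>2 * T)"
      using T by (simp add: E_def r_def power_mult_distrib mult_ac)
    ultimately have "(norm (e T))^2 \<le> (E * norm (y - x)^2)^2" by simp
    then have "norm (e T) \<le> E * norm (y - x)^2" by (rule power2_le_imp_le) (use C T in \<open>auto simp: E_def\<close>)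
    then show ?thesis by (simp add: e_def)
  qed
  have der: "((\<lambda>y. X y T) has_derivative blinfun_apply (W T)) (at x)"
    by (rule quadratic_error_imp_has_derivative[OF blinfun.bounded_linear_right d(1) main])
  have "c * norm h \<le> norm (W T h)" for h
    by (rule lower_bound_imp_derivative_bound[OF der d(1) low])
  then have "h = 0" if "W T h = 0" for h using d(3) that by (metis norm_zero norm_le_zero_iff mult_le_0_iff not_le)
  then have "inj (blinfun_apply (W T))"
    by (subst linear_injective_0) (auto intro: bounded_linear.linear blinfun.bounded_linear_right)
  then show ?thesis using der that by blast
qed

lemma X_cont: "0 \<le> t \<Longrightarrow> isCont (\<lambda>y. X y t) x"
  using X_diff has_derivative_continuous by metis

text \<open>A local inverse of the time-t map without a backward flow: the map is continuous and
  injective, so by invariance of domain its range is open and its inverse continuous, and the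
  invertible derivative makes the inverse differentiable.\<close>

lemma X_inverse:
  assumes t: "0 \<le> t"
  obtains g D where "\<forall>\<^sub>F z in nhds (X x t). X (g z) t = z" "g (X x t) = x"
    "(g has_derivative D) (at (X x t))" "inj D"
proof -
  let ?h = "\<lambda>y. X y t"
  have cont: "continuous_on UNIV ?h" using X_cont[OF t] by (simp add: continuous_at_imp_continuous_on)
  have inj: "inj ?h" using X_inj[OF t] by (auto simp: inj_def)
  have op: "open (range ?h)" by (rule invariance_of_domain[OF cont _ inj]) auto
  obtain g where g: "homeomorphism UNIV (range ?h) ?h g"
    using invariance_of_domain_homeomorphism[OF _ cont _ inj] by auto
  then have gh: "g (X y t) = y" for y by (simp add: homeomorphism_def)
  have hg: "X (g z) t = z" if "z \<in> range ?h" for z using g that by (auto simp: homeomorphism_def)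
  obtain D where D: "(?h has_derivative D) (at x)" "inj D" using X_diff[OF t] by blast
  have lin: "linear D" using D(1) has_derivative_linear by blast
  obtain D' where D': "linear D'" "D' \<circ> D = id" using linear_injective_left_inverse[OF lin D(2)] by blast
  have "D \<circ> D' = id" using linear_inverse_left[OF D'(1) lin] D'(2) by simp
  then have "inj D'" by (metis inj_on_id inj_on_imageI2)
  moreover have "(g has_derivative D') (at (X x t))"
  proof (rule has_derivative_inverse_basic_x[where f="?h" and x=x and g=g, OF D(1) _ D'(2) _ gh op])
    show "bounded_linear D'" using D'(1) linear_conv_bounded_linear by blast
    show "continuous (at (X x t)) g"
      using g op by (auto simp: homeomorphism_def continuous_on_eq_continuous_at)
  qed (use hg in auto)
  moreover have "\<forall>\<^sub>F z in nhds (X x t). X (g z) t = z"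
    using op hg by (auto simp: eventually_nhds)
  ultimately show ?thesis using that gh by blast
qed

lemma shift: "smooth_flow (\<lambda>x. f (x + e)) (\<lambda>x. f' (x + e)) (\<lambda>x t. X (x + e) t - e)"
proof
  fix x :: 'a and t R :: real
  show "((\<lambda>x. f (x + e)) has_derivative blinfun_apply (f' (x + e))) (at x)"
  proof -
    have "((\<lambda>x. x + e) has_derivative (\<lambda>h. h)) (at x)" by (auto intro!: derivative_eq_intros)
    from has_derivative_compose[OF this f_der] show ?thesis .
  qed
  obtain L where L: "\<forall>x\<in>cball 0 (R + norm e). \<forall>y\<in>cball 0 (R + norm e). norm (f' x - f' y) \<le> L * norm (x - y)"
    using f'_lip by blast
  have "x + e \<in> cball 0 (R + norm e)" if "x \<in> cball 0 R" for x
    using that norm_triangle_ineq[of x e] by simp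
  then have "norm (f' (x + e) - f' (y + e)) \<le> L * norm ((x + e) - (y + e))"
    if "x \<in> cball 0 R" "y \<in> cball 0 R" for x y
    using L that by blast
  then show "\<exists>L. \<forall>x\<in>cball 0 R. \<forall>y\<in>cball 0 R. norm (f' (x + e) - f' (y + e)) \<le> L * norm (x - y)"
    unfolding add_diff_cancel_right by blast
  show "X (x + e) 0 - e = x" by simp
  show "((\<lambda>t. X (x + e) t - e) has_vector_derivative f (X (x + e) t - e + e)) (at t within {0..})" if "0 \<le> t"
    using X_der[OF that, of "x + e"] by (auto intro!: derivative_eq_intros)
qed

text \<open>Exponential decay of the velocity makes the trajectory Cauchy. The limit is an
  equilibrium because \<open>f\<close> along the trajectory tends both to \<open>f e\<close> and to
  0.\<close>

lemma equilibrium_limit: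
  assumes k: "0 < k" and bound: "\<And>t. 0 \<le> t \<Longrightarrow> norm (f (X x t)) \<le> C * exp (- k * t)"
  obtains e where "f e = 0" "(X x \<longlongrightarrow> e) at_top"
proof -
  have "0 \<le> norm (f x)" by simp
  also have C: "\<dots> \<le> C" using bound[of 0] by simp
  finally have C: "0 \<le> C" .
  have dist: "norm (X x t - X x s) \<le> C / k * exp (- k * s)" if s: "0 \<le> s" "s \<le> t" for s t
  proof (cases "s = t")
    case False
    then have st: "s < t" using s by simp
    have "norm (X x t - X x s) \<le> - (C / k) * exp (- k * t) - (- (C / k) * exp (- k * s))"
    proof (rule differentiable_bound_general[OF st])
      show "continuous_on {s..t} (X x)" by (rule continuous_on_subset[OF X_cont_time[of t]]) (use s in auto)
      show "continuous_on {s..t} (\<lambda>t. - (C / k) * exp (- k * t))" by (intro continuous_intros)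
      fix u assume u: "s < u" "u < t"
      have "at u within {0..} = at u" using u s by (intro at_within_interior) auto
      then show "(X x has_vector_derivative f (X x u)) (at u)" using X_der[of u x] u s by simp
      show "((\<lambda>t. - (C / k) * exp (- k * t)) has_vector_derivative C * exp (- k * u)) (at u)"
        unfolding has_real_derivative_iff_has_vector_derivative[symmetric]
        using k by (auto intro!: derivative_eq_intros)
      show "norm (f (X x u)) \<le> C * exp (- k * u)" using bound u s by simp
    qed
    also have "\<dots> \<le> C / k * exp (- k * s)" using C k by simp
    finally show ?thesis .
  qed (use C k in simp)
  have e0: "((\<lambda>t. D * exp (- k * t)) \<longlongrightarrow> 0) at_top" for D :: real
  proof -
    have "((\<lambda>t. exp (- k * t)) \<longlongrightarrow> 0) at_top"
      using k by (intro filterlim_compose[OF exp_at_bot] filterlim_tendsto_neg_mult_at_bot[OF tendsto_const _ filterlim_ident]) auto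
    then show ?thesis using tendsto_mult_right_zero by blast
  qed
  have "Cauchy (\<lambda>n. X x (real n))"
  proof (rule CauchyI)
    fix d :: real assume "0 < d"
    then have "\<forall>\<^sub>F t in at_top. 2 * (C / k) * exp (- k * t) < d" by (intro order_tendstoD(2)[OF e0])
    then obtain T where T: "\<And>t. T \<le> t \<Longrightarrow> 2 * (C / k) * exp (- k * t) < d" unfolding eventually_at_top_linorder by blast
    define M where "M = nat \<lceil>T\<rceil>"
    have M: "T \<le> real M" unfolding M_def by linarith
    show "\<exists>M. \<forall>m\<ge>M. \<forall>n\<ge>M. norm (X x (real m) - X x (real n)) < d"
    proof (intro exI[of _ M] allI impI)
      fix m n assume "M \<le> m" "M \<le> n"
      then have "norm (X x m - X x M) \<le> C / k * exp (- k * M)" "norm (X x n - X x M) \<le> C / k * exp (- k * M)"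
        using dist[of "real M" "real m"] dist[of "real M" "real n"] by simp_all
      then have "norm ((X x m - X x M) - (X x n - X x M)) \<le> 2 * (C / k) * exp (- k * M)"
        using norm_triangle_ineq4[of "X x m - X x M" "X x n - X x M"] by linarith
      then show "norm (X x (real m) - X x (real n)) < d" using T[OF M] by simp
    qed
  qed
  then obtain e where e: "(\<lambda>n. X x (real n)) \<longlonglongrightarrow> e" using Cauchy_convergent_iff convergent_def by blast
  have "norm (X x t - e) \<le> C / k * exp (- k * t)" if t: "0 \<le> t" for t
  proof (rule LIMSEQ_le_const2)
    show "(\<lambda>n. norm (X x n - X x t)) \<longlonglongrightarrow> norm (X x t - e)"
      using tendsto_norm[OF tendsto_diff[OF e tendsto_const[of "X x t"]]] by (simp add: norm_minus_commute)
    have "norm (X x n - X x t) \<le> C / k * exp (- k * t)" if "nat \<lceil>t\<rceil> \<le> n" for n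
      by (rule dist[OF t]) (use that in linarith)
    then show "\<exists>N. \<forall>n\<ge>N. norm (X x (real n) - X x t) \<le> C / k * exp (- k * t)" by blast
  qed
  then have "\<forall>\<^sub>F t in at_top. norm (X x t - e) \<le> C / k * exp (- k * t)"
    by (rule eventually_mono[OF eventually_ge_at_top[of 0]])
  from Lim_null_comparison[OF this e0] have lim: "(X x \<longlongrightarrow> e) at_top" by (simp add: LIM_zero_cancel)
  have "((\<lambda>t. f (X x t)) \<longlongrightarrow> f e) at_top"
    using f_cont[of UNIV] by (intro isCont_tendsto_compose[OF _ lim]) (simp add: continuous_on_eq_continuous_at)
  moreover have "\<forall>\<^sub>F t in at_top. norm (f (X x t)) \<le> C * exp (- k * t)"
    using eventually_ge_at_top[of 0] by eventually_elim (rule bound)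
  from Lim_null_comparison[OF this e0] have "((\<lambda>t. f (X x t)) \<longlongrightarrow> 0) at_top" .
  ultimately have "f e = 0" by (intro tendsto_unique[of at_top]) auto
  then show ?thesis using that lim by blast
qed

end

section \<open>Contraction near the equilibrium and the time-section coordinates\<close>

text \<open>The metric is frozen to the constant form \<open>P\<close> near the equilibrium.
  Contraction is available where the form is below 4 c, while the section will be at level c, so
  that points on both sides of the section stay in the region.\<close>

locale local_contraction = smooth_flow f f' X
  for f :: "'a::euclidean_space \<Rightarrow> 'a" and f' X +
  fixes P :: "'a \<Rightarrow>\<^sub>L 'a" and p r c :: real
  assumes f_0: "f 0 = 0"
    and P_sym: "x \<bullet> P y = y \<bullet> P x"
    and p_pos: "0 < p" and P_ge: "p * (norm x)\<^sup>2 \<le> x \<bullet> P x"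
    and r_pos: "0 < r" and c_pos: "0 < c"
    and contracting: "x \<bullet> P x < 4 * c \<Longrightarrow> y \<bullet> P y < 4 * c \<Longrightarrow>
      (x - y) \<bullet> P (f x - f y) \<le> - r * ((x - y) \<bullet> P (x - y))"
begin

definition V :: "'a \<Rightarrow> real" where "V x = x \<bullet> P x"

definition "q = norm P + 1"

lemma q_pos: "0 < q" unfolding q_def by (simp add: add_nonneg_pos)

lemma V_le: "V x \<le> q * (norm x)\<^sup>2"
proof -
  have "V x \<le> norm x * norm (P x)" unfolding V_def by (rule norm_cauchy_schwarz)
  also have "\<dots> \<le> norm x * (norm P * norm x)" by (intro mult_left_mono norm_blinfun) auto
  also have "\<dots> \<le> q * (norm x)\<^sup>2" by (simp add: q_def power2_eq_square algebra_simps)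
  finally show ?thesis .
qed

lemma V_ge: "p * (norm x)\<^sup>2 \<le> V x" using P_ge by (simp add: V_def)

lemma V_0 [simp]: "V 0 = 0" by (simp add: V_def)

lemma V_pos: "x \<noteq> 0 \<Longrightarrow> 0 < V x"
  using V_ge[of x] p_pos by (smt (verit) zero_less_norm_iff zero_less_power mult_pos_pos)

lemma V_nonneg: "0 \<le> V x" using V_pos[of x] by (cases "x = 0") auto

lemma V_add: "V (x + y) = V x + 2 * (x \<bullet> P y) + V y"
  by (simp add: V_def blinfun.add_right inner_add_left inner_add_right P_sym[of y x])

lemma V_cont: "continuous_on S V"
  unfolding V_def[abs_def] by (intro continuous_intros)

lemma norm_le_of_V: "V x \<le> b \<Longrightarrow> norm x \<le> sqrt (b / p)"
  using V_ge[of x] p_pos by (intro real_le_rsqrt) (simp add: field_simps)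

definition "R0 = sqrt (4 * c / p)"

lemma in_cball: "V x \<le> 4 * c \<Longrightarrow> x \<in> cball 0 R0"
  using norm_le_of_V[of x "4 * c"] by (simp add: R0_def)

lemma V_curve_der:
  assumes u: "curve u T" and v: "curve v T" and s: "s \<in> {0..T}"
  shows "((\<lambda>s. V (u s - v s)) has_real_derivative 2 * ((u s - v s) \<bullet> P (f (u s) - f (v s))))
    (at s within {0..T})"
proof -
  have d: "((\<lambda>s. u s - v s) has_vector_derivative f (u s) - f (v s)) (at s within {0..T})"
    by (intro has_vector_derivative_diff curveD u v s)
  show ?thesis unfolding V_def has_real_derivative_iff_has_vector_derivative
    by (rule has_vector_derivative_eq_rhs,
        rule bounded_bilinear.has_vector_derivative[OF bounded_bilinear_inner d
          bounded_linear.has_vector_derivative[OF blinfun.bounded_linear_right d]])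
       (simp add: P_sym)
qed

lemma curve_0: "curve (\<lambda>_. 0) T" by (simp add: curve_def f_0)

lemma X_zero [simp]: "0 \<le> t \<Longrightarrow> X 0 t = 0"
  using curves_eq_iff[OF curve_X[of 0 t] curve_0[of t]] by simp

lemma X_nonzero: "0 \<le> t \<Longrightarrow> x \<noteq> 0 \<Longrightarrow> X x t \<noteq> 0"
  using X_inj[of t x 0] by simp

text \<open>\<open>V\<close> decreases while the curve is in the region, by contraction towards the
  constant solution 0; hence the region cannot be left.\<close>

lemma curve_in_region:
  assumes u: "curve u T" and u0: "V (u 0) < 4 * c" and t: "t \<in> {0..T}"
  shows "V (u t) < 4 * c"
proof (rule first_exit[OF _ _ t])
  show "continuous_on {0..T} (\<lambda>s. V (u s))"
    by (rule continuous_on_compose2[OF V_cont[of UNIV] curve_continuous[OF u]]) auto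
  fix t assume t: "t \<in> {0..T}" and less: "\<And>s. 0 \<le> s \<Longrightarrow> s < t \<Longrightarrow> V (u s) < 4 * c"
  have "V (u t - 0) \<le> V (u 0 - 0)"
  proof (rule nonincreasing_within[where h="\<lambda>s. V (u s - 0)"])
    show "((\<lambda>s. V (u s - 0)) has_real_derivative 2 * ((u s - 0) \<bullet> P (f (u s) - f 0))) (at s within {0..t})"
      if "s \<in> {0..t}" for s
      using V_curve_der[OF curve_subset[OF u] curve_0 that] t by simp
    show "2 * ((u s - 0) \<bullet> P (f (u s) - f 0)) \<le> 0" if "0 < s" "s < t" for s
    proof -
      have "(u s - 0) \<bullet> P (f (u s) - f 0) \<le> - r * V (u s - 0)"
        using contracting[of "u s" 0] less[of s] that c_pos by (simp add: V_def)
      moreover have "0 \<le> r * V (u s - 0)" using r_pos V_nonneg by simp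
      ultimately show ?thesis by linarith
    qed
  qed (use t in auto)
  then show "V (u t) < 4 * c" using u0 by simp
qed

lemma X_in_region: "V x < 4 * c \<Longrightarrow> 0 \<le> t \<Longrightarrow> V (X x t) < 4 * c"
  using curve_in_region[OF curve_X[of x t], of t] by simp

lemma V_diff_decay:
  assumes x: "V x < 4 * c" and y: "V y < 4 * c" and t: "0 \<le> t"
  shows "V (X x t - X y t) \<le> exp (- 2 * r * t) * V (x - y)"
proof -
  have "V (X x t - X y t) \<le> exp (- 2 * r * (t - 0)) * V (X x 0 - X y 0)"
  proof (rule growth_le[OF t V_curve_der[OF curve_X curve_X]])
    show "2 * ((X x s - X y s) \<bullet> P (f (X x s) - f (X y s))) \<le> - 2 * r * V (X x s - X y s)"
      if "0 < s" "s < t" for s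
      using contracting[of "X x s" "X y s"] X_in_region[OF x, of s] X_in_region[OF y, of s] that
      by (simp add: V_def)
  qed
  then show ?thesis by simp
qed

lemma V_decay: "V x < 4 * c \<Longrightarrow> 0 \<le> t \<Longrightarrow> V (X x t) \<le> exp (- 2 * r * t) * V x"
  using V_diff_decay[of x 0 t] c_pos by simp

text \<open>The factor lost when decay of \<open>V\<close> is restated for the norm.\<close>

definition "kap = sqrt (q / p)"

lemma kap_pos: "0 < kap" using q_pos p_pos by (simp add: kap_def)

lemma dist_decay:
  assumes x: "V x < 4 * c" and y: "V y < 4 * c" and t: "0 \<le> t"
  shows "norm (X x t - X y t) \<le> kap * exp (- r * t) * norm (x - y)"
proof -
  have "p * (norm (X x t - X y t))\<^sup>2 \<le> exp (- 2 * r * t) * (q * (norm (x - y))\<^sup>2)"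
    by (rule order_trans[OF V_ge order_trans[OF V_diff_decay[OF x y t] mult_left_mono[OF V_le]]]) auto
  then have "(norm (X x t - X y t))\<^sup>2 \<le> (q / p) * exp (- 2 * r * t) * (norm (x - y))\<^sup>2"
    using p_pos by (simp add: field_simps)
  also have "\<dots> = (kap * exp (- r * t) * norm (x - y))\<^sup>2"
    using p_pos q_pos by (simp add: kap_def power_mult_distrib exp_double[symmetric] mult.assoc)
  finally show ?thesis by (rule power2_le_imp_le) (use kap_pos in auto)
qed

lemma norm_decay: "V x < 4 * c \<Longrightarrow> 0 \<le> t \<Longrightarrow> norm (X x t) \<le> kap * exp (- r * t) * norm x"
  using dist_decay[of x 0 t] c_pos by simp

lemma X_tendsto_0:
  assumes "V x < 4 * c"
  shows "(X x \<longlongrightarrow> 0) at_top"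
proof (rule Lim_null_comparison)
  show "\<forall>\<^sub>F t in at_top. norm (X x t) \<le> kap * exp (- r * t) * norm x"
    using eventually_ge_at_top[of 0] by eventually_elim (rule norm_decay[OF assms])
  have "((\<lambda>t. exp (- r * t)) \<longlongrightarrow> 0) at_top"
    using r_pos by (intro filterlim_compose[OF exp_at_bot] filterlim_tendsto_neg_mult_at_bot[OF tendsto_const _ filterlim_ident]) auto
  then have "((\<lambda>t. kap * exp (- r * t) * norm x) \<longlongrightarrow> kap * 0 * norm x) at_top" by (intro tendsto_intros)
  then show "((\<lambda>t. kap * exp (- r * t) * norm x) \<longlongrightarrow> 0) at_top" by simp
qed

lemma region_lip:
  obtains L where "0 < L" "\<And>x y. V x \<le> 4 * c \<Longrightarrow> V y \<le> 4 * c \<Longrightarrow> norm (f x - f y) \<le> L * norm (x - y)"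
    "\<And>x. V x \<le> 4 * c \<Longrightarrow> norm (f x) \<le> L"
proof -
  obtain L where L: "0 < L" "\<And>x y. x \<in> cball 0 R0 \<Longrightarrow> y \<in> cball 0 R0 \<Longrightarrow> norm (f x - f y) \<le> L * norm (x - y)"
    using f_lip by blast
  define L' where "L' = L * (1 + R0)"
  have R0: "0 \<le> R0" using c_pos p_pos by (simp add: R0_def)
  show ?thesis
  proof (rule that[of L'])
    show "norm (f x - f y) \<le> L' * norm (x - y)" if "V x \<le> 4 * c" "V y \<le> 4 * c" for x y
      by (rule order_trans[OF L(2)[OF in_cball[OF that(1)] in_cball[OF that(2)]] mult_right_mono])
         (use L R0 in \<open>auto simp: L'_def\<close>)
    show "norm (f x) \<le> L'" if "V x \<le> 4 * c" for x
    proof -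
      have "norm (f x) \<le> L * norm x" using L(2)[of x 0] in_cball[OF that] R0 by (simp add: f_0)
      also have "\<dots> \<le> L'" using in_cball[OF that] L R0 unfolding L'_def by (intro mult_left_mono) auto
      finally show ?thesis .
    qed
  qed (use L R0 in \<open>auto simp: L'_def\<close>)
qed

text \<open>With y = 0 this limits how fast a trajectory can approach the equilibrium.\<close>

lemma dist_lower:
  obtains L where "0 < L" "\<And>x y t. V x < 4 * c \<Longrightarrow> V y < 4 * c \<Longrightarrow> 0 \<le> t \<Longrightarrow>
    exp (- L * t) * norm (x - y) \<le> norm (X x t - X y t)"
proof -
  obtain L where L: "0 < L" "\<And>x y. V x \<le> 4 * c \<Longrightarrow> V y \<le> 4 * c \<Longrightarrow> norm (f x - f y) \<le> L * norm (x - y)"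
    using region_lip by metis
  show ?thesis
  proof (rule that[OF L(1)])
    fix x y t assume *: "V x < 4 * c" "V y < 4 * c" "(0::real) \<le> t"
    show "exp (- L * t) * norm (x - y) \<le> norm (X x t - X y t)"
      using curves_close(2)[OF curve_X[of x t] curve_X[of y t] *(3) L(2)]
        X_in_region[OF *(1)] X_in_region[OF *(2)] by (simp add: less_imp_le)
  qed
qed

end

section \<open>Trajectory coordinates: section point and signed time\<close>

locale contracting_flow = local_contraction f f' X P p r c
  for f :: "'a::euclidean_space \<Rightarrow> 'a" and f' X P p r c +
  assumes attracting: "(X x \<longlongrightarrow> 0) at_top"
begin

text \<open>\<open>t\<close> is the signed time from the section point \<open>y\<close> to
  \<open>x\<close>. As only the forward flow is available, both points are run forward until they
  meet, and \<open>t\<close> is the difference of the two running times.\<close>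

definition rel :: "'a \<Rightarrow> 'a \<Rightarrow> real \<Rightarrow> bool" where
  "rel x y t \<longleftrightarrow> V y = c \<and> (\<exists>a\<ge>0. \<exists>b\<ge>0. X x a = X y b \<and> t = b - a)"

text \<open>The backward equation is solved for a truncated, globally Lipschitz field that agrees
  with - f on the region. \<open>V\<close> grows at least at rate 2 r along it and so reaches c;
  until then the truncation has no effect, and reversing time gives a trajectory of the
  flow.\<close>

lemma backward_to_section:
  assumes x: "x \<noteq> 0" "V x < c"
  obtains y t where "V y = c" "0 \<le> t" "X y t = x"
proof -
  \<comment> \<open>Growth at rate 2 r starting from \<open>V x\<close> reaches c no later than at
    this time.\<close>
  define T where "T = ln (c / V x) / (2 * r)"
  have T: "0 \<le> T" "exp (2 * r * T) * V x = c"
    using V_pos[OF x(1)] x(2) r_pos by (auto simp: T_def)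
  let ?B = "cball (0::'a) R0"
  have R0: "0 \<le> R0" using c_pos p_pos by (simp add: R0_def)
  obtain L where L: "0 < L" "\<And>x y. x \<in> ?B \<Longrightarrow> y \<in> ?B \<Longrightarrow> norm (f x - f y) \<le> L * norm (x - y)"
    using f_lip by blast
  \<comment> \<open>Projection to a ball is nonexpansive, so the truncated field inherits the
    Lipschitz constant of \<open>f\<close> on the ball.\<close>
  define g where "g = (\<lambda>w. - f (closest_point ?B w))"
  have cp: "closest_point ?B w \<in> ?B" for w using R0 by (intro closest_point_in_set) auto
  have cp_lip: "norm (closest_point ?B v - closest_point ?B w) \<le> norm (v - w)" for v w
    using closest_point_lipschitz[of ?B v w] R0 by (simp add: dist_norm)
  have glip: "norm (g v - g w) \<le> L * norm (v - w)" for v w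
  proof -
    have "norm (g v - g w) = norm (f (closest_point ?B v) - f (closest_point ?B w))"
      by (simp add: g_def norm_minus_commute)
    also have "\<dots> \<le> L * norm (closest_point ?B v - closest_point ?B w)" by (intro L cp)
    also have "\<dots> \<le> L * norm (v - w)" using L by (intro mult_left_mono cp_lip) auto
    finally show ?thesis .
  qed
  then have "L-lipschitz_on UNIV g" using L by (intro lipschitz_onI) (auto simp: dist_norm)
  then have gcont: "continuous_on UNIV g" by (rule lipschitz_on_continuous_on)
  obtain v where v0: "v 0 = x" and v: "\<And>t. t \<in> {0..T} \<Longrightarrow> (v has_vector_derivative g (v t)) (at t within {0..T})"
    by (rule picard[OF T(1) L(1), of "\<lambda>_. g" x])
       (auto intro: glip continuous_on_compose2[OF gcont])
  have gv: "g w = - f w" if "V w \<le> 4 * c" for w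
    using in_cball[OF that] by (simp add: g_def closest_point_self)
  have cont: "continuous_on {0..T} (\<lambda>s. V (v s))"
    by (rule continuous_on_compose2[OF V_cont[of UNIV] continuous_on_vector_derivative[OF v]]) auto
  have Vder: "((\<lambda>s. V (v s)) has_real_derivative 2 * (v s \<bullet> P (g (v s)))) (at s within {0..T})"
    if "s \<in> {0..T}" for s
    unfolding V_def has_real_derivative_iff_has_vector_derivative
    by (rule has_vector_derivative_eq_rhs,
        rule bounded_bilinear.has_vector_derivative[OF bounded_bilinear_inner v[OF that]
          bounded_linear.has_vector_derivative[OF blinfun.bounded_linear_right v[OF that]]])
       (simp add: P_sym)
  have "\<exists>s\<in>{0..T}. c \<le> V (v s)"
  proof (rule ccontr)
    assume "\<not> ?thesis"
    then have less: "V (v s) < c" if "s \<in> {0..T}" for s using that by force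
    have "exp (2 * r * (T - 0)) * V (v 0) \<le> V (v T)"
    proof (rule growth_ge[OF T(1) Vder])
      fix s assume "0 < s" "s < T"
      then have "V (v s) < 4 * c" using less[of s] c_pos by auto
      then show "2 * r * V (v s) \<le> 2 * (v s \<bullet> P (g (v s)))"
        using contracting[of "v s" 0] c_pos by (simp add: gv V_def f_0 blinfun.minus_right)
    qed
    then show False using T(2) less[of T] T(1) by (simp add: v0)
  qed
  then obtain m where m: "m \<in> {0..T}" "c \<le> V (v m)" "\<And>s. s \<in> {0..T} \<Longrightarrow> c \<le> V (v s) \<Longrightarrow> m \<le> s"
    using first_time_above[OF cont] by metis
  then have m': "0 \<le> m" "m \<le> T" by auto
  \<comment> \<open>At the first time with \<open>V\<close> at least c, equality holds: the
    intermediate value theorem finds a time with equality that is not later.\<close>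
  obtain s where s: "0 \<le> s" "s \<le> m" "V (v s) = c"
    using IVT'[of "\<lambda>s. V (v s)" 0 c m] x m(2) m' continuous_on_subset[OF cont] by (auto simp: v0)
  have "m \<le> s" using m(3)[of s] s m' by auto
  with s have Vm: "V (v m) = c" by auto
  have inside: "V (v s) \<le> c" if "s \<in> {0..m}" for s
    using m(3)[of s] that m' Vm by (cases "c \<le> V (v s)") auto
  have "curve (\<lambda>s. v (m - s)) m" unfolding curve_def
  proof
    fix s assume s: "s \<in> {0..m}"
    have "(v \<circ> (\<lambda>s. m - s) has_vector_derivative (-1) *\<^sub>R g (v (m - s))) (at s within {0..m})"
    proof (rule vector_diff_chain_within)
      show "((\<lambda>s. m - s) has_vector_derivative -1) (at s within {0..m})" by (auto intro!: derivative_eq_intros)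
      show "(v has_vector_derivative g (v (m - s))) (at (m - s) within (\<lambda>s. m - s) ` {0..m})"
        using s m' by (intro has_vector_derivative_within_subset[OF v]) auto
    qed
    moreover have "V (v (m - s)) \<le> 4 * c" using inside[of "m - s"] s c_pos by auto
    ultimately show "((\<lambda>s. v (m - s)) has_vector_derivative f (v (m - s))) (at s within {0..m})"
      by (simp add: gv o_def)
  qed
  from curves_eq_iff[OF curve_X[of "v m" m] this m'(1)] have "X (v m) m = x" using v0 by simp
  then show ?thesis using that Vm m'(1) by blast
qed

lemma rel_exists:
  assumes x: "x \<noteq> 0"
  shows "\<exists>y t. rel x y t"
proof (cases "V x < c")
  case True
  obtain y t where "V y = c" "0 \<le> t" "X y t = x" using backward_to_section[OF x True] .
  then have "rel x y t" unfolding rel_def by (intro conjI exI[of _ 0] exI[of _ t]) auto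
  then show ?thesis by blast
next
  case False
  have "((\<lambda>t. V (X x t)) \<longlongrightarrow> V 0) at_top"
    using V_cont[of UNIV] by (intro isCont_tendsto_compose[OF _ attracting]) (simp add: continuous_on_eq_continuous_at)
  then have "\<forall>\<^sub>F t in at_top. V (X x t) < c" using c_pos by (auto dest: order_tendstoD)
  then have "\<forall>\<^sub>F t in at_top. V (X x t) < c \<and> 0 \<le> t" using eventually_ge_at_top by (rule eventually_conj)
  then obtain T where T: "V (X x T) < c" "0 \<le> T" using eventually_happens by fastforce
  have "continuous_on {0..T} (\<lambda>t. V (X x t))"
    by (rule continuous_on_compose2[OF V_cont[of UNIV] X_cont_time]) auto
  then obtain a where "0 \<le> a" "V (X x a) = c" using IVT2'[of "\<lambda>t. V (X x t)" T c 0] T False by auto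
  then have "rel x (X x a) (0 - a)" unfolding rel_def by (intro conjI exI[of _ a] exI[of _ 0]) auto
  then show ?thesis by blast
qed

text \<open>Injectivity of the flow cancels the common running time; then \<open>V\<close> decays
  strictly along trajectories, so the level c is met at most once.\<close>

lemma section_unique:
  assumes "V y = c" "V z = c" "0 \<le> a" "a \<le> b" "X y a = X z b"
  shows "a = b \<and> y = z"
proof -
  have "X y a = X (X z (b - a)) a" using assms by (simp add: X_add)
  then have y: "y = X z (b - a)" using X_inj assms by blast
  have "c \<le> exp (- 2 * r * (b - a)) * c" using V_decay[of z "b - a"] assms y c_pos by simp
  then have "0 \<le> - 2 * r * (b - a)" using c_pos by simp
  then have "b - a = 0" using r_pos assms(4) by (auto simp: mult_le_0_iff)
  then show ?thesis using y by simp
qed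

text \<open>Running both section points further makes them meet at one point, namely at
  \<open>x\<close> flowed for the time a + a'.\<close>

lemma rel_unique:
  assumes "rel x y s" "rel x z t"
  shows "y = z \<and> s = t"
proof -
  obtain a b where y: "V y = c" "0 \<le> a" "0 \<le> b" "X x a = X y b" "s = b - a" using assms by (auto simp: rel_def)
  obtain a' b' where z: "V z = c" "0 \<le> a'" "0 \<le> b'" "X x a' = X z b'" "t = b' - a'" using assms by (auto simp: rel_def)
  have "X y (b + a') = X (X x a) a'" unfolding y(4) using y z by (simp add: X_add)
  also have "\<dots> = X (X x a') a" using y(2) z(2) by (simp add: X_add add.commute)
  also have "\<dots> = X z (b' + a)" unfolding z(4) using y z by (simp add: X_add)
  finally have "X y (b + a') = X z (b' + a)" .
  then show ?thesis
    using section_unique[OF y(1) z(1), of "b + a'" "b' + a"] section_unique[OF z(1) y(1), of "b' + a" "b + a'"]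
      y z by (cases "b + a' \<le> b' + a") auto
qed

text \<open>No section point is related to 0, so \<open>base 0\<close> and \<open>tau 0\<close> are
  unspecified; functions built from them fix their value at 0 separately.\<close>

definition base :: "'a \<Rightarrow> 'a" where "base x = (SOME y. \<exists>t. rel x y t)"

definition tau :: "'a \<Rightarrow> real" where "tau x = (SOME t. rel x (base x) t)"

lemma rel_base_tau: "x \<noteq> 0 \<Longrightarrow> rel x (base x) (tau x)"
  unfolding tau_def by (rule someI_ex) (unfold base_def, rule someI_ex[OF rel_exists])

lemma base_tau_eqI: "rel x y t \<Longrightarrow> base x = y \<and> tau x = t"
proof -
  assume rel: "rel x y t"
  then have "\<exists>t. rel x (base x) t" unfolding base_def by (intro someI_ex[of "\<lambda>y. \<exists>t. rel x y t"]) blast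
  then have "rel x (base x) (tau x)" unfolding tau_def by (rule someI_ex)
  then show ?thesis using rel_unique[OF rel] by blast
qed

lemma V_base: "x \<noteq> 0 \<Longrightarrow> V (base x) = c" using rel_base_tau by (simp add: rel_def)

lemma base_tau_X:
  assumes x: "x \<noteq> 0" and t: "0 \<le> t"
  shows "base (X x t) = base x" "tau (X x t) = tau x + t"
proof -
  obtain a b where ab: "0 \<le> a" "0 \<le> b" "X x a = X (base x) b" "tau x = b - a"
    using rel_base_tau[OF x] by (auto simp: rel_def)
  have "X (X x t) a = X (X x a) t" using t ab(1) by (simp add: X_add add.commute)
  also have "\<dots> = X (base x) (b + t)" unfolding ab(3) using t ab by (simp add: X_add)
  finally have "rel (X x t) (base x) (tau x + t)" using ab t V_base[OF x] unfolding rel_def by force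
  from base_tau_eqI[OF this] show "base (X x t) = base x" "tau (X x t) = tau x + t" by auto
qed

lemma X_base_tau:
  assumes x: "x \<noteq> 0"
  shows "0 \<le> tau x \<Longrightarrow> X (base x) (tau x) = x" "tau x \<le> 0 \<Longrightarrow> X x (- tau x) = base x"
proof -
  obtain a b where ab: "0 \<le> a" "0 \<le> b" "X x a = X (base x) b" "tau x = b - a"
    using rel_base_tau[OF x] by (auto simp: rel_def)
  show "X (base x) (tau x) = x" if "0 \<le> tau x"
  proof -
    have "X (X (base x) (tau x)) a = X x a" using ab that by (simp add: X_add)
    then show ?thesis using X_inj ab by blast
  qed
  show "X x (- tau x) = base x" if "tau x \<le> 0"
  proof -
    have "X (X x (- tau x)) b = X (base x) b" using ab that by (simp add: X_add)
    then show ?thesis using X_inj ab by blast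
  qed
qed

lemma V_tau_nonpos: "x \<noteq> 0 \<Longrightarrow> tau x \<le> 0 \<Longrightarrow> c \<le> V x"
proof (rule ccontr)
  assume x: "x \<noteq> 0" "tau x \<le> 0" "\<not> c \<le> V x"
  have "c \<le> exp (- 2 * r * (- tau x)) * V x"
    using V_decay[of x "- tau x"] X_base_tau(2)[OF x(1,2)] V_base[OF x(1)] x c_pos by simp
  also have "\<dots> \<le> 1 * V x" using r_pos x V_nonneg by (intro mult_right_mono) (auto simp: mult_le_0_iff)
  finally show False using x by simp
qed

lemma base_tau_section: "V x = c \<Longrightarrow> base x = x \<and> tau x = 0"
  by (rule base_tau_eqI) (auto simp: rel_def intro!: exI[of _ 0])

text \<open>A trajectory approaches 0 at most exponentially, so a small x has a large
  \<open>tau x\<close>. This converts decay in \<open>tau\<close> into an order of vanishing at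
  0.\<close>

lemma norm_ge_tau:
  obtains L k where "0 < L" "0 < k"
    "\<And>x. x \<noteq> 0 \<Longrightarrow> V x < c \<Longrightarrow> 0 < tau x \<and> k * exp (- L * tau x) \<le> norm x"
proof -
  obtain L where L: "0 < L" "\<And>x y t. V x < 4 * c \<Longrightarrow> V y < 4 * c \<Longrightarrow> 0 \<le> t \<Longrightarrow>
    exp (- L * t) * norm (x - y) \<le> norm (X x t - X y t)" using dist_lower by metis
  show ?thesis
  proof (rule that[OF L(1), of "sqrt (c / q)"])
    show "0 < sqrt (c / q)" using c_pos q_pos by simp
    fix x assume x: "x \<noteq> 0" "V x < c"
    then have t: "0 < tau x" using V_tau_nonpos[OF x(1)] by force
    have "sqrt (c / q) \<le> norm (base x)"
      using V_le[of "base x"] V_base[OF x(1)] q_pos by (intro real_le_lsqrt) (auto simp: field_simps)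
    then have "sqrt (c / q) * exp (- L * tau x) \<le> exp (- L * tau x) * norm (base x - 0)" by simp
    also have "\<dots> \<le> norm (X (base x) (tau x) - X 0 (tau x))" using V_base[OF x(1)] t c_pos by (intro L) auto
    also have "\<dots> = norm x" using X_base_tau(1)[OF x(1)] t by simp
    finally show "0 < tau x \<and> sqrt (c / q) * exp (- L * tau x) \<le> norm x" using t by simp
  qed
qed

end

section \<open>Differentiability of the trajectory coordinates\<close>

lemma small_of_one_minus_exp:
  fixes y m :: real
  assumes "0 \<le> y" "1 - exp (- y) \<le> m" "m \<le> 1 / 2"
  shows "y \<le> 2 * m"
proof -
  have "(1 + y) * exp (- y) \<le> exp y * exp (- y)" by (intro mult_right_mono exp_ge_add_one_self) auto
  then have "(1 + y) * exp (- y) \<le> 1" by (simp flip: exp_add)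
  moreover have "(1 + y) * (1 - m) \<le> (1 + y) * exp (- y)" using assms by (intro mult_left_mono) auto
  ultimately have *: "y * (1 - m) \<le> m" by (simp add: algebra_simps)
  have "y * (1 / 2) \<le> y * (1 - m)" using assms by (intro mult_left_mono) auto
  then show ?thesis using * by simp
qed

context local_contraction begin

lemma inner_P_le: "\<bar>x \<bullet> P y\<bar> \<le> q * (norm x * norm y)"
proof -
  have "\<bar>x \<bullet> P y\<bar> \<le> norm x * norm (P y)" by (rule Cauchy_Schwarz_ineq2)
  also have "\<dots> \<le> norm x * (norm P * norm y)" by (intro mult_left_mono norm_blinfun) auto
  also have "\<dots> \<le> q * (norm x * norm y)" by (simp add: q_def algebra_simps)
  finally show ?thesis .
qed

lemma X_taylor:
  obtains B where "0 < B" "\<And>z s. V z < 4 * c \<Longrightarrow> 0 \<le> s \<Longrightarrow> norm (X z s - z) \<le> B * s"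
    "\<And>z s. V z < 4 * c \<Longrightarrow> 0 \<le> s \<Longrightarrow> norm (X z s - z - s *\<^sub>R f z) \<le> B * s\<^sup>2"
proof -
  obtain L where L: "0 < L" "\<And>x y. V x \<le> 4 * c \<Longrightarrow> V y \<le> 4 * c \<Longrightarrow> norm (f x - f y) \<le> L * norm (x - y)"
    "\<And>x. V x \<le> 4 * c \<Longrightarrow> norm (f x) \<le> L"
    using region_lip by metis
  have 1: "norm (X z s - z) \<le> L * s" if "V z < 4 * c" "0 \<le> s" for z s
    using mean_value_norm[OF that(2) curveD[OF curve_X[of z s]], of L] L(3) X_in_region[OF that(1)]
    by (simp add: less_imp_le)
  have 2: "norm (X z s - z - s *\<^sub>R f z) \<le> (L * L) * s\<^sup>2" if z: "V z < 4 * c" and s: "0 \<le> s" for z s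
  proof -
    have "norm ((X z s - s *\<^sub>R f z) - (X z 0 - 0 *\<^sub>R f z)) \<le> L * (L * s) * (s - 0)"
    proof (rule mean_value_norm[OF s])
      fix t assume t: "t \<in> {0..s}"
      show "((\<lambda>t. X z t - t *\<^sub>R f z) has_vector_derivative f (X z t) - f z) (at t within {0..s})"
        by (auto intro!: derivative_eq_intros curveD[OF curve_X t])
      have "norm (f (X z t) - f z) \<le> L * norm (X z t - z)"
        using X_in_region[OF z, of t] z t by (intro L) auto
      also have "\<dots> \<le> L * (L * s)"
        using 1[OF z, of t] t L(1) by (intro mult_left_mono) (auto intro: order_trans mult_left_mono)
      finally show "norm (f (X z t) - f z) \<le> L * (L * s)" .
    qed
    then show ?thesis by (simp add: power2_eq_square algebra_simps)
  qed
  show ?thesis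
  proof (rule that[of "L + L * L"])
    show "norm (X z s - z) \<le> (L + L * L) * s" if "V z < 4 * c" "0 \<le> s" for z s
      by (rule order_trans[OF 1[OF that] mult_right_mono]) (use that in auto)
    show "norm (X z s - z - s *\<^sub>R f z) \<le> (L + L * L) * s\<^sup>2" if "V z < 4 * c" "0 \<le> s" for z s
      by (rule order_trans[OF 2[OF that] mult_right_mono]) (use L in auto)
  qed (use L in \<open>auto simp: add_pos_pos\<close>)
qed

end

context contracting_flow begin

text \<open>Explicit estimates in place of the implicit function theorem. Near the section
  \<open>V x - c\<close> is of order |x - x0|, and since \<open>V\<close> decays at a definite rate,
  the time to the section has the same order; expanding the flow to first order in that time leaves
  a quadratic error.\<close>

lemma tau_base_near_section:
  assumes x0: "V x0 = c"
  obtains d K where "0 < d" "d \<le> 1" "0 < K"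
    "\<And>x. norm (x - x0) < d \<Longrightarrow> x \<noteq> 0"
    "\<And>x. norm (x - x0) < d \<Longrightarrow> norm (base x - x) \<le> K * norm (x - x0)"
    "\<And>x. norm (x - x0) < d \<Longrightarrow> norm (base x - x + tau x *\<^sub>R f x0) \<le> K * (norm (x - x0))\<^sup>2"
proof -
  obtain B where B: "0 < B" "\<And>z s. V z < 4 * c \<Longrightarrow> 0 \<le> s \<Longrightarrow> norm (X z s - z) \<le> B * s"
    "\<And>z s. V z < 4 * c \<Longrightarrow> 0 \<le> s \<Longrightarrow> norm (X z s - z - s *\<^sub>R f z) \<le> B * s\<^sup>2"
    using X_taylor by metis
  obtain L where L: "0 < L" "\<And>x y. V x \<le> 4 * c \<Longrightarrow> V y \<le> 4 * c \<Longrightarrow> norm (f x - f y) \<le> L * norm (x - y)"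
    using region_lip by metis
  \<comment> \<open>Bounds the variation of \<open>V\<close> around \<open>x0\<close> within
    distance 1, by the expansion \<open>V_add\<close>.\<close>
  define KV where "KV = 2 * norm x0 * q + q"
  have KV: "0 < KV" using q_pos by (simp add: KV_def add_nonneg_pos)
  define d where "d = min 1 (c / (2 * KV))"
  define K1 where "K1 = KV / (r * c)"
  define K2 where "K2 = B * K1 + 1"
  define K3 where "K3 = B * K1\<^sup>2 + K1 * L * K2"
  have K: "0 < K1" "0 < K2" "0 < K3"
    using KV r_pos c_pos B(1) L(1) by (auto simp: K1_def K2_def K3_def add_pos_pos)
  have Vx: "\<bar>V x - c\<bar> \<le> KV * norm (x - x0) \<and> KV * norm (x - x0) \<le> c / 2" if "norm (x - x0) < d" for x
  proof -
    let ?d = "norm (x - x0)"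
    have "V x - c = 2 * (x0 \<bullet> P (x - x0)) + V (x - x0)" using V_add[of x0 "x - x0"] x0 by simp
    then have "\<bar>V x - c\<bar> \<le> 2 * (q * (norm x0 * ?d)) + q * ?d\<^sup>2"
      using inner_P_le[of x0 "x - x0"] V_le[of "x - x0"] V_nonneg[of "x - x0"] by linarith
    also have "?d\<^sup>2 \<le> ?d" using that by (simp add: d_def power2_eq_square mult_left_le)
    finally have "\<bar>V x - c\<bar> \<le> KV * ?d" using q_pos by (simp add: KV_def algebra_simps)
    moreover have "KV * ?d \<le> KV * (c / (2 * KV))" using that KV by (intro mult_left_mono) (auto simp: d_def)
    ultimately show ?thesis using KV by simp
  qed
  have d: "0 < d" using KV c_pos by (simp add: d_def)
  have nz: "x \<noteq> 0" if "norm (x - x0) < d" for x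
    using Vx[OF that] c_pos by (auto simp: abs_if split: if_splits)
  have main: "norm (base x - x) \<le> B * K1 * norm (x - x0) \<and>
      norm (base x - x + tau x *\<^sub>R f x0) \<le> K3 * (norm (x - x0))\<^sup>2" if x: "norm (x - x0) < d" for x
  proof -
    let ?d = "norm (x - x0)"
    define s where "s = \<bar>tau x\<bar>"
    \<comment> \<open>The two points are ordered in time, so that the forward flow leads from a to b
      on either side of the section.\<close>
    define a where "a = (if 0 \<le> tau x then base x else x)"
    define b where "b = (if 0 \<le> tau x then x else base x)"
    have s: "0 \<le> s" by (simp add: s_def)
    have Xab: "X a s = b" using X_base_tau[OF nz[OF x]] by (simp add: s_def a_def b_def)
    have Va: "c \<le> V a" "V a < 4 * c"
      using V_base[OF nz[OF x]] V_tau_nonpos[OF nz[OF x]] Vx[OF x] c_pos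
      by (auto simp: a_def abs_if split: if_splits)
    have "V a - V b \<le> KV * ?d" using V_base[OF nz[OF x]] Vx[OF x] by (auto simp: a_def b_def abs_if split: if_splits)
    moreover have "V b \<le> exp (- (2 * r * s)) * V a" using V_decay[OF Va(2) s] Xab by simp
    ultimately have "(1 - exp (- (2 * r * s))) * V a \<le> KV * ?d" by (simp add: algebra_simps)
    moreover have "(1 - exp (- (2 * r * s))) * c \<le> (1 - exp (- (2 * r * s))) * V a"
      using Va r_pos s by (intro mult_left_mono) auto
    ultimately have "(1 - exp (- (2 * r * s))) * c \<le> KV * ?d" by linarith
    then have "1 - exp (- (2 * r * s)) \<le> KV * ?d / c" using c_pos by (simp add: pos_le_divide_eq)
    moreover have "KV * ?d / c \<le> 1 / 2" using Vx[OF x] c_pos by (simp add: pos_divide_le_eq)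
    ultimately have "2 * r * s \<le> 2 * (KV * ?d / c)" using s r_pos by (intro small_of_one_minus_exp) auto
    then have sd: "s \<le> K1 * ?d" using r_pos c_pos by (simp add: K1_def field_simps)
    have ab: "norm (b - a) \<le> B * s" using B(2)[OF Va(2) s] Xab by simp
    also have "\<dots> \<le> B * (K1 * ?d)" using sd B(1) by (intro mult_left_mono) auto
    finally have ab': "norm (b - a) \<le> B * K1 * ?d" by (simp add: mult.assoc)
    have bx: "norm (base x - x) = norm (b - a)" by (simp add: a_def b_def norm_minus_commute)
    have "norm (a - x) \<le> norm (b - a)" by (simp add: a_def b_def norm_minus_commute)
    then have ax0: "norm (a - x0) \<le> K2 * ?d"
      using ab' norm_triangle_ineq[of "a - x" "x - x0"] by (simp add: K2_def algebra_simps)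
    have "norm (b - a - s *\<^sub>R f a) \<le> B * s\<^sup>2" using B(3)[OF Va(2) s] Xab by simp
    also have "\<dots> \<le> B * (K1 * ?d)\<^sup>2" using sd s B(1) by (intro mult_left_mono power_mono) auto
    finally have e1: "norm (b - a - s *\<^sub>R f a) \<le> B * (K1 * ?d)\<^sup>2" .
    \<comment> \<open>The time s and the distance from a to x0 are both of first order, so replacing
      \<open>f a\<close> by \<open>f x0\<close> costs a second-order term.\<close>
    have "norm (f a - f x0) \<le> L * norm (a - x0)" using Va x0 c_pos by (intro L) auto
    also have "\<dots> \<le> L * (K2 * ?d)" using ax0 L(1) by (intro mult_left_mono) auto
    finally have e2: "norm (s *\<^sub>R (f a - f x0)) \<le> (K1 * ?d) * (L * (K2 * ?d))"
      using sd s by (simp add: mult_mono)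
    have eq: "b - a - s *\<^sub>R f x0 = (b - a - s *\<^sub>R f a) + s *\<^sub>R (f a - f x0)" by (simp add: algebra_simps)
    have "norm (b - a - s *\<^sub>R f x0) \<le> B * (K1 * ?d)\<^sup>2 + (K1 * ?d) * (L * (K2 * ?d))"
      by (subst eq) (rule norm_triangle_mono[OF e1 e2])
    also have "\<dots> = K3 * ?d\<^sup>2" by (simp add: K3_def power2_eq_square algebra_simps)
    finally have "norm (b - a - s *\<^sub>R f x0) \<le> K3 * ?d\<^sup>2" .
    moreover have "norm (base x - x + tau x *\<^sub>R f x0) = norm (b - a - s *\<^sub>R f x0)"
    proof (cases "0 \<le> tau x")
      case True
      then have "base x - x + tau x *\<^sub>R f x0 = - (b - a - s *\<^sub>R f x0)"
        by (simp add: a_def b_def s_def)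
      then show ?thesis by (simp only: norm_minus_cancel)
    qed (simp add: a_def b_def s_def)
    ultimately show ?thesis using ab' bx by simp
  qed
  show ?thesis
  proof (rule that[of d "B * K1 + K3"])
    show "norm (base x - x) \<le> (B * K1 + K3) * norm (x - x0)" if "norm (x - x0) < d" for x
    proof -
      have "B * K1 * norm (x - x0) \<le> (B * K1 + K3) * norm (x - x0)" using K by (intro mult_right_mono) auto
      then show ?thesis using main[OF that] by linarith
    qed
    show "norm (base x - x + tau x *\<^sub>R f x0) \<le> (B * K1 + K3) * (norm (x - x0))\<^sup>2" if "norm (x - x0) < d" for x
    proof -
      have "K3 * (norm (x - x0))\<^sup>2 \<le> (B * K1 + K3) * (norm (x - x0))\<^sup>2" using K B by (intro mult_right_mono) auto
      then show ?thesis using main[OF that] by linarith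
    qed
  qed (use d K B nz in \<open>auto simp: d_def add_pos_pos\<close>)
qed

text \<open>The flow is transversal to the section. \<open>Dt\<close> is the differential of
  \<open>V\<close> divided by its rate \<open>G\<close> along f, and \<open>Db\<close> is the
  projection along \<open>f x0\<close> to the tangent space of the section; only 0 is killed by
  both.\<close>

lemma tau_base_derivative_section:
  assumes x0: "V x0 = c"
  shows "\<exists>Dt Db. (tau has_derivative Dt) (at x0) \<and> (base has_derivative Db) (at x0)
    \<and> (\<forall>h. Dt h = 0 \<and> Db h = 0 \<longrightarrow> h = 0)"
proof -
  obtain d K where d: "0 < d" "d \<le> 1" "0 < K"
    and nz: "\<And>x. norm (x - x0) < d \<Longrightarrow> x \<noteq> 0"
    and w: "\<And>x. norm (x - x0) < d \<Longrightarrow> norm (base x - x) \<le> K * norm (x - x0)"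
    and e: "\<And>x. norm (x - x0) < d \<Longrightarrow> norm (base x - x + tau x *\<^sub>R f x0) \<le> K * (norm (x - x0))\<^sup>2"
    using tau_base_near_section[OF x0] by metis
  define G where "G = 2 * (x0 \<bullet> P (f x0))"
  have "x0 \<bullet> P (f x0) \<le> - r * c" using contracting[of x0 0] x0 c_pos by (simp add: V_def f_0)
  moreover have "0 < r * c" using r_pos c_pos by simp
  ultimately have G: "G < 0" by (simp add: G_def)
  define Dt where "Dt h = 2 / G * (x0 \<bullet> P h)" for h
  have linDt: "bounded_linear Dt" unfolding Dt_def[abs_def]
    by (intro bounded_linear_const_mult bounded_linear_inner_right_comp blinfun.bounded_linear_right)
  define Db where "Db h = h - Dt h *\<^sub>R f x0" for h
  have linDb: "bounded_linear Db" unfolding Db_def[abs_def]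
    by (intro bounded_linear_intros linDt)
  define K4 where "K4 = (q + 2 * q * norm x0 * K + 2 * q * K + q * K\<^sup>2) / \<bar>G\<bar>"
  have K4G: "K4 * \<bar>G\<bar> = q + 2 * q * norm x0 * K + 2 * q * K + q * K\<^sup>2" using G by (simp add: K4_def)
  have 1: "norm (tau x - tau x0 - Dt (x - x0)) \<le> K4 * (norm (x - x0))\<^sup>2" if x: "norm (x - x0) < d" for x
  proof -
    let ?d = "norm (x - x0)"
    define h where "h = x - x0"
    define w where "w = base x - x"
    define z where "z = w + tau x *\<^sub>R f x0"
    have wle: "norm w \<le> K * norm h" and zle: "norm z \<le> K * (norm h)\<^sup>2"
      using w[OF x] e[OF x] by (auto simp: w_def h_def z_def)
    \<comment> \<open>\<open>V (base x)\<close> and \<open>V x0\<close> both equal c. Expanding the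
      former about x0, with the displacement w equal to \<open>- tau x *\<^sub>R f x0\<close> up to
      the quadratic term z, isolates \<open>G * tau x\<close>.\<close>
    have "c = V x + 2 * (x \<bullet> P w) + V w" using V_add[of x w] V_base[OF nz[OF x]] by (simp add: w_def)
    moreover have "V x = c + 2 * (x0 \<bullet> P h) + V h" using V_add[of x0 h] x0 by (simp add: h_def)
    moreover have "x \<bullet> P w = x0 \<bullet> P w + h \<bullet> P w" by (simp add: h_def inner_diff_left)
    moreover have "x0 \<bullet> P w = x0 \<bullet> P z - tau x * (x0 \<bullet> P (f x0))"
      by (simp add: z_def blinfun.add_right blinfun.scaleR_right inner_add_right)
    ultimately have eq: "G * tau x - 2 * (x0 \<bullet> P h) = V h + 2 * (x0 \<bullet> P z) + 2 * (h \<bullet> P w) + V w"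
      unfolding G_def by (simp add: algebra_simps)
    have "\<bar>x0 \<bullet> P z\<bar> \<le> q * (norm x0 * (K * (norm h)\<^sup>2))"
      using q_pos by (intro order_trans[OF inner_P_le] mult_left_mono zle) auto
    moreover have "\<bar>h \<bullet> P w\<bar> \<le> q * (norm h * (K * norm h))"
      using q_pos by (intro order_trans[OF inner_P_le] mult_left_mono wle) auto
    moreover have "V w \<le> q * (K * norm h)\<^sup>2"
      using q_pos by (intro order_trans[OF V_le] mult_left_mono power_mono wle) auto
    ultimately have "\<bar>G * tau x - 2 * (x0 \<bullet> P h)\<bar> \<le> q * (norm h)\<^sup>2 + 2 * (q * (norm x0 * (K * (norm h)\<^sup>2)))
        + 2 * (q * (norm h * (K * norm h))) + q * (K * norm h)\<^sup>2"
      using V_le[of h] V_nonneg[of h] V_nonneg[of w] unfolding eq by linarith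
    also have "\<dots> = K4 * \<bar>G\<bar> * (norm h)\<^sup>2" unfolding K4G by (simp add: power2_eq_square algebra_simps)
    finally have "\<bar>G * tau x - 2 * (x0 \<bullet> P h)\<bar> \<le> \<bar>G\<bar> * (K4 * (norm h)\<^sup>2)" by (simp add: mult_ac)
    moreover have "G * tau x - 2 * (x0 \<bullet> P h) = G * (tau x - Dt h)" using G by (simp add: Dt_def algebra_simps)
    ultimately have "\<bar>tau x - Dt h\<bar> \<le> K4 * (norm h)\<^sup>2" using G by (simp add: abs_mult)
    then show ?thesis using base_tau_section[OF x0] by (simp add: h_def)
  qed
  have 2: "norm (base x - base x0 - Db (x - x0)) \<le> (K + K4 * norm (f x0)) * (norm (x - x0))\<^sup>2"
    if x: "norm (x - x0) < d" for x
  proof -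
    have "base x - base x0 - Db (x - x0)
        = (base x - x + tau x *\<^sub>R f x0) - (tau x - tau x0 - Dt (x - x0)) *\<^sub>R f x0"
      using base_tau_section[OF x0] by (simp add: Db_def algebra_simps)
    also have "norm \<dots> \<le> norm (base x - x + tau x *\<^sub>R f x0) + norm ((tau x - tau x0 - Dt (x - x0)) *\<^sub>R f x0)"
      by (rule norm_triangle_ineq4)
    also have "\<dots> \<le> K * (norm (x - x0))\<^sup>2 + K4 * (norm (x - x0))\<^sup>2 * norm (f x0)"
      using e[OF x] 1[OF x] by (simp add: add_mono mult_right_mono)
    finally show ?thesis by (simp add: algebra_simps)
  qed
  have "(tau has_derivative Dt) (at x0)" by (rule quadratic_error_imp_has_derivative[OF linDt d(1) 1])
  moreover have "(base has_derivative Db) (at x0)" by (rule quadratic_error_imp_has_derivative[OF linDb d(1) 2])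
  moreover have "\<forall>h. Dt h = 0 \<and> Db h = 0 \<longrightarrow> h = 0" by (auto simp: Db_def)
  ultimately show ?thesis by blast
qed

text \<open>Near x both coordinates factor through a map \<open>g\<close> into a neighbourhood of
  the section point, up to a constant time: the flow itself if x lies before the section, a local
  inverse of it otherwise. Injectivity of the derivative of \<open>g\<close> transports the joint
  injectivity.\<close>

lemma tau_base_derivative:
  assumes x: "x \<noteq> 0"
  obtains Dt Db where "(tau has_derivative Dt) (at x)" "(base has_derivative Db) (at x)"
    "\<And>h. Dt h = 0 \<Longrightarrow> Db h = 0 \<Longrightarrow> h = 0"
proof -
  define t where "t = \<bar>tau x\<bar>"
  have t: "0 \<le> t" by (simp add: t_def)
  obtain Dt Db where D: "(tau has_derivative Dt) (at (base x))" "(base has_derivative Db) (at (base x))"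
    "\<And>h. Dt h = 0 \<Longrightarrow> Db h = 0 \<Longrightarrow> h = 0"
    using tau_base_derivative_section[OF V_base[OF x]] by metis
  obtain g E s where E: "inj E" "(g has_derivative E) (at x)" "g x = base x"
    and ev: "\<forall>\<^sub>F y in nhds x. tau y = tau (g y) + s \<and> base y = base (g y)"
  proof (cases "0 \<le> tau x")
    case True
    then have X: "X (base x) t = x" using X_base_tau(1)[OF x] by (simp add: t_def)
    obtain g E where g: "\<forall>\<^sub>F z in nhds x. X (g z) t = z" "g x = base x" "(g has_derivative E) (at x)" "inj E"
      using X_inverse[OF t, of "base x"] unfolding X by metis
    have "\<forall>\<^sub>F z in nhds x. z \<noteq> 0" using x by (rule t1_space_nhds)
    with g(1) have "\<forall>\<^sub>F y in nhds x. tau y = tau (g y) + t \<and> base y = base (g y)"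
    proof eventually_elim
      case (elim y)
      then have "g y \<noteq> 0" using t by auto
      from base_tau_X[OF this t] show ?case using elim by simp
    qed
    then show ?thesis using that g by blast
  next
    case False
    then have X: "X x t = base x" using X_base_tau(2)[OF x] by (simp add: t_def)
    obtain E where E: "((\<lambda>y. X y t) has_derivative E) (at x)" "inj E" using X_diff[OF t] by blast
    have "\<forall>\<^sub>F z in nhds x. z \<noteq> 0" using x by (rule t1_space_nhds)
    then have "\<forall>\<^sub>F y in nhds x. tau y = tau (X y t) + (- t) \<and> base y = base (X y t)"
      by eventually_elim (use t base_tau_X in auto)
    then show ?thesis using that[OF E(2,1)] X by blast
  qed
  have ev': "\<forall>\<^sub>F y in at x. tau y = tau (g y) + s \<and> base y = base (g y)"
    using ev by (auto simp: eventually_at_filter elim: eventually_mono)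
  have "((\<lambda>y. tau (g y) + s) has_derivative (\<lambda>h. Dt (E h))) (at x)"
    using has_derivative_compose[OF E(2), of tau Dt] D(1) E(3) by (auto intro!: derivative_eq_intros)
  then have 1: "(tau has_derivative (\<lambda>h. Dt (E h))) (at x)"
    by (rule has_derivative_transform_eventually)
       (use ev' eventually_nhds_x_imp_x[OF ev] in \<open>auto elim: eventually_mono\<close>)
  have "((\<lambda>y. base (g y)) has_derivative (\<lambda>h. Db (E h))) (at x)"
    using has_derivative_compose[OF E(2), of base Db] D(2) E(3) by auto
  then have 2: "(base has_derivative (\<lambda>h. Db (E h))) (at x)"
    by (rule has_derivative_transform_eventually)
       (use ev' eventually_nhds_x_imp_x[OF ev] in \<open>auto elim: eventually_mono\<close>)
  have "h = 0" if "Dt (E h) = 0" "Db (E h) = 0" for h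
  proof -
    have "E h = 0" using D(3) that by blast
    moreover have "E 0 = 0" using has_derivative_linear[OF E(2)] by (rule linear_0)
    ultimately show ?thesis using E(1) by (metis injD)
  qed
  then show ?thesis using that 1 2 by blast
qed

end

section \<open>Generalized eigenfunctionals\<close>

text \<open>First component of the exponential of t times a Jordan block, the operator sending the
  sequence a to lam a(j) + a(j + 1), for sequences that vanish from index m on.\<close>

definition J :: "complex \<Rightarrow> nat \<Rightarrow> real \<Rightarrow> (nat \<Rightarrow> complex) \<Rightarrow> complex" where
  "J lam m t a = exp (lam * of_real t) * (\<Sum>j<m. of_real (t ^ j / fact j) * a j)"

lemma J_add: "J lam m t (\<lambda>j. a j + b j) = J lam m t a + J lam m t b"
  by (simp only: J_def distrib_left sum.distrib)

lemma J_diff: "J lam m t (\<lambda>j. a j - b j) = J lam m t a - J lam m t b"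
  by (simp only: J_def right_diff_distrib sum_subtractf)

lemma J_cmult: "J lam m t (\<lambda>j. k * a j) = k * J lam m t a"
  by (simp add: J_def sum_distrib_left mult_ac)

lemma J_sums:
  assumes "\<And>j. (\<lambda>k. a k j) sums s j"
  shows "(\<lambda>k. J lam m t (a k)) sums J lam m t s"
  unfolding J_def by (intro sums_mult sums_sum assms)

lemma J_0:
  assumes "\<And>j. m \<le> j \<Longrightarrow> a j = 0"
  shows "J lam m 0 a = a 0"
proof (cases m)
  case 0 then show ?thesis using assms[of 0] by (simp add: J_def)
next
  case (Suc n)
  then show ?thesis by (simp add: J_def sum.lessThan_Suc_shift del: sum.lessThan_Suc)
qed

text \<open>Group law of the Jordan exponential. Vanishing of \<open>a\<close> from m on restricts
  the double sum to i + j < m, where the binomial theorem handles each antidiagonal.\<close>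

lemma J_J:
  assumes a: "\<And>j. m \<le> j \<Longrightarrow> a j = 0"
  shows "J lam m s (\<lambda>i. J lam m t (\<lambda>j. a (i + j))) = J lam m (s + t) a"
proof -
  define c where "c t j = complex_of_real (t ^ j / fact j)" for t j
  have bin: "(\<Sum>i\<le>k. c s i * c t (k - i)) = c (s + t) k" for k
  proof -
    have "(\<Sum>i\<le>k. s ^ i / fact i * (t ^ (k - i) / fact (k - i))) = (s + t) ^ k / fact k"
      unfolding binomial_ring sum_divide_distrib
      by (intro sum.cong refl) (simp add: binomial_fact field_simps)
    then have "complex_of_real (\<Sum>i\<le>k. s ^ i / fact i * (t ^ (k - i) / fact (k - i))) = c (s + t) k"
      by (simp add: c_def)
    then show ?thesis by (simp add: c_def)
  qed
  have "(\<Sum>i<m. c s i * (\<Sum>j<m. c t j * a (i + j))) = (\<Sum>(i,j)\<in>{..<m}\<times>{..<m}. c s i * c t j * a (i + j))"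
    by (simp add: sum.cartesian_product sum_distrib_left mult.assoc)
  also have "\<dots> = (\<Sum>(i,j)\<in>{(i,j). i + j < m}. c s i * c t j * a (i + j))"
    by (intro sum.mono_neutral_right) (auto, meson a not_less)
  also have "\<dots> = (\<Sum>k<m. \<Sum>i\<le>k. c s i * c t (k - i) * a (i + (k - i)))"
    by (rule sum.triangle_reindex)
  also have "\<dots> = (\<Sum>k<m. c (s + t) k * a k)"
    by (intro sum.cong refl) (simp add: sum_distrib_right flip: bin)
  finally have "(\<Sum>i<m. c s i * (\<Sum>j<m. c t j * a (i + j))) = (\<Sum>k<m. c (s + t) k * a k)" .
  moreover have "J lam m s (\<lambda>i. J lam m t (\<lambda>j. a (i + j)))
      = exp (lam * of_real s) * exp (lam * of_real t) * (\<Sum>i<m. c s i * (\<Sum>j<m. c t j * a (i + j)))"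
    unfolding J_def c_def by (simp add: sum_distrib_left mult_ac)
  ultimately show ?thesis by (simp add: J_def c_def exp_add distrib_left)
qed

text \<open>The powers of t are absorbed by an arbitrarily small exponential rate, as (e |t|)^j / j!
  \<le> exp (e |t|). With |t| in the exponent the bound serves both time directions.\<close>

lemma J_bound:
  assumes e: "0 < e"
  obtains C where "0 < C"
    "\<And>t a A. (\<And>j. norm (a j) \<le> A) \<Longrightarrow> norm (J lam m t a) \<le> C * exp (Re lam * t + e * \<bar>t\<bar>) * A"
proof (rule that[of "(\<Sum>j<m. 1 / e ^ j) + 1"])
  show "0 < (\<Sum>j<m. 1 / e ^ j) + 1" using e by (intro add_nonneg_pos sum_nonneg) auto
  fix t A :: real and a :: "nat \<Rightarrow> complex"
  assume a: "\<And>j. norm (a j) \<le> A"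
  have A: "0 \<le> A" using a[of 0] norm_ge_zero order_trans by blast
  have trm: "norm (of_real (t ^ j / fact j) * a j) \<le> 1 / e ^ j * (exp (e * \<bar>t\<bar>) * A)" for j
  proof -
    have "(\<Sum>k\<in>{j}. (e * \<bar>t\<bar>) ^ k /\<^sub>R fact k) \<le> exp (e * \<bar>t\<bar>)"
      unfolding exp_def by (rule sum_le_suminf[OF summable_exp_generic]) (use e in auto)
    then have "\<bar>t\<bar> ^ j / fact j \<le> 1 / e ^ j * exp (e * \<bar>t\<bar>)"
      using e by (simp add: field_simps power_mult_distrib)
    then have "\<bar>t\<bar> ^ j / fact j * norm (a j) \<le> (1 / e ^ j * exp (e * \<bar>t\<bar>)) * A"
      using e a by (intro mult_mono) auto
    then show ?thesis by (simp add: norm_mult norm_divide norm_power mult.assoc)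
  qed
  have "norm (\<Sum>j<m. of_real (t ^ j / fact j) * a j) \<le> (\<Sum>j<m. 1 / e ^ j * (exp (e * \<bar>t\<bar>) * A))"
    by (intro sum_norm_le trm)
  also have "\<dots> = (\<Sum>j<m. 1 / e ^ j) * (exp (e * \<bar>t\<bar>) * A)" by (simp add: sum_distrib_right)
  also have "\<dots> \<le> ((\<Sum>j<m. 1 / e ^ j) + 1) * (exp (e * \<bar>t\<bar>) * A)" using A by (intro mult_right_mono) auto
  finally have "norm (J lam m t a) \<le> exp (Re lam * t) * (((\<Sum>j<m. 1 / e ^ j) + 1) * (exp (e * \<bar>t\<bar>) * A))"
    unfolding J_def norm_mult norm_exp_eq_Re by (intro mult_mono) auto
  then show "norm (J lam m t a) \<le> ((\<Sum>j<m. 1 / e ^ j) + 1) * exp (Re lam * t + e * \<bar>t\<bar>) * A"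
    by (simp add: exp_add mult_ac)
qed

text \<open>Differentiating the powers of \<open>g\<close> shifts the index by one;
  \<open>am\<close> fills in the top term, so that the shifted sum is again a full
  \<open>J\<close>.\<close>

lemma J_has_vector_derivative:
  assumes g: "(g has_real_derivative g') (at s within S)"
    and a: "\<And>j. (a j has_vector_derivative a' j) (at s within S)"
    and am: "a m s = 0"
  shows "((\<lambda>s. J lam m (g s) (\<lambda>j. a j s)) has_vector_derivative
    of_real g' * (lam * J lam m (g s) (\<lambda>j. a j s) + J lam m (g s) (\<lambda>j. a (Suc j) s)) + J lam m (g s) a')
    (at s within S)"
proof -
  have 1: "((\<lambda>s. exp (lam * of_real (g s))) has_vector_derivative of_real g' * (lam * exp (lam * of_real (g s))))
      (at s within S)"
  proof -
    have "((\<lambda>s. of_real (g s) :: complex) has_vector_derivative of_real g') (at s within S)"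
      using g unfolding has_real_derivative_iff_has_vector_derivative
      by (rule bounded_linear.has_vector_derivative[OF bounded_linear_of_real])
    then have "((\<lambda>s. lam * of_real (g s)) has_vector_derivative lam * of_real g') (at s within S)"
      by (rule has_vector_derivative_mult_right)
    from field_vector_diff_chain_within[OF this, of exp "exp (lam * of_real (g s))"]
    have "(exp \<circ> (\<lambda>s. lam * of_real (g s)) has_vector_derivative lam * of_real g' * exp (lam * of_real (g s)))
        (at s within S)" by (auto intro: has_field_derivative_at_within DERIV_exp)
    then show ?thesis by (simp add: o_def mult_ac)
  qed
  have 2: "((\<lambda>s. \<Sum>j<m. of_real (g s ^ j / fact j) * a j s) has_vector_derivative
      of_real g' * (\<Sum>j<m. of_real (g s ^ j / fact j) * a (Suc j) s) + (\<Sum>j<m. of_real (g s ^ j / fact j) * a' j))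
      (at s within S)"
  proof -
    have t: "((\<lambda>s. of_real (g s ^ j / fact j) * a j s) has_vector_derivative
        of_real (g s ^ j / fact j) * a' j + of_real (real j * (g' * g s ^ (j - 1)) / fact j) * a j s) (at s within S)" for j
    proof (rule has_vector_derivative_mult[OF _ a])
      have "((\<lambda>s. g s ^ j / fact j) has_real_derivative real j * (g' * g s ^ (j - 1)) / fact j) (at s within S)"
        using g by (auto intro!: derivative_eq_intros)
      then show "((\<lambda>s. of_real (g s ^ j / fact j) :: complex) has_vector_derivative
          of_real (real j * (g' * g s ^ (j - 1)) / fact j)) (at s within S)"
        unfolding has_real_derivative_iff_has_vector_derivative by (rule bounded_linear.has_vector_derivative[OF bounded_linear_of_real])
    qed
    have "(\<Sum>j<m. of_real (real j * (g' * g s ^ (j - 1)) / fact j) * a j s)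
        = of_real g' * (\<Sum>j<m. of_real (g s ^ j / fact j) * a (Suc j) s)"
    proof (cases m)
      case (Suc n)
      have "(\<Sum>j<m. of_real (real j * (g' * g s ^ (j - 1)) / fact j) * a j s)
          = (\<Sum>j<n. of_real (real (Suc j) * (g' * g s ^ j) / fact (Suc j)) * a (Suc j) s)"
        unfolding Suc by (subst sum.lessThan_Suc_shift) simp
      also have "\<dots> = (\<Sum>j<n. of_real g' * (of_real (g s ^ j / fact j) * a (Suc j) s))"
      proof (intro sum.cong refl)
        fix j
        have "real (Suc j) * (g' * g s ^ j) / fact (Suc j) = g' * (g s ^ j / fact j)"
          by (simp add: divide_simps del: of_nat_Suc)
        then show "of_real (real (Suc j) * (g' * g s ^ j) / fact (Suc j)) * a (Suc j) s
          = of_real g' * (of_real (g s ^ j / fact j) * a (Suc j) s)"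
          by (simp only: of_real_mult mult.assoc)
      qed
      also have "\<dots> = of_real g' * (\<Sum>j<m. of_real (g s ^ j / fact j) * a (Suc j) s)"
        using am by (simp add: Suc sum_distrib_left)
      finally show ?thesis .
    qed simp
    moreover have "((\<lambda>s. \<Sum>j<m. of_real (g s ^ j / fact j) * a j s) has_vector_derivative
        (\<Sum>j<m. of_real (g s ^ j / fact j) * a' j + of_real (real j * (g' * g s ^ (j - 1)) / fact j) * a j s))
        (at s within S)" by (rule has_vector_derivative_sum) (rule t)
    ultimately show ?thesis unfolding sum.distrib by (simp only: add.commute)
  qed
  from has_vector_derivative_mult[OF 1 2] show ?thesis
    unfolding J_def by (simp add: algebra_simps)
qed

text \<open>\<open>nshift F lam\<close> is the operator \<open>u \<mapsto> u \<circ> F - lam u\<close> on complex-valued functionals, so a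
  functional annihilated by a power of it is a generalized left eigenvector of \<open>F\<close>.\<close>

definition nshift :: "('a \<Rightarrow> 'a) \<Rightarrow> complex \<Rightarrow> ('a \<Rightarrow> complex) \<Rightarrow> 'a \<Rightarrow> complex" where
  "nshift F lam u x = u (F x) - lam * u x"

lemma linear_nshift:
  assumes "linear F" "linear u"
  shows "linear (nshift F lam u)"
  using assms unfolding nshift_def[abs_def]
  by (auto intro!: linear_compose_sub simp: linear_iff algebra_simps)

lemma linear_nshift_pow: "linear F \<Longrightarrow> linear u \<Longrightarrow> linear ((nshift F lam ^^ m) u)"
  by (induction m) (auto intro: linear_nshift)

lemma nshift_0 [simp]: "nshift F lam (\<lambda>_. 0) = (\<lambda>_. 0)"
  by (simp add: nshift_def fun_eq_iff)

lemma nshift_pow_0 [simp]: "(nshift F lam ^^ m) (\<lambda>_. 0) = (\<lambda>_. 0)"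
  by (induction m) auto

lemma nshift_comb:
  "nshift F lam (\<lambda>x. a * u x + b * v x) = (\<lambda>x. a * nshift F lam u x + b * nshift F lam v x)"
  by (simp add: nshift_def fun_eq_iff algebra_simps)

lemma nshift_pow_comb:
  "(nshift F lam ^^ m) (\<lambda>x. a * u x + b * v x) = (\<lambda>x. a * (nshift F lam ^^ m) u x + b * (nshift F lam ^^ m) v x)"
  by (induction m) (auto simp: nshift_comb)

lemma nshift_pow_mono:
  assumes "(nshift F lam ^^ m) u = (\<lambda>_. 0)" "m \<le> k"
  shows "(nshift F lam ^^ k) u = (\<lambda>_. 0)"
proof -
  have "(nshift F lam ^^ k) u = (nshift F lam ^^ (k - m)) ((nshift F lam ^^ m) u)"
    using assms(2) by (simp flip: funpow_add comp_apply[of "_ ^^ _"])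
  then show ?thesis using assms(1) by simp
qed

lemma linear_comb_complex:
  fixes u v :: "'a::real_vector \<Rightarrow> complex"
  assumes "linear u" "linear v"
  shows "linear (\<lambda>x. a * u x + b * v x)"
  using assms by (auto simp: linear_iff algebra_simps)

text \<open>On functionals killed by a power of \<open>nshift F mu\<close>, the operator for
  \<open>lam\<close> is the nonzero scalar mu - lam plus a nilpotent operator, hence invertible; the
  induction unrolls the finite Neumann series.\<close>

lemma nshift_solve:
  assumes F: "linear F" and "linear u" "(nshift F mu ^^ m) u = (\<lambda>_. 0)" "mu \<noteq> lam"
  shows "\<exists>w. linear w \<and> (nshift F mu ^^ m) w = (\<lambda>_. 0) \<and> nshift F lam w = u"
  using assms(2-)
proof (induction m arbitrary: u)
  case 0
  then show ?case by (intro exI[of _ "\<lambda>_. 0"]) (auto simp: linear_iff)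
next
  case (Suc m)
  let ?u1 = "nshift F mu u"
  define d where "d = mu - lam"
  have d: "d \<noteq> 0" using Suc.prems by (simp add: d_def)
  have "(nshift F mu ^^ m) ?u1 = (\<lambda>_. 0)" using Suc.prems by (simp add: funpow_swap1)
  then obtain w1 where w1: "linear w1" "(nshift F mu ^^ m) w1 = (\<lambda>_. 0)" "nshift F lam w1 = ?u1"
    using Suc.IH[of ?u1] linear_nshift[OF F] Suc.prems by blast
  let ?w = "\<lambda>x. 1 / d * u x + (- 1 / d) * w1 x"
  have "(nshift F mu ^^ Suc m) ?w = (\<lambda>_. 0)"
    unfolding nshift_pow_comb using Suc.prems w1 by simp
  moreover have "nshift F lam ?w = u"
  proof
    fix x
    have "nshift F lam ?w x = 1 / d * (nshift F lam u x - ?u1 x)"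
      unfolding nshift_comb w1(3) by (simp add: algebra_simps)
    also have "nshift F lam u x - ?u1 x = d * u x" by (simp add: nshift_def d_def algebra_simps)
    finally show "nshift F lam ?w x = u x" using d by simp
  qed
  ultimately show ?case using linear_comb_complex[OF Suc.prems(1) w1(1)] by blast
qed

text \<open>Sums of generalized eigenfunctionals as a predicate with an induction rule, in place of
  a direct sum of spaces; an eigenvalue may occur repeatedly.\<close>

inductive gsum :: "('a::real_vector \<Rightarrow> 'a) \<Rightarrow> ('a \<Rightarrow> complex) \<Rightarrow> bool" for F where
  zero: "gsum F (\<lambda>_. 0)"
| add: "linear u \<Longrightarrow> (nshift F lam ^^ m) u = (\<lambda>_. 0) \<Longrightarrow> gsum F v \<Longrightarrow> gsum F (\<lambda>x. u x + v x)"

lemma gsum_linear: "gsum F u \<Longrightarrow> linear u"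
  by (induction rule: gsum.induct) (auto simp: linear_iff algebra_simps)

text \<open>Summands for eigenvalues other than \<open>lam\<close> lie in the range of
  \<open>nshift F lam\<close>; those for \<open>lam\<close> are collected in z.\<close>

lemma gsum_nshift_range:
  assumes "gsum F u" and F: "linear F"
  shows "\<exists>w z m. gsum F w \<and> linear z \<and> (nshift F lam ^^ m) z = (\<lambda>_. 0) \<and> u = (\<lambda>x. nshift F lam w x + z x)"
  using assms(1)
proof (induction rule: gsum.induct)
  case zero
  show ?case
    by (intro exI[of _ "\<lambda>_. 0"] exI[of _ 0]) (auto intro: gsum.zero simp: linear_iff)
next
  case (add u mu m v)
  then obtain w z k where IH: "gsum F w" "linear z" "(nshift F lam ^^ k) z = (\<lambda>_. 0)"
    "v = (\<lambda>x. nshift F lam w x + z x)" by blast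
  show ?case
  proof (cases "mu = lam")
    case True
    have "(nshift F lam ^^ max m k) (\<lambda>x. 1 * u x + 1 * z x) = (\<lambda>_. 0)"
      unfolding nshift_pow_comb
      using nshift_pow_mono[OF add(2), of "max m k"] nshift_pow_mono[OF IH(3), of "max m k"] True by simp
    then show ?thesis using IH add linear_comb_complex[of u z 1 1]
      by (intro exI[of _ w] exI[of _ "\<lambda>x. u x + z x"] exI[of _ "max m k"]) (auto simp: fun_eq_iff)
  next
    case False
    then obtain w1 where w1: "linear w1" "(nshift F mu ^^ m) w1 = (\<lambda>_. 0)" "nshift F lam w1 = u"
      using nshift_solve[OF F add(1,2)] by blast
    have "nshift F lam (\<lambda>x. w1 x + w x) = (\<lambda>x. u x + nshift F lam w x)"
      using nshift_comb[of F lam 1 w1 1 w] w1 by simp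
    then show ?thesis using IH gsum.add[OF w1(1,2) IH(1)]
      by (intro exI[of _ "\<lambda>x. w1 x + w x"] exI[of _ z] exI[of _ k]) (auto simp: fun_eq_iff)
  qed
qed

primrec ann :: "('a \<Rightarrow> 'a) \<Rightarrow> complex list \<Rightarrow> ('a \<Rightarrow> complex) \<Rightarrow> bool" where
  "ann F [] u \<longleftrightarrow> u = (\<lambda>_. 0)"
| "ann F (l # ls) u \<longleftrightarrow> ann F ls (nshift F l u)"

text \<open>Primary decomposition by induction over the linear factors, without coprimality: after
  subtracting the w supplied by \<open>gsum_nshift_range\<close>, the rest of u is killed by a power
  of the first factor.\<close>

lemma gsum_if_ann:
  assumes F: "linear F"
  shows "linear u \<Longrightarrow> ann F ls u \<Longrightarrow> gsum F u"
proof (induction ls arbitrary: u)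
  case (Cons l ls)
  then have "gsum F (nshift F l u)" using linear_nshift[OF F] by auto
  then obtain w z m where w: "gsum F w" "linear z" "(nshift F l ^^ m) z = (\<lambda>_. 0)"
    "nshift F l u = (\<lambda>x. nshift F l w x + z x)" using gsum_nshift_range[OF _ F] by blast
  let ?v = "\<lambda>x. 1 * u x + (- 1) * w x"
  have "nshift F l ?v = z" unfolding nshift_comb w(4) by simp
  then have "(nshift F l ^^ Suc m) ?v = (\<lambda>_. 0)" using w(3) by (simp only: funpow_Suc_right comp_apply)
  moreover have "linear ?v" using Cons.prems gsum_linear[OF w(1)] by (intro linear_comb_complex)
  ultimately have "gsum F (\<lambda>x. ?v x + w x)" using w(1) by (intro gsum.add)
  then show ?case by simp
qed (simp add: gsum.zero)

text \<open>Stated for sequences, whereas \<open>dependent\<close> speaks of sets; a repeated vector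
  is a relation by itself.\<close>

lemma linear_relation:
  fixes v :: "nat \<Rightarrow> 'a::euclidean_space"
  shows "\<exists>c n. (\<exists>k\<le>n. c k \<noteq> 0) \<and> (\<Sum>k\<le>n. c k *\<^sub>R v k) = 0"
proof (cases "inj_on v {..DIM('a)}")
  case True
  then have "dependent (v ` {..DIM('a)})" by (intro dependent_biggerset) (simp add: card_image)
  then obtain u where u: "\<exists>w\<in>v ` {..DIM('a)}. u w \<noteq> 0" "(\<Sum>w\<in>v ` {..DIM('a)}. u w *\<^sub>R w) = 0"
    using dependent_finite[of "v ` {..DIM('a)}"] by auto
  then show ?thesis using True by (intro exI[of _ "\<lambda>k. u (v k)"] exI[of _ "DIM('a)"]) (auto simp: sum.reindex)
next
  case False
  then obtain i j where ij: "i \<le> DIM('a)" "j \<le> DIM('a)" "i \<noteq> j" "v i = v j" by (auto simp: inj_on_def)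
  let ?c = "\<lambda>k. if k = i then 1 else if k = j then -1 else (0::real)"
  have "(\<Sum>k\<le>DIM('a). ?c k *\<^sub>R v k) = (\<Sum>k\<in>{i,j}. ?c k *\<^sub>R v k)"
    using ij by (intro sum.mono_neutral_right) auto
  also have "\<dots> = 0" using ij by simp
  finally show ?thesis using ij by (intro exI[of _ ?c] exI[of _ "DIM('a)"]) auto
qed

text \<open>The polynomial p evaluated at the operator of composition with F, applied to u.\<close>

definition papply :: "('a \<Rightarrow> 'a) \<Rightarrow> complex poly \<Rightarrow> ('a \<Rightarrow> complex) \<Rightarrow> 'a \<Rightarrow> complex" where
  "papply F p u x = (\<Sum>k\<le>degree p. coeff p k * u ((F ^^ k) x))"

lemma papply_linear_factor: "papply F ([:- z, 1:] * q) u = papply F q (nshift F z u)"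
proof
  fix x
  show "papply F ([:- z, 1:] * q) u x = papply F q (nshift F z u) x"
  proof (cases "q = 0")
    case False
    then have deg: "degree ([:- z, 1:] * q) = Suc (degree q)" by (subst degree_mult_eq) auto
    let ?n = "degree q"
    have "papply F ([:- z, 1:] * q) u x
        = (\<Sum>k\<le>Suc ?n. coeff (pCons 0 q) k * u ((F ^^ k) x)) + (\<Sum>k\<le>Suc ?n. - z * coeff q k * u ((F ^^ k) x))"
      unfolding papply_def deg by (simp add: sum.distrib[symmetric] algebra_simps del: sum.atMost_Suc)
    also have "(\<Sum>k\<le>Suc ?n. coeff (pCons 0 q) k * u ((F ^^ k) x)) = (\<Sum>k\<le>?n. coeff q k * u (F ((F ^^ k) x)))"
      by (subst sum.atMost_Suc_shift) simp
    also have "(\<Sum>k\<le>Suc ?n. - z * coeff q k * u ((F ^^ k) x)) = (\<Sum>k\<le>?n. - z * coeff q k * u ((F ^^ k) x))"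
      by (simp add: coeff_eq_0)
    finally show ?thesis
      by (simp add: papply_def nshift_def sum.distrib[symmetric] algebra_simps)
  qed (simp add: papply_def)
qed

lemma ann_if_papply: "p \<noteq> 0 \<Longrightarrow> papply F p u = (\<lambda>_. 0) \<Longrightarrow> \<exists>ls. ann F ls u"
proof (induction "degree p" arbitrary: p u rule: less_induct)
  case less
  show ?case
  proof (cases "degree p = 0")
    case True
    then obtain a where "p = [:a:]" using degree_eq_zeroE by blast
    then have "u = (\<lambda>_. 0)" using less.prems by (auto simp: papply_def fun_eq_iff)
    then show ?thesis by (intro exI[of _ "[]"]) simp
  next
    case False
    then obtain z where "poly p z = 0"
      using fundamental_theorem_of_algebra[of p] by (auto simp: constant_degree)
    then obtain q where q: "p = [:- z, 1:] * q" by (auto simp: poly_eq_0_iff_dvd)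
    then have "q \<noteq> 0" using less.prems by auto
    then have "degree q < degree p" unfolding q by (subst degree_mult_eq) auto
    then obtain ls where "ann F ls (nshift F z u)"
      using less.hyps[of q "nshift F z u"] \<open>q \<noteq> 0\<close> less.prems(2) papply_linear_factor[of F z q u] q by auto
    then show ?thesis by (intro exI[of _ "z # ls"]) simp
  qed
qed

text \<open>The iterates of b under the adjoint satisfy a linear relation. Its coefficients form a
  polynomial that annihilates the coordinate functional and splits over the complex numbers.\<close>

lemma ann_coordinate:
  fixes F :: "'a::euclidean_space \<Rightarrow> 'a"
  assumes F: "linear F"
  shows "\<exists>ls. ann F ls (\<lambda>x. of_real (b \<bullet> x))"
proof -
  obtain c n where c: "\<exists>k\<le>n. c k \<noteq> 0" "(\<Sum>k\<le>n. c k *\<^sub>R (adjoint F ^^ k) b) = 0"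
    using linear_relation[of "\<lambda>k. (adjoint F ^^ k) b"] by auto
  have adj: "(adjoint F ^^ k) b \<bullet> x = b \<bullet> (F ^^ k) x" for k x
  proof (induction k arbitrary: x)
    case (Suc k)
    have "(adjoint F ^^ Suc k) b \<bullet> x = (adjoint F ^^ k) b \<bullet> F x"
      using adjoint_works[OF F, of x "(adjoint F ^^ k) b"] by (simp add: inner_commute)
    also have "\<dots> = b \<bullet> (F ^^ Suc k) x" using Suc[of "F x"] by (simp add: funpow_swap1)
    finally show ?case .
  qed simp
  define p where "p = (\<Sum>k\<le>n. monom (complex_of_real (c k)) k)"
  have coeff: "coeff p k = (if k \<le> n then of_real (c k) else 0)" for k
    by (auto simp: p_def coeff_sum if_distrib cong: if_cong)
  then have "p \<noteq> 0" using c(1) by (metis coeff_0 of_real_eq_0_iff)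
  have deg: "degree p \<le> n" by (rule degree_le) (simp add: coeff)
  have "papply F p (\<lambda>x. of_real (b \<bullet> x)) x = 0" for x
  proof -
    have "papply F p (\<lambda>x. of_real (b \<bullet> x)) x = (\<Sum>k\<le>n. coeff p k * of_real (b \<bullet> (F ^^ k) x))"
      unfolding papply_def using deg by (intro sum.mono_neutral_left) (auto simp: coeff_eq_0)
    also have "\<dots> = of_real (\<Sum>k\<le>n. c k * ((adjoint F ^^ k) b \<bullet> x))" by (simp add: coeff adj)
    also have "(\<Sum>k\<le>n. c k * ((adjoint F ^^ k) b \<bullet> x)) = (\<Sum>k\<le>n. c k *\<^sub>R (adjoint F ^^ k) b) \<bullet> x"
      by (simp add: inner_sum_left)
    finally show ?thesis by (simp add: c(2))
  qed
  then have "papply F p (\<lambda>x. of_real (b \<bullet> x)) = (\<lambda>_. 0)" by (rule ext)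
  then show ?thesis by (rule ann_if_papply[OF \<open>p \<noteq> 0\<close>])
qed

lemma linear_coordinate: "linear (\<lambda>x. complex_of_real (b \<bullet> x))"
  by (auto simp: linear_iff inner_add_right scaleR_conv_of_real)

lemma gsum_coordinate:
  fixes F :: "'a::euclidean_space \<Rightarrow> 'a"
  assumes "linear F"
  shows "gsum F (\<lambda>x. of_real (b \<bullet> x))"
  using gsum_if_ann[OF assms linear_coordinate] ann_coordinate[OF assms] by blast

text \<open>A quadratic form given through its differential, Euler's identity and a bilinear bound.
  No definiteness is required, because the Lyapunov forms below may have directions of either
  sign.\<close>

definition quad :: "('a::real_normed_vector \<Rightarrow> real) \<Rightarrow> ('a \<Rightarrow> 'a \<Rightarrow> real) \<Rightarrow> bool" where
  "quad Q Q' \<longleftrightarrow> (\<forall>x. (Q has_derivative Q' x) (at x)) \<and> (\<forall>x. Q' x x = 2 * Q x) \<and>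
    (\<exists>K. \<forall>x h. \<bar>Q' x h\<bar> \<le> K * norm x * norm h)"

lemma quad_comb:
  assumes "quad Q Q'" "quad R R'"
  shows "quad (\<lambda>x. a * Q x + b * R x) (\<lambda>x h. a * Q' x h + b * R' x h)"
proof -
  obtain K L where K: "\<And>x h. \<bar>Q' x h\<bar> \<le> K * norm x * norm h" and L: "\<And>x h. \<bar>R' x h\<bar> \<le> L * norm x * norm h"
    using assms unfolding quad_def by blast
  have "\<bar>a * Q' x h + b * R' x h\<bar> \<le> (\<bar>a\<bar> * K + \<bar>b\<bar> * L) * norm x * norm h" for x h
  proof -
    have "\<bar>a * Q' x h + b * R' x h\<bar> \<le> \<bar>a\<bar> * \<bar>Q' x h\<bar> + \<bar>b\<bar> * \<bar>R' x h\<bar>"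
      by (metis abs_mult abs_triangle_ineq)
    also have "\<dots> \<le> \<bar>a\<bar> * (K * norm x * norm h) + \<bar>b\<bar> * (L * norm x * norm h)"
      by (intro add_mono mult_left_mono K L) auto
    finally show ?thesis by (simp add: algebra_simps)
  qed
  moreover have "((\<lambda>x. a * Q x + b * R x) has_derivative (\<lambda>h. a * Q' x h + b * R' x h)) (at x)" for x
    using assms unfolding quad_def by (intro has_derivative_add has_derivative_mult_right) auto
  moreover have "a * Q' x x + b * R' x x = 2 * (a * Q x + b * R x)" for x
    using assms by (simp add: quad_def algebra_simps)
  ultimately show ?thesis unfolding quad_def by blast
qed

lemma quad_0: "quad (\<lambda>_. 0) (\<lambda>_ _. 0)"
  unfolding quad_def by (auto intro!: exI[of _ 0])

lemma quad_norm_sq: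
  fixes u :: "'a::euclidean_space \<Rightarrow> complex"
  assumes "linear u"
  shows "quad (\<lambda>x. (norm (u x))\<^sup>2) (\<lambda>x h. 2 * (u x \<bullet> u h))"
proof -
  have bl: "bounded_linear u" using assms by (simp add: linear_conv_bounded_linear)
  then obtain B where B: "\<And>x. norm (u x) \<le> norm x * B" "0 < B" using bounded_linear.pos_bounded by blast
  have "\<bar>2 * (u x \<bullet> u h)\<bar> \<le> (2 * B * B) * norm x * norm h" for x h
  proof -
    have "\<bar>u x \<bullet> u h\<bar> \<le> norm (u x) * norm (u h)" by (rule Cauchy_Schwarz_ineq2)
    also have "\<dots> \<le> (norm x * B) * (norm h * B)" using B(2) by (intro mult_mono B) auto
    finally show ?thesis by (simp add: abs_mult mult_ac)
  qed
  moreover have "((\<lambda>x. (norm (u x))\<^sup>2) has_derivative (\<lambda>h. 2 * (u x \<bullet> u h))) (at x)" for x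
    unfolding power2_norm_eq_inner
    by (rule has_derivative_eq_rhs, rule has_derivative_inner;
        (rule bounded_linear_imp_has_derivative[OF bl])?) (simp add: inner_commute)
  ultimately show ?thesis unfolding quad_def by (auto simp: power2_norm_eq_inner)
qed

text \<open>The derivative of |u|^2 / a along F + s is 2 |u|^2 plus a cross term with v =
  \<open>nshift F l u\<close>. Completing the square absorbs the cross term at the cost of |v|^2 /
  a^2, which the form for the shorter list dominates. As a = Re l + s may have either sign, the form
  is indefinite in general.\<close>

lemma quad_if_ann:
  fixes F :: "'a::euclidean_space \<Rightarrow> 'a"
  assumes F: "linear F"
  shows "linear u \<Longrightarrow> ann F ls u \<Longrightarrow> (\<And>l. l \<in> set ls \<Longrightarrow> Re l + s \<noteq> 0) \<Longrightarrow>
    \<exists>Q Q'. quad Q Q' \<and> (\<forall>x. (norm (u x))\<^sup>2 \<le> Q' x (F x + s *\<^sub>R x))"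
proof (induction ls arbitrary: u)
  case Nil
  then show ?case using quad_0 by fastforce
next
  case (Cons l ls)
  let ?v = "nshift F l u"
  define a where "a = Re l + s"
  have a: "a \<noteq> 0" using Cons.prems(3)[of l] by (simp add: a_def)
  obtain Q Q' where Q: "quad Q Q'" "\<And>x. (norm (?v x))\<^sup>2 \<le> Q' x (F x + s *\<^sub>R x)"
    using Cons.IH[of ?v] Cons.prems linear_nshift[OF F Cons.prems(1)] by auto
  have "(norm (u x))\<^sup>2 \<le> 1 / a * (2 * (u x \<bullet> u (F x + s *\<^sub>R x))) + 1 / a\<^sup>2 * Q' x (F x + s *\<^sub>R x)" for x
  proof -
    have "u (F x + s *\<^sub>R x) = ?v x + (l + of_real s) * u x"
      using Cons.prems(1) by (simp add: nshift_def linear_add linear_scale scaleR_conv_of_real algebra_simps)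
    moreover have "u x \<bullet> ((l + of_real s) * u x) = a * (norm (u x))\<^sup>2"
      unfolding cmod_power2 inner_complex_def by (simp add: a_def power2_eq_square algebra_simps)
    ultimately have e: "u x \<bullet> u (F x + s *\<^sub>R x) = u x \<bullet> ?v x + a * (norm (u x))\<^sup>2"
      by (simp add: inner_add_right)
    have "0 \<le> (norm (u x + (1 / a) *\<^sub>R ?v x))\<^sup>2" by simp
    also have "\<dots> = (norm (u x))\<^sup>2 + 2 / a * (u x \<bullet> ?v x) + 1 / a\<^sup>2 * (norm (?v x))\<^sup>2"
      unfolding power2_norm_eq_inner
      by (simp add: inner_add_left inner_add_right inner_commute power2_eq_square)
    finally have "0 \<le> (norm (u x))\<^sup>2 + 2 / a * (u x \<bullet> ?v x) + 1 / a\<^sup>2 * (norm (?v x))\<^sup>2" .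
    moreover have "1 / a\<^sup>2 * (norm (?v x))\<^sup>2 \<le> 1 / a\<^sup>2 * Q' x (F x + s *\<^sub>R x)"
      using Q(2)[of x] by (intro mult_left_mono) auto
    moreover have "1 / a * (2 * (u x \<bullet> u (F x + s *\<^sub>R x))) = 2 / a * (u x \<bullet> ?v x) + 2 * (norm (u x))\<^sup>2"
      unfolding e using a by (simp add: field_simps)
    ultimately show ?thesis by linarith
  qed
  then show ?case
    using quad_comb[OF quad_norm_sq[OF Cons.prems(1)] Q(1), of "1 / a" "1 / a\<^sup>2"] by blast
qed

text \<open>Adding the forms of all coordinate functionals dominates the full norm. The excluded
  values are the negated real parts of the roots that occur in the annihilating
  factorizations.\<close>

lemma hyperbolic_quad:
  fixes F :: "'a::euclidean_space \<Rightarrow> 'a"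
  assumes F: "linear F"
  obtains L :: "real set" where "finite L"
    "\<And>s. s \<notin> L \<Longrightarrow> \<exists>Q Q'. quad Q Q' \<and> (\<forall>x. (norm x)\<^sup>2 \<le> Q' x (F x + s *\<^sub>R x))"
proof -
  obtain ls where ls: "\<And>b. ann F (ls b) (\<lambda>x. of_real (b \<bullet> x))" using ann_coordinate[OF F] by metis
  define L where "L = (\<Union>b\<in>Basis. (\<lambda>l. - Re l) ` set (ls b))"
  have "\<exists>Q Q'. quad Q Q' \<and> (\<forall>x. (norm x)\<^sup>2 \<le> Q' x (F x + s *\<^sub>R x))" if s: "s \<notin> L" for s
  proof -
    have "\<exists>Q Q'. quad Q Q' \<and> (\<forall>x. (norm (complex_of_real (b \<bullet> x)))\<^sup>2 \<le> Q' x (F x + s *\<^sub>R x))"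
      if "b \<in> Basis" for b
      using s that by (intro quad_if_ann[OF F linear_coordinate ls]) (force simp: L_def)
    then obtain Q Q' where Q: "\<And>b. b \<in> Basis \<Longrightarrow> quad (Q b) (Q' b)"
      "\<And>b x. b \<in> Basis \<Longrightarrow> (b \<bullet> x)\<^sup>2 \<le> Q' b x (F x + s *\<^sub>R x)" by (simp add: norm_of_real) metis
    have "quad (\<lambda>x. \<Sum>b\<in>B. Q b x) (\<lambda>x h. \<Sum>b\<in>B. Q' b x h)" if "finite B" "B \<subseteq> Basis" for B
      using that
    proof (induction B rule: finite_induct)
      case (insert b B)
      then show ?case using quad_comb[of "Q b" "Q' b" _ _ 1 1] Q(1)[of b] by simp
    qed (simp add: quad_0)
    then have "quad (\<lambda>x. \<Sum>b\<in>Basis. Q b x) (\<lambda>x h. \<Sum>b\<in>Basis. Q' b x h)" by simp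
    moreover have "(norm x)\<^sup>2 \<le> (\<Sum>b\<in>Basis. Q' b x (F x + s *\<^sub>R x))" for x
    proof -
      have "(norm x)\<^sup>2 = (\<Sum>b\<in>Basis. (b \<bullet> x)\<^sup>2)"
        unfolding power2_norm_eq_inner euclidean_inner[of x x] by (simp add: power2_eq_square inner_commute)
      also have "\<dots> \<le> (\<Sum>b\<in>Basis. Q' b x (F x + s *\<^sub>R x))" by (intro sum_mono Q(2))
      finally show ?thesis .
    qed
    ultimately show ?thesis by blast
  qed
  then show ?thesis using that[of L] by (simp add: L_def)
qed

section \<open>The cutoff construction\<close>

definition possq :: "real \<Rightarrow> real" where "possq s = (max 0 s)\<^sup>2"

lemma possq_deriv: "(possq has_real_derivative 2 * max 0 s) (at s)"
proof (cases "s = 0")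
  case True
  have "(possq has_derivative (\<lambda>h. 0)) (at 0)"
    by (rule quadratic_error_imp_has_derivative[of _ 1 _ _ 1])
       (auto simp: possq_def max_def)
  then show ?thesis using True by (simp add: has_field_derivative_def lambda_zero)
next
  case False
  show ?thesis
  proof (cases "0 < s")
    case True
    have "((\<lambda>s. s\<^sup>2) has_real_derivative 2 * s) (at s)" by (auto intro!: derivative_eq_intros)
    then have "(possq has_real_derivative 2 * s) (at s)"
      by (rule has_field_derivative_transform_within_open[of _ _ _ "{0<..}"]) (auto simp: possq_def True)
    then show ?thesis using True by simp
  next
    case False
    then have "s < 0" using \<open>s \<noteq> 0\<close> by simp
    have "((\<lambda>s. 0) has_real_derivative 0) (at s)" by simp
    then have "(possq has_real_derivative 0) (at s)"
      by (rule has_field_derivative_transform_within_open[of _ _ _ "{..<0}"]) (auto simp: possq_def \<open>s < 0\<close>)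
    then show ?thesis using \<open>s < 0\<close> by simp
  qed
qed

text \<open>The inner \<open>possq\<close> is 0 from 2 on and at least 1 up to 1; the outer one
  turns this into the plateaus 0 and 1 of a C1 cutoff.\<close>

definition chi :: "real \<Rightarrow> real" where "chi s = 1 - possq (1 - possq (2 - s))"

definition chi' :: "real \<Rightarrow> real" where "chi' s = - (2 * max 0 (1 - possq (2 - s))) * (2 * max 0 (2 - s))"

lemma chi_deriv: "(chi has_real_derivative chi' s) (at s)"
proof -
  have "((\<lambda>s. 2 - s) has_real_derivative - 1) (at s)" by (auto intro!: derivative_eq_intros)
  note DERIV_diff[OF DERIV_const DERIV_chain2[OF possq_deriv this], of 1]
  note DERIV_diff[OF DERIV_const DERIV_chain2[OF possq_deriv this], of 1]
  then show ?thesis unfolding chi_def[abs_def] chi'_def by (rule DERIV_cong) simp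
qed

lemma chi_0: "2 \<le> s \<Longrightarrow> chi s = 0 \<and> chi' s = 0"
  by (simp add: chi_def chi'_def possq_def)

lemma possq_large: "s \<le> 1 \<Longrightarrow> max 0 (1 - possq (2 - s)) = 0"
proof -
  assume "s \<le> 1"
  then have "1 \<le> (2 - s)\<^sup>2" "possq (2 - s) = (2 - s)\<^sup>2" by (auto simp: possq_def max_def intro: one_le_power)
  then show ?thesis by linarith
qed

lemma chi_1: "s \<le> 1 \<Longrightarrow> chi s = 1"
proof -
  assume "s \<le> 1"
  then have "max 0 (1 - possq (2 - s)) = 0" by (rule possq_large)
  then show ?thesis by (simp add: chi_def possq_def[of "1 - _"])
qed

lemma chi_bound: "0 \<le> chi s" "chi s \<le> 1" "\<bar>chi' s\<bar> \<le> 4"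
proof -
  have nn: "0 \<le> possq s" for s by (simp add: possq_def)
  have "max 0 (1 - possq (2 - s)) \<le> 1" using nn[of "2 - s"] by simp
  then have "possq (1 - possq (2 - s)) \<le> 1\<^sup>2" unfolding possq_def[of "1 - _"] by (intro power_mono) auto
  then show "0 \<le> chi s" "chi s \<le> 1" using nn by (auto simp: chi_def)
  show "\<bar>chi' s\<bar> \<le> 4"
  proof (cases "1 \<le> s")
    case True
    have "(2 * max 0 (1 - possq (2 - s))) * (2 * max 0 (2 - s)) \<le> (2 * 1) * (2 * 1)"
      using True nn[of "2 - s"] by (intro mult_mono) auto
    then show ?thesis by (simp add: chi'_def abs_mult)
  next
    case False
    then have "max 0 (1 - possq (2 - s)) = 0" by (intro possq_large) simp
    then show ?thesis by (simp add: chi'_def)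
  qed
qed

text \<open>\<open>sig_low\<close> makes the derivatives of kept increments summable,
  \<open>sig_up\<close> makes discarded increments negligible, and \<open>eps\<close> pays for the
  polynomial factors of the Jordan block. \<open>Q\<close> separates trajectories decaying faster
  than exp (- sig t) from slower ones; by \<open>Q'_rem\<close> the nonlinear part uses up at most
  half of the gain in \<open>Q'_ge\<close>.\<close>

locale eigen_flow = contracting_flow f f' X P p r c
  for f :: "'a::euclidean_space \<Rightarrow> 'a" and f' X P p r c +
  fixes lam :: complex and m :: nat and u :: "'a \<Rightarrow> complex" and Q Q' and sig eps :: real
  assumes u_linear: "linear u"
    and u_nil: "(nshift (f' 0) lam ^^ m) u = (\<lambda>_. 0)"
    and eps_pos: "0 < eps" and sig_pos: "0 < sig"
    and sig_low: "- Re lam + eps < sig + r" and sig_up: "sig < - Re lam - eps"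
    and quad: "quad Q Q'" and Q'_ge: "(norm x)\<^sup>2 \<le> Q' x (f' 0 x + sig *\<^sub>R x)"
    and Q'_rem: "V x < 4 * c \<Longrightarrow> \<bar>Q' x (f x - f' 0 x)\<bar> \<le> 1 / 2 * (norm x)\<^sup>2"
begin

text \<open>Jordan chain generated by \<open>u\<close>: along the linear field each member is driven
  by the next.\<close>

definition a :: "nat \<Rightarrow> 'a \<Rightarrow> complex" where "a j = (nshift (f' 0) lam ^^ j) u"

lemma a_linear: "linear (a j)" unfolding a_def by (intro linear_nshift_pow linear_f'0 u_linear)

lemma a_bounded_linear: "bounded_linear (a j)" using a_linear by (simp add: linear_conv_bounded_linear)

lemma a_nil: "m \<le> j \<Longrightarrow> a j x = 0"
  using nshift_pow_mono[OF u_nil] unfolding a_def by metis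

lemma a_f'0: "a j (f' 0 x) = lam * a j x + a (Suc j) x"
  by (simp add: a_def nshift_def)

lemma a_bound: obtains A where "0 < A" "\<And>j x. norm (a j x) \<le> A * norm x"
proof -
  have "\<exists>B>0. \<forall>x. norm (a j x) \<le> B * norm x" for j
    using bounded_linear.pos_bounded[OF a_bounded_linear[of j]] by (auto simp: mult.commute)
  then obtain B where B: "\<And>j. 0 < B j" "\<And>j x. norm (a j x) \<le> B j * norm x" by metis
  show ?thesis
  proof (rule that[of "1 + (\<Sum>j<m. B j)"])
    show "0 < 1 + (\<Sum>j<m. B j)" by (intro add_pos_nonneg sum_nonneg less_imp_le[OF B(1)]) auto
    show "norm (a j x) \<le> (1 + (\<Sum>j<m. B j)) * norm x" for j x
    proof (cases "j < m")
      case True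
      have "B j \<le> (\<Sum>j<m. B j)" using True B(1) by (intro member_le_sum) (auto intro: less_imp_le)
      then have "B j * norm x \<le> (1 + (\<Sum>j<m. B j)) * norm x" by (intro mult_right_mono) auto
      then show ?thesis using B(2) order_trans by blast
    next
      case False
      have "0 \<le> (\<Sum>j<m. B j)" by (intro sum_nonneg less_imp_le[OF B(1)])
      then show ?thesis using a_nil[of j x] False by simp
    qed
  qed
qed

text \<open>On a solution of the linearization \<open>E j t s\<close> would not depend on \<open>s\<close>.\<close>

definition E :: "nat \<Rightarrow> real \<Rightarrow> real \<Rightarrow> 'a \<Rightarrow> complex" where
  "E j t s x = J lam m (t - s) (\<lambda>i. a (j + i) (X x s))"

text \<open>The derivative of the Jordan exponential cancels the linear part of the field, so only
  the nonlinear remainder is left.\<close>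

lemma E_deriv:
  assumes s: "s \<in> {s0..s1}" "0 \<le> s0"
  shows "((\<lambda>s. E j t s x) has_vector_derivative J lam m (t - s) (\<lambda>i. a (j + i) (f (X x s) - f' 0 (X x s))))
    (at s within {s0..s1})"
proof -
  have X: "(X x has_vector_derivative f (X x s)) (at s within {s0..s1})"
    by (rule has_vector_derivative_within_subset[OF X_der]) (use s in auto)
  have "((\<lambda>s. E j t s x) has_vector_derivative
      of_real (-1) * (lam * J lam m (t - s) (\<lambda>i. a (j + i) (X x s)) + J lam m (t - s) (\<lambda>i. a (j + Suc i) (X x s)))
      + J lam m (t - s) (\<lambda>i. a (j + i) (f (X x s)))) (at s within {s0..s1})"
    unfolding E_def
    by (rule J_has_vector_derivative)
       (auto intro!: derivative_eq_intros bounded_linear.has_vector_derivative[OF a_bounded_linear X] simp: a_nil)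
  moreover have EQ: "lam * J lam m (t - s) (\<lambda>i. a (j + i) (X x s)) + J lam m (t - s) (\<lambda>i. a (j + Suc i) (X x s))
      = J lam m (t - s) (\<lambda>i. a (j + i) (f' 0 (X x s)))"
    by (simp add: a_f'0 J_add J_cmult)
  ultimately show ?thesis
    unfolding EQ by (simp add: linear_diff[OF a_linear] J_diff)
qed

text \<open>Basic estimate for one time step: the remainder is quadratic, and the norms and the
  distance of the two trajectories grow at most by the factor \<open>kap\<close> within the step. It
  compares two initial points because the derivative of an increment is wanted; y = 0 gives its
  size.\<close>

lemma E_lip:
  obtains C where "0 < C" "\<And>j t s0 s1 x y. V x < 4 * c \<Longrightarrow> V y < 4 * c \<Longrightarrow> 0 \<le> s0 \<Longrightarrow> s0 \<le> s1 \<Longrightarrow> s1 \<le> s0 + 1 \<Longrightarrow>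
    norm ((E j t s1 x - E j t s0 x) - (E j t s1 y - E j t s0 y))
      \<le> C * exp (Re lam * (t - s0) + eps * \<bar>t - s0\<bar>) * (norm (X x s0) + norm (X y s0)) * norm (X x s0 - X y s0)"
proof -
  obtain C1 where C1: "0 < C1" "\<And>t a A. (\<And>j. norm (a j) \<le> A) \<Longrightarrow>
      norm (J lam m t a) \<le> C1 * exp (Re lam * t + eps * \<bar>t\<bar>) * A" using J_bound[OF eps_pos] by metis
  obtain A where A: "0 < A" "\<And>j x. norm (a j x) \<le> A * norm x" using a_bound by metis
  obtain Cg where Cg: "0 < Cg" "\<And>x y. V x < 4 * c \<Longrightarrow> V y < 4 * c \<Longrightarrow>
    norm ((f x - f' 0 x) - (f y - f' 0 y)) \<le> Cg * (norm x + norm y) * norm (x - y)" proof -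
    have "0 \<le> R0" using c_pos p_pos by (simp add: R0_def)
    from remainder_lip_ball[OF this] show ?thesis using that in_cball less_imp_le by metis
  qed
  \<comment> \<open>Covers the change of the exponential weight over a step of length at most
    1.\<close>
  define C2 where "C2 = exp (\<bar>Re lam\<bar> + eps)"
  show ?thesis
  proof (rule that[of "C1 * C2 * (A * (Cg * kap * kap))"])
    show "0 < C1 * C2 * (A * (Cg * kap * kap))" using C1 A Cg kap_pos by (simp add: C2_def)
    fix j t s0 s1 x y
    assume x: "V x < 4 * c" and y: "V y < 4 * c" and s: "0 \<le> s0" "s0 \<le> s1" "s1 \<le> s0 + (1::real)"
    let ?b = "\<lambda>s. exp (Re lam * (t - s) + eps * \<bar>t - s\<bar>)"
    let ?g = "\<lambda>x. f x - f' 0 x"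
    let ?N = "(norm (X x s0) + norm (X y s0)) * norm (X x s0 - X y s0)"
    let ?B = "C1 * (C2 * ?b s0) * (A * (Cg * kap * kap * ?N))"
    have "norm ((E j t s1 x - E j t s1 y) - (E j t s0 x - E j t s0 y)) \<le> ?B * (s1 - s0)"
    proof (rule mean_value_norm[OF s(2)])
      fix s assume s': "s \<in> {s0..s1}"
      show "((\<lambda>s. E j t s x - E j t s y) has_vector_derivative
          J lam m (t - s) (\<lambda>i. a (j + i) (?g (X x s)) - a (j + i) (?g (X y s)))) (at s within {s0..s1})"
        unfolding J_diff by (intro has_vector_derivative_diff E_deriv s s')
      have shift: "X z s = X (X z s0) (s - s0)" for z using s s' by (simp add: X_add)
      have e: "kap * exp (- r * (s - s0)) \<le> kap" using r_pos s' kap_pos by simp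
      have Vs: "V (X x s) < 4 * c" "V (X y s) < 4 * c" "V (X x s0) < 4 * c" "V (X y s0) < 4 * c"
        using X_in_region x y s s' by auto
      have nz: "norm (X z s) \<le> kap * norm (X z s0)" if "V z < 4 * c" for z
      proof -
        have "norm (X z s) \<le> kap * exp (- r * (s - s0)) * norm (X z s0)"
          unfolding shift[of z] using X_in_region[OF that s(1)] s' by (intro norm_decay) auto
        also have "\<dots> \<le> kap * norm (X z s0)" by (intro mult_right_mono e) auto
        finally show ?thesis .
      qed
      have "norm (X x s - X y s) \<le> kap * exp (- r * (s - s0)) * norm (X x s0 - X y s0)"
        unfolding shift[of x] shift[of y] using Vs s' by (intro dist_decay) auto
      also have "\<dots> \<le> kap * norm (X x s0 - X y s0)" by (intro mult_right_mono e) auto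
      finally have d: "norm (X x s - X y s) \<le> kap * norm (X x s0 - X y s0)" .
      have "norm (?g (X x s) - ?g (X y s)) \<le> Cg * (norm (X x s) + norm (X y s)) * norm (X x s - X y s)"
        by (rule Cg(2)[OF Vs(1,2)])
      also have "\<dots> \<le> Cg * (kap * norm (X x s0) + kap * norm (X y s0)) * (kap * norm (X x s0 - X y s0))"
        using Cg(1) kap_pos by (intro mult_mono mult_left_mono add_mono nz x y d) auto
      also have "\<dots> = Cg * kap * kap * ?N" by (simp add: algebra_simps)
      finally have g: "norm (?g (X x s) - ?g (X y s)) \<le> Cg * kap * kap * ?N" .
      have "norm (a (j + i) (?g (X x s)) - a (j + i) (?g (X y s))) \<le> A * (Cg * kap * kap * ?N)" for i
        unfolding linear_diff[OF a_linear, symmetric]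
        by (rule order_trans[OF A(2) mult_left_mono[OF g]]) (use A in auto)
      from C1(2)[OF this] have "norm (J lam m (t - s) (\<lambda>i. a (j + i) (?g (X x s)) - a (j + i) (?g (X y s))))
          \<le> C1 * ?b s * (A * (Cg * kap * kap * ?N))" .
      also have "\<dots> \<le> ?B"
      proof -
        have "Re lam * (t - s) = Re lam * (t - s0) + Re lam * (s0 - s)" by (simp add: algebra_simps)
        also have "Re lam * (s0 - s) \<le> \<bar>Re lam\<bar> * 1"
        proof -
          have "Re lam * (s0 - s) \<le> \<bar>Re lam * (s0 - s)\<bar>" by (rule abs_ge_self)
          also have "\<dots> \<le> \<bar>Re lam\<bar> * 1" unfolding abs_mult using s s' by (intro mult_left_mono) auto
          finally show ?thesis .
        qed
        finally have "Re lam * (t - s) \<le> Re lam * (t - s0) + \<bar>Re lam\<bar>" by simp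
        moreover have "eps * \<bar>t - s\<bar> \<le> eps * (\<bar>t - s0\<bar> + 1)" using eps_pos s s' by (intro mult_left_mono) auto
        ultimately have "?b s \<le> exp ((\<bar>Re lam\<bar> + eps) + (Re lam * (t - s0) + eps * \<bar>t - s0\<bar>))"
          by (simp add: algebra_simps)
        also have "\<dots> = C2 * ?b s0" by (simp add: C2_def exp_add)
        finally show ?thesis using C1 A Cg kap_pos by (intro mult_right_mono mult_left_mono) auto
      qed
      finally show "norm (J lam m (t - s) (\<lambda>i. a (j + i) (?g (X x s)) - a (j + i) (?g (X y s)))) \<le> ?B" .
    qed
    also have "\<dots> \<le> ?B * 1" using s C1 A Cg kap_pos by (intro mult_left_mono) (auto simp: C2_def)
    finally show "norm ((E j t s1 x - E j t s0 x) - (E j t s1 y - E j t s0 y))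
      \<le> C1 * C2 * (A * (Cg * kap * kap)) * ?b s0 * (norm (X x s0) + norm (X y s0)) * norm (X x s0 - X y s0)"
      by (simp add: algebra_simps)
  qed
qed

lemma E_zero: "0 \<le> s \<Longrightarrow> E j t s 0 = 0"
  by (simp add: E_def linear_0[OF a_linear] J_def)

text \<open>The function G(s) = exp (2 sig s) Q(X x s) is nondecreasing, and over the unit interval
  before s it gains at least \<open>mu\<close>, a multiple of exp (2 sig s) |X x s|^2. So G is at
  least mu / 2 at s or at most - mu / 2 at s - 1. In the first case it stays so and keeps the
  trajectory slow for ever. In the second it was so at time 0, where G is bounded; this bounds
  \<open>mu\<close> and gives the fast alternative.\<close>

lemma dichotomy:
  obtains C k where "0 < C" "0 < k"
    "\<And>x s. V x = c \<Longrightarrow> 0 \<le> s \<Longrightarrow> (norm (X x s))\<^sup>2 \<le> C * exp (- 2 * sig * s) \<or>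
      (\<forall>t\<ge>s. k * exp (- sig * (t - s)) * norm (X x s) \<le> norm (X x t))"
proof -
  obtain K0 where K0: "\<And>x h. \<bar>Q' x h\<bar> \<le> K0 * norm x * norm h" using quad unfolding quad_def by metis
  define K where "K = \<bar>K0\<bar> + 1"
  have Qle: "\<bar>Q x\<bar> \<le> K * (norm x)\<^sup>2" for x
  proof -
    have "\<bar>2 * Q x\<bar> \<le> K0 * (norm x)\<^sup>2" using K0[of x x] quad by (simp add: quad_def power2_eq_square mult.assoc)
    also have "\<dots> \<le> K * (norm x)\<^sup>2" unfolding K_def by (intro mult_right_mono) auto
    finally show ?thesis by simp
  qed
  have K: "0 < K" by (simp add: K_def)
  \<comment> \<open>The losses over the unit interval: exp (- 2 sig) from the weight,
    \<open>kap\<close> squared from comparing X x s with earlier points, and 1 / 2 from the gain of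
    G.\<close>
  define k2 where "k2 = exp (- 2 * sig) / (2 * kap\<^sup>2)"
  have k2: "0 < k2" using kap_pos by (simp add: k2_def)
  \<comment> \<open>The first summand serves s < 1, where no full unit interval precedes s; the
    second serves the case of a negative G at s - 1.\<close>
  define C where "C = kap\<^sup>2 * (c / p) * exp (2 * sig) + 2 * K * (c / p) / k2"
  have C: "kap\<^sup>2 * (c / p) * exp (2 * sig) \<le> C" "2 * K * (c / p) / k2 \<le> C" "0 < C"
    using kap_pos c_pos p_pos K k2 by (auto simp: C_def intro!: add_pos_pos)
  define k where "k = sqrt (k2 / (2 * K))"
  have k: "0 < k" using k2 K by (simp add: k_def)
  show ?thesis
  proof (rule that[OF C(3) k])
    fix x s assume x: "V x = c" and s: "(0::real) \<le> s"
    have x4: "V x < 4 * c" using x c_pos by simp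
    have nx: "(norm x)\<^sup>2 \<le> c / p" using V_ge[of x] x p_pos by (simp add: field_simps)
    define G where "G s = exp (2 * sig * s) * Q (X x s)" for s
    have Gder: "(G has_real_derivative exp (2 * sig * s) * (2 * sig * Q (X x s) + Q' (X x s) (f (X x s))))
        (at s within {s0..s1})" if "s \<in> {s0..s1}" "0 \<le> s0" for s s0 s1
    proof -
      have X: "(X x has_vector_derivative f (X x s)) (at s within {s0..s1})"
        by (rule has_vector_derivative_within_subset[OF X_der]) (use that in auto)
      have "((\<lambda>s. Q (X x s)) has_derivative (\<lambda>h. Q' (X x s) (h *\<^sub>R f (X x s)))) (at s within {s0..s1})"
        using X quad unfolding has_vector_derivative_def quad_def
        by (intro has_derivative_compose[of "X x" "\<lambda>h. h *\<^sub>R f (X x s)" s _ Q]) auto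
      moreover have "Q' (X x s) (h *\<^sub>R f (X x s)) = Q' (X x s) (f (X x s)) * h" for h
        using quad has_derivative_linear unfolding quad_def by (metis linear_scale real_scaleR_def mult.commute)
      ultimately have "((\<lambda>s. Q (X x s)) has_real_derivative Q' (X x s) (f (X x s))) (at s within {s0..s1})"
        by (simp add: has_field_derivative_def)
      then show ?thesis unfolding G_def[abs_def] by (auto intro!: derivative_eq_intros simp: algebra_simps)
    qed
    have G': "exp (2 * sig * s) * ((norm (X x s))\<^sup>2 / 2)
        \<le> exp (2 * sig * s) * (2 * sig * Q (X x s) + Q' (X x s) (f (X x s)))" if "0 \<le> s" for s
    proof (rule mult_left_mono)
      let ?z = "X x s"
      have lin: "linear (Q' ?z)" using quad has_derivative_linear unfolding quad_def by metis
      have "f ?z = (f' 0 ?z + sig *\<^sub>R ?z) + (f ?z - f' 0 ?z) - sig *\<^sub>R ?z" by simp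
      then have "Q' ?z (f ?z) = Q' ?z ((f' 0 ?z + sig *\<^sub>R ?z) + (f ?z - f' 0 ?z) - sig *\<^sub>R ?z)" by simp
      also have "\<dots> = Q' ?z (f' 0 ?z + sig *\<^sub>R ?z) + Q' ?z (f ?z - f' 0 ?z) - sig * Q' ?z ?z"
        unfolding linear_diff[OF lin, of "_ + _"] linear_add[OF lin, of "_ + _"] linear_scale[OF lin, of sig ?z] by simp
      finally have "Q' ?z (f ?z) = Q' ?z (f' 0 ?z + sig *\<^sub>R ?z) + Q' ?z (f ?z - f' 0 ?z) - sig * Q' ?z ?z" .
      moreover have "Q' ?z ?z = 2 * Q ?z" using quad by (simp add: quad_def)
      ultimately have "Q' ?z (f ?z) + 2 * sig * Q ?z = Q' ?z (f' 0 ?z + sig *\<^sub>R ?z) + Q' ?z (f ?z - f' 0 ?z)" by simp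
      then show "(norm ?z)\<^sup>2 / 2 \<le> 2 * sig * Q ?z + Q' ?z (f ?z)"
        using Q'_ge[of ?z] Q'_rem[OF X_in_region[OF x4 that]] by (simp add: abs_le_iff)
    qed simp
    have Gmono: "G s0 \<le> G s1" if "0 \<le> s0" "s0 \<le> s1" for s0 s1
    proof -
      have "0 \<le> exp (2 * sig * s) * (2 * sig * Q (X x s) + Q' (X x s) (f (X x s)))" if "0 \<le> s" for s
        by (rule order_trans[OF _ G'[OF that]]) simp
      then have "exp (0 * (s1 - s0)) * G s0 \<le> G s1"
        using that by (intro growth_ge[OF _ Gder]) auto
      then show ?thesis by simp
    qed
    have Q0: "\<bar>G 0\<bar> \<le> K * (c / p)" using order_trans[OF Qle[of x] mult_left_mono[OF nx]] K by (simp add: G_def)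
    show "(norm (X x s))\<^sup>2 \<le> C * exp (- 2 * sig * s) \<or>
      (\<forall>t\<ge>s. k * exp (- sig * (t - s)) * norm (X x s) \<le> norm (X x t))"
    proof (cases "s < 1")
      case True
      have "norm (X x s) \<le> kap * exp (- r * s) * norm x" by (rule norm_decay[OF x4 s])
      also have "\<dots> \<le> kap * 1 * norm x" using r_pos s kap_pos by (intro mult_right_mono mult_left_mono) auto
      finally have "(norm (X x s))\<^sup>2 \<le> (kap * norm x)\<^sup>2" by (intro power_mono) auto
      also have "\<dots> \<le> kap\<^sup>2 * (c / p)" unfolding power_mult_distrib using nx by (intro mult_left_mono) auto
      also have "\<dots> \<le> kap\<^sup>2 * (c / p) * exp (2 * sig * (1 - s))"
      proof -
        have "kap\<^sup>2 * (c / p) * 1 \<le> kap\<^sup>2 * (c / p) * exp (2 * sig * (1 - s))"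
          using True sig_pos c_pos p_pos by (intro mult_left_mono) auto
        then show ?thesis by simp
      qed
      also have "\<dots> = kap\<^sup>2 * (c / p) * exp (2 * sig) * exp (- 2 * sig * s)"
        by (simp add: algebra_simps flip: exp_add)
      also have "\<dots> \<le> C * exp (- 2 * sig * s)" using C by (intro mult_right_mono) auto
      finally show ?thesis by blast
    next
      case False
      then have s1: "0 \<le> s - 1" by simp
      define mu where "mu = k2 * exp (2 * sig * s) * (norm (X x s))\<^sup>2"
      have "(\<lambda>t. mu * t - G t) s \<le> (\<lambda>t. mu * t - G t) (s - 1)"
      proof (rule nonincreasing_within[where h = "\<lambda>t. mu * t - G t" and a = "s - 1" and b = s and h' = "\<lambda>t. mu - exp (2 * sig * t) * (2 * sig * Q (X x t) + Q' (X x t) (f (X x t)))"])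
        fix t assume t: "s - 1 < t" "t < s"
        have "norm (X (X x t) (s - t)) \<le> kap * exp (- r * (s - t)) * norm (X x t)"
          using t s1 by (intro norm_decay X_in_region x4) auto
        also have "\<dots> \<le> kap * 1 * norm (X x t)" using r_pos t kap_pos by (intro mult_right_mono mult_left_mono) auto
        finally have "norm (X x s) \<le> kap * norm (X x t)" using t s1 by (simp add: X_add)
        then have "(norm (X x s))\<^sup>2 \<le> kap\<^sup>2 * (norm (X x t))\<^sup>2"
          using power_mono[of _ _ 2] by (metis norm_ge_zero power_mult_distrib)
        then have "(norm (X x s))\<^sup>2 / kap\<^sup>2 \<le> (norm (X x t))\<^sup>2" using kap_pos by (simp add: field_simps)
        moreover have "exp (- 2 * sig) * exp (2 * sig * s) \<le> exp (2 * sig * t)"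
        proof -
          have "sig * s \<le> sig * (t + 1)" using t sig_pos by (intro mult_left_mono) auto
          then show ?thesis by (simp add: algebra_simps flip: exp_add)
        qed
        ultimately have "(exp (- 2 * sig) * exp (2 * sig * s)) * ((norm (X x s))\<^sup>2 / kap\<^sup>2)
            \<le> exp (2 * sig * t) * (norm (X x t))\<^sup>2" by (intro mult_mono) auto
        then have "mu \<le> exp (2 * sig * t) * ((norm (X x t))\<^sup>2 / 2)" by (simp add: mu_def k2_def)
        then show "mu - exp (2 * sig * t) * (2 * sig * Q (X x t) + Q' (X x t) (f (X x t))) \<le> 0"
          using G'[of t] t s1 by linarith
      qed (use s1 in \<open>auto intro!: derivative_eq_intros Gder\<close>)
      then have step: "mu \<le> G s - G (s - 1)" by (simp add: algebra_simps)
      show ?thesis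
      proof (cases "mu / 2 \<le> G s")
        case True
        have "k * exp (- sig * (t - s)) * norm (X x s) \<le> norm (X x t)" if t: "s \<le> t" for t
        proof -
          have "mu / 2 \<le> G t" using True Gmono[OF s t] by linarith
          also have "\<dots> \<le> exp (2 * sig * t) * (K * (norm (X x t))\<^sup>2)"
            unfolding G_def using Qle[of "X x t"] by (intro mult_left_mono) auto
          finally have 1: "exp (- 2 * sig * t) * (mu / 2) \<le> exp (- 2 * sig * t) * (exp (2 * sig * t) * (K * (norm (X x t))\<^sup>2))"
            by (rule mult_left_mono) simp
          have 2: "exp (- 2 * sig * t) * (exp (2 * sig * t) * z) = z" for z
            by (simp add: mult.assoc[symmetric] flip: exp_add)
          have e2: "exp (- 2 * sig * t) * exp (2 * sig * s) = (exp (- sig * (t - s)))\<^sup>2"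
            by (simp add: algebra_simps flip: exp_add exp_double)
          have 3: "exp (- 2 * sig * t) * mu = k2 * ((exp (- sig * (t - s)))\<^sup>2 * (norm (X x s))\<^sup>2)"
            unfolding mu_def e2[symmetric] by (simp add: mult_ac)
          from 1 have "k2 * ((exp (- sig * (t - s)))\<^sup>2 * (norm (X x s))\<^sup>2) \<le> 2 * K * (norm (X x t))\<^sup>2"
            unfolding 2 3[symmetric] by simp
          then have "k2 / (2 * K) * ((exp (- sig * (t - s)))\<^sup>2 * (norm (X x s))\<^sup>2) \<le> (norm (X x t))\<^sup>2"
            using K by (simp add: field_simps)
          then have "(k * exp (- sig * (t - s)) * norm (X x s))\<^sup>2 \<le> (norm (X x t))\<^sup>2"
            using k2 K by (simp add: k_def power_mult_distrib mult.assoc)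
          then show ?thesis by (rule power2_le_imp_le) simp
        qed
        then show ?thesis by blast
      next
        case False
        then have "mu / 2 \<le> - G (s - 1)" using step by linarith
        also have "\<dots> \<le> - G 0" using Gmono[of 0 "s - 1"] s1 by simp
        also have "\<dots> \<le> K * (c / p)" using Q0 by linarith
        finally have "mu \<le> 2 * K * (c / p)" by linarith
        then have "exp (2 * sig * s) * (norm (X x s))\<^sup>2 \<le> 2 * K * (c / p) / k2"
          unfolding pos_le_divide_eq[OF k2] by (simp add: mu_def mult_ac)
        also have "\<dots> \<le> C" by (rule C)
        finally have F: "exp (- 2 * sig * s) * (exp (2 * sig * s) * (norm (X x s))\<^sup>2) \<le> exp (- 2 * sig * s) * C"
          by (intro mult_left_mono) auto
        have e: "exp (- 2 * sig * s) * (exp (2 * sig * s) * (norm (X x s))\<^sup>2) = (norm (X x s))\<^sup>2"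
          by (simp add: mult.assoc[symmetric] flip: exp_add)
        from F[unfolded e] show ?thesis by (simp only: mult.commute[of C] simp_thms)
      qed
    qed
  qed
qed

end

context contracting_flow begin

text \<open>Lets the evolution law be read off from an explicit formula along the trajectory; the
  one-sided derivative at time 0 suffices.\<close>

lemma derivative_along_flow:
  assumes g: "(g has_derivative D) (at x)" and h: "\<And>t. 0 \<le> t \<Longrightarrow> g (X x t) = h t"
    and h': "(h has_vector_derivative d) (at 0 within {0..1})"
  shows "D (f x) = d"
proof -
  have X: "(X x has_vector_derivative f x) (at 0 within {0..1})"
    using has_vector_derivative_within_subset[OF X_der[of 0 x]] by auto
  have "((\<lambda>t. g (X x t)) has_derivative (\<lambda>s. D (s *\<^sub>R f x))) (at 0 within {0..1})"
    using has_derivative_compose[of "X x" _ 0 "{0..1}" g D] X g by (simp add: has_vector_derivative_def)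
  moreover have "D (s *\<^sub>R f x) = s *\<^sub>R D (f x)" for s using has_derivative_linear[OF g] by (rule linear_scale)
  ultimately have "((\<lambda>t. g (X x t)) has_vector_derivative D (f x)) (at 0 within {0..1})"
    by (simp add: has_vector_derivative_def)
  then have "(h has_vector_derivative D (f x)) (at 0 within {0..1})"
    by (rule has_vector_derivative_transform[rotated 2]) (auto simp: h)
  then show ?thesis
    using vector_derivative_unique_within_closed_interval[of 0 1 0 h] h' by (simp add: cbox_interval)
qed

end

section \<open>The series of cut increments and its extension along the flow\<close>

context eigen_flow begin

text \<open>Without the factor \<open>chi\<close> the increments telescope to the naive candidate
  for the limit. The reference time 0 makes the exponential run backward by n; the increment is kept
  where X x n is of order exp (- sig n), and b sets the threshold.\<close>

definition cut_incr :: "real \<Rightarrow> nat \<Rightarrow> nat \<Rightarrow> 'a \<Rightarrow> complex" where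
  "cut_incr b j n x = chi (b * exp (2 * sig * n) * V (X x n)) *\<^sub>R (E j 0 (n + 1) x - E j 0 n x)"

text \<open>Decay rate of the cut increments: exp (- sig n) from the trajectory and exp (- r n) from
  its derivative, against the growth exp (- Re lam n + eps n) of the backward exponential.\<close>

definition "kp = sig + r + Re lam - eps"

lemma kp_pos: "0 < kp" using sig_low by (simp add: kp_def)

lemma cutoff_norm:
  assumes "b * exp (2 * sig * n) * V (X x n) < 2" "0 < b"
  shows "norm (X x n) \<le> sqrt (2 / (b * p)) * exp (- sig * n)"
proof (rule power2_le_imp_le)
  have "b * exp (2 * sig * n) * (p * (norm (X x n))\<^sup>2) \<le> b * exp (2 * sig * n) * V (X x n)"
    using assms(2) V_ge by (intro mult_left_mono) auto
  then have "b * p * (exp (2 * sig * n) * (norm (X x n))\<^sup>2) < 2" using assms(1) by (simp add: mult_ac)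
  then have 1: "exp (2 * sig * n) * (norm (X x n))\<^sup>2 \<le> 2 / (b * p)"
    using assms(2) p_pos by (simp add: field_simps)
  have "(norm (X x n))\<^sup>2 = exp (- 2 * sig * n) * (exp (2 * sig * n) * (norm (X x n))\<^sup>2)"
    by (simp add: mult.assoc[symmetric] flip: exp_add)
  also have "\<dots> \<le> exp (- 2 * sig * n) * (2 / (b * p))" using 1 by (intro mult_left_mono) auto
  also have "\<dots> = (sqrt (2 / (b * p)) * exp (- sig * n))\<^sup>2"
    using assms(2) p_pos by (simp add: power_mult_distrib flip: exp_double)
  finally show "(norm (X x n))\<^sup>2 \<le> (sqrt (2 / (b * p)) * exp (- sig * n))\<^sup>2" .
  show "0 \<le> sqrt (2 / (b * p)) * exp (- sig * n)" using assms(2) p_pos by simp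
qed

lemma exp_rates: "exp (Re lam * (0 - n) + eps * \<bar>0 - n\<bar>) * exp (- r * n) * exp (- sig * n) = exp (- kp * n)" if "0 \<le> n"
  using that by (simp add: kp_def algebra_simps flip: exp_add)

lemma E_differentiable: "0 \<le> s \<Longrightarrow> E j t s differentiable at x"
proof -
  assume s: "0 \<le> s"
  obtain D where D: "((\<lambda>y. X y s) has_derivative D) (at x)" using X_diff[OF s] by blast
  have "(\<lambda>y. a (j + i) (X y s)) differentiable at x" for i
    using bounded_linear.has_derivative[OF a_bounded_linear D] by (rule differentiableI)
  then show ?thesis unfolding E_def[abs_def] J_def
    by (intro differentiable_mult differentiable_const differentiable_sum) auto
qed

text \<open>Both terms of the product rule decay at rate \<open>kp\<close>. The derivative of the
  step is of order |X| |DX|, up to the backward exponential. The derivative of the cutoff costs exp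
  (2 sig n) |X| |DX|, but the step itself is of order |X|^2, and |X| is of order exp (- sig n)
  wherever the cutoff is nonzero, so the weight cancels.\<close>

lemma cut_incr_deriv:
  assumes b: "0 < b"
  obtains K where "0 < K" "\<And>x n j. V x < 4 * c \<Longrightarrow>
    \<exists>D. (cut_incr b j n has_derivative D) (at x) \<and> (\<forall>h. norm (D h) \<le> K * exp (- kp * n) * norm h)"
proof -
  obtain C where C: "0 < C" "\<And>j t s0 s1 x y. V x < 4 * c \<Longrightarrow> V y < 4 * c \<Longrightarrow> 0 \<le> s0 \<Longrightarrow> s0 \<le> s1 \<Longrightarrow> s1 \<le> s0 + 1 \<Longrightarrow>
    norm ((E j t s1 x - E j t s0 x) - (E j t s1 y - E j t s0 y))
      \<le> C * exp (Re lam * (t - s0) + eps * \<bar>t - s0\<bar>) * (norm (X x s0) + norm (X y s0)) * norm (X x s0 - X y s0)"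
    using E_lip by metis
  define C3 where "C3 = sqrt (2 / (b * p))"
  have C3: "0 < C3" using b p_pos by (simp add: C3_def)
  define K1 where "K1 = 4 * (2 * b * q * kap * C3) * (C * C3\<^sup>2)"
  define K2 where "K2 = C * (2 * C3 + kap) * kap"
  have K: "0 < K1" "0 < K2" using b q_pos kap_pos C3 C(1) by (auto simp: K1_def K2_def)
  have main: "\<exists>D. (cut_incr b j n has_derivative D) (at x) \<and> (\<forall>h. norm (D h) \<le> (K1 + K2) * exp (- kp * n) * norm h)"
    if x: "V x < 4 * c" for x n j
  proof -
    define w where "w y = b * exp (2 * sig * n) * V (X y n)" for y
    define d where "d y = E j 0 (n + 1) y - E j 0 n y" for y
    define be where "be = exp (Re lam * (0 - real n) + eps * \<bar>0 - real n\<bar>)"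
    have be: "0 < be" by (simp add: be_def)
    have T: "cut_incr b j n = (\<lambda>y. chi (w y) *\<^sub>R d y)" by (simp add: fun_eq_iff cut_incr_def w_def d_def)
    obtain DX where DX: "((\<lambda>y. X y n) has_derivative DX) (at x)" using X_diff[of "real n" x] by auto
    have "d differentiable at x" unfolding d_def[abs_def] by (intro differentiable_diff E_differentiable) auto
    then obtain Dd where Dd: "(d has_derivative Dd) (at x)" by (auto simp: differentiable_def)
    define Dw where "Dw h = b * exp (2 * sig * n) * (2 * (X x n \<bullet> P (DX h)))" for h
    have "((\<lambda>y. V (X y n)) has_derivative (\<lambda>h. X x n \<bullet> P (DX h) + DX h \<bullet> P (X x n))) (at x)"
      unfolding V_def[abs_def]
      by (rule has_derivative_inner[OF DX bounded_linear.has_derivative[OF blinfun.bounded_linear_right DX]])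
    then have "(w has_derivative Dw) (at x)" unfolding w_def[abs_def] Dw_def[abs_def]
      by (intro has_derivative_mult_right) (simp add: P_sym[of _ "X x n"])
    then have "((\<lambda>y. chi (w y)) has_derivative (\<lambda>h. chi' (w x) * Dw h)) (at x)"
      by (rule has_derivative_compose) (use chi_deriv in \<open>simp add: has_field_derivative_def\<close>)
    from has_derivative_scaleR[OF this Dd]
    have der: "(cut_incr b j n has_derivative (\<lambda>h. chi (w x) *\<^sub>R Dd h + (chi' (w x) * Dw h) *\<^sub>R d x)) (at x)"
      unfolding T .
    have "open {y. V y < 4 * c}" using open_Collect_less[OF V_cont continuous_on_const] by simp
    then obtain d0 where d0: "0 < d0" "\<And>y. dist y x < d0 \<Longrightarrow> V y < 4 * c"
      using x unfolding open_dist by (metis mem_Collect_eq)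
    have DXb: "norm (DX h) \<le> kap * exp (- r * n) * norm h" for h
      by (rule lipschitz_imp_derivative_bound[OF DX d0(1)]) (use d0 x dist_decay[of _ x "real n"] in \<open>auto simp: dist_norm\<close>)
    have d_lip: "norm (d y - d x) \<le> C * be * (norm (X y n) + norm (X x n)) * norm (X y n - X x n)"
      if "V y < 4 * c" for y
      using C(2)[of y x "real n" "real n + 1" j 0] that x unfolding d_def be_def by (simp add: add.commute)
    have Ddb: "norm (Dd h) \<le> (C * be * (2 * norm (X x n) + kap * exp (- sig * n)) * (kap * exp (- r * n))) * norm h" for h
    proof (rule lipschitz_imp_derivative_bound[OF Dd])
      \<comment> \<open>The radius may shrink with n, since only the derivative at x is bounded; it
        keeps X y n within \<open>kap * exp (- sig * n)\<close> of X x n.\<close>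
      show "0 < min d0 (exp (- sig * n))" using d0 by simp
      fix y assume y: "norm (y - x) < min d0 (exp (- sig * n))"
      then have Vy: "V y < 4 * c" using d0 by (simp add: dist_norm)
      have Xd: "norm (X y n - X x n) \<le> kap * exp (- r * n) * norm (y - x)" using Vy x by (intro dist_decay) auto
      also have "\<dots> \<le> kap * 1 * exp (- sig * n)" using kap_pos r_pos y by (intro mult_mono) auto
      finally have "norm (X y n) + norm (X x n) \<le> 2 * norm (X x n) + kap * exp (- sig * n)"
        using norm_triangle_sub[of "X y n" "X x n"] by simp
      then have "norm (d y - d x) \<le> C * be * (2 * norm (X x n) + kap * exp (- sig * n)) * (kap * exp (- r * n) * norm (y - x))"
        using C(1) be by (intro order_trans[OF d_lip[OF Vy]] mult_mono Xd mult_left_mono) (auto simp: kap_pos less_imp_le)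
      then show "norm (d y - d x) \<le> C * be * (2 * norm (X x n) + kap * exp (- sig * n)) * (kap * exp (- r * n)) * norm (y - x)"
        by (simp add: mult.assoc)
    qed
    have "norm (chi (w x) *\<^sub>R Dd h + (chi' (w x) * Dw h) *\<^sub>R d x) \<le> (K1 + K2) * exp (- kp * n) * norm h" for h
    proof (cases "w x < 2")
      case False
      then show ?thesis using chi_0[of "w x"] K by simp
    next
      case True
      then have Xn: "norm (X x n) \<le> C3 * exp (- sig * n)" unfolding w_def C3_def by (rule cutoff_norm[OF _ b])
      have rates: "be * exp (- r * n) * exp (- sig * n) = exp (- kp * n)"
        using exp_rates[of "real n"] by (simp add: be_def)
      have "norm (Dd h) \<le> (C * be * (2 * norm (X x n) + kap * exp (- sig * n)) * (kap * exp (- r * n))) * norm h" by (rule Ddb)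
      also have "\<dots> \<le> (C * be * (2 * (C3 * exp (- sig * n)) + kap * exp (- sig * n)) * (kap * exp (- r * n))) * norm h"
        using C(1) be kap_pos Xn by (intro mult_right_mono mult_left_mono add_mono) auto
      also have "\<dots> = K2 * (be * exp (- r * n) * exp (- sig * n)) * norm h" by (simp add: K2_def algebra_simps)
      finally have 1: "norm (Dd h) \<le> K2 * exp (- kp * n) * norm h" unfolding rates .
      have 2: "norm (chi (w x) *\<^sub>R Dd h) \<le> K2 * exp (- kp * n) * norm h"
        using mult_mono[OF chi_bound(2)[of "w x"] 1] chi_bound(1)[of "w x"] by simp
      have "\<bar>X x n \<bullet> P (DX h)\<bar> \<le> q * ((C3 * exp (- sig * n)) * (kap * exp (- r * n) * norm h))"
        using q_pos C3 by (intro order_trans[OF inner_P_le] mult_left_mono mult_mono Xn DXb) auto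
      then have "\<bar>Dw h\<bar> \<le> b * exp (2 * sig * n) * (2 * (q * ((C3 * exp (- sig * n)) * (kap * exp (- r * n) * norm h))))"
        using b unfolding Dw_def abs_mult by (intro mult_mono) auto
      also have "\<dots> = (2 * b * q * kap * C3) * (exp (2 * sig * n) * exp (- sig * n) * exp (- r * n)) * norm h" by simp
      finally have Dw: "\<bar>Dw h\<bar> \<le> (2 * b * q * kap * C3) * (exp (2 * sig * n) * exp (- sig * n) * exp (- r * n)) * norm h" .
      have "norm (d x) \<le> C * be * norm (X x n) * norm (X x n)"
        using C(2)[of x 0 "real n" "real n + 1" j 0] x c_pos unfolding d_def be_def by (simp add: E_zero add.commute)
      also have "\<dots> \<le> C * be * (C3 * exp (- sig * n)) * (C3 * exp (- sig * n))"
        using C(1) be C3 by (intro mult_mono Xn) auto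
      finally have dx: "norm (d x) \<le> C * be * (C3 * exp (- sig * n)) * (C3 * exp (- sig * n))" .
      have "norm ((chi' (w x) * Dw h) *\<^sub>R d x) = \<bar>chi' (w x)\<bar> * \<bar>Dw h\<bar> * norm (d x)" by (simp add: abs_mult)
      also have "\<dots> \<le> 4 * ((2 * b * q * kap * C3) * (exp (2 * sig * n) * exp (- sig * n) * exp (- r * n)) * norm h)
          * (C * be * (C3 * exp (- sig * n)) * (C3 * exp (- sig * n)))"
        using b q_pos kap_pos C3 by (intro mult_mono chi_bound(3) Dw dx) auto
      also have "\<dots> = K1 * ((exp (2 * sig * n) * exp (- sig * n) * exp (- sig * n)) * (be * exp (- r * n) * exp (- sig * n))) * norm h"
        by (simp add: K1_def power2_eq_square)
      also have "exp (2 * sig * n) * exp (- sig * n) * exp (- sig * n) = 1" by (simp flip: exp_add)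
      finally have 3: "norm ((chi' (w x) * Dw h) *\<^sub>R d x) \<le> K1 * exp (- kp * n) * norm h" unfolding rates by simp
      show ?thesis using norm_triangle_mono[OF 2 3] by (simp add: algebra_simps)
    qed
    then show ?thesis using der by blast
  qed
  show ?thesis using that[of "K1 + K2"] main K by simp
qed

text \<open>The increments vanish at 0 and the region contains the segment from 0 to x, so the
  derivative bound integrates to a bound on values.\<close>

lemma cut_incr_bound:
  assumes b: "0 < b"
  obtains K where "0 < K" "\<And>x n j. V x < 4 * c \<Longrightarrow> norm (cut_incr b j n x) \<le> K * exp (- kp * n)"
proof -
  obtain K where K: "0 < K" "\<And>x n j. V x < 4 * c \<Longrightarrow>
    \<exists>D. (cut_incr b j n has_derivative D) (at x) \<and> (\<forall>h. norm (D h) \<le> K * exp (- kp * n) * norm h)"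
    using cut_incr_deriv[OF b] by metis
  have "norm (cut_incr b j n x) \<le> K * R0 * exp (- kp * n)" if x: "V x < 4 * c" for x n j
  proof -
    have seg: "V y < 4 * c" if y: "y \<in> closed_segment 0 x" for y
    proof -
      obtain s where s: "0 \<le> s" "s \<le> 1" "y = s *\<^sub>R x" using y by (auto simp: in_segment)
      then have "V y = s * (s * V x)" by (simp add: V_def blinfun.scaleR_right)
      also have "\<dots> \<le> V x" using s V_nonneg[of x] by (meson mult_left_le_one_le mult_nonneg_nonneg order_trans)
      finally show ?thesis using x by simp
    qed
    define D where "D y = (SOME D. (cut_incr b j n has_derivative D) (at y) \<and> (\<forall>h. norm (D h) \<le> K * exp (- kp * n) * norm h))"
      for y
    have "(cut_incr b j n has_derivative D y) (at y) \<and> (\<forall>h. norm (D y h) \<le> K * exp (- kp * n) * norm h)"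
      if "V y < 4 * c" for y
      unfolding D_def by (rule someI_ex[OF K(2)[OF that]])
    then have D: "\<And>y. V y < 4 * c \<Longrightarrow> (cut_incr b j n has_derivative D y) (at y)"
      "\<And>y h. V y < 4 * c \<Longrightarrow> norm (D y h) \<le> K * exp (- kp * n) * norm h" by blast+
    have "norm (cut_incr b j n x - cut_incr b j n 0) \<le> K * exp (- kp * n) * norm (x - 0)"
      by (rule differentiable_bound[of "closed_segment 0 x" _ D])
         (use D seg in \<open>auto intro: has_derivative_at_withinI[OF D(1)] intro!: onorm_le\<close>)
    also have "\<dots> \<le> K * exp (- kp * n) * R0"
      using in_cball[of x] x K(1) by (intro mult_left_mono) auto
    finally show ?thesis by (simp add: cut_incr_def E_zero mult_ac)
  qed
  moreover have "0 < R0" using c_pos p_pos by (simp add: R0_def)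
  ultimately show ?thesis using that[of "K * R0"] K(1) by simp
qed

lemma summable_exp: "0 < k \<Longrightarrow> summable (\<lambda>n. exp (- k * real n))"
proof -
  assume "0 < k"
  have "exp (- k * real n) = exp (- k) ^ n" for n by (simp add: exp_of_nat_mult[symmetric] mult.commute)
  then show ?thesis using \<open>0 < k\<close> by (simp add: summable_geometric)
qed

lemma cut_incr_summable: "0 < b \<Longrightarrow> V x < 4 * c \<Longrightarrow> summable (\<lambda>n. cut_incr b j n x)"
proof -
  assume b: "0 < b" and x: "V x < 4 * c"
  obtain K where "\<And>x n j. V x < 4 * c \<Longrightarrow> norm (cut_incr b j n x) \<le> K * exp (- kp * n)" using cut_incr_bound[OF b] by metis
  then show ?thesis using x
    by (intro summable_comparison_test'[OF summable_mult[OF summable_exp[OF kp_pos]], of 0 _ K]) auto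
qed

definition corr :: "real \<Rightarrow> nat \<Rightarrow> 'a \<Rightarrow> complex" where "corr b j x = a j x + (\<Sum>n. cut_incr b j n x)"

text \<open>Term-by-term differentiation; the tails of the series of derivatives are uniformly small
  on a ball inside the region.\<close>

lemma corr_differentiable:
  assumes b: "0 < b" and x: "V x < 4 * c"
  shows "corr b j differentiable at x"
proof -
  obtain K where K: "0 < K" "\<And>x n j. V x < 4 * c \<Longrightarrow>
    \<exists>D. (cut_incr b j n has_derivative D) (at x) \<and> (\<forall>h. norm (D h) \<le> K * exp (- kp * n) * norm h)"
    using cut_incr_deriv[OF b] by metis
  define D where "D n y = (SOME D. (cut_incr b j n has_derivative D) (at y) \<and> (\<forall>h. norm (D h) \<le> K * exp (- kp * n) * norm h))"
    for n y
  have "(cut_incr b j n has_derivative D n y) (at y) \<and> (\<forall>h. norm (D n y h) \<le> K * exp (- kp * n) * norm h)"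
    if "V y < 4 * c" for n y
    unfolding D_def by (rule someI_ex[OF K(2)[OF that]])
  then have D: "\<And>n y. V y < 4 * c \<Longrightarrow> (cut_incr b j n has_derivative D n y) (at y)"
    "\<And>n y h. V y < 4 * c \<Longrightarrow> norm (D n y h) \<le> K * exp (- kp * n) * norm h" by blast+
  have "open {y. V y < 4 * c}" using open_Collect_less[OF V_cont continuous_on_const] by simp
  then obtain d0 where d0: "0 < d0" "ball x d0 \<subseteq> {y. V y < 4 * c}"
    by (rule openE[of _ x]) (use x in auto)
  have sum: "summable (\<lambda>n. K * exp (- kp * real n))" by (intro summable_mult summable_exp kp_pos)
  have sumD: "summable (\<lambda>n. D n z h)" if "V z < 4 * c" for z h
    by (rule summable_comparison_test'[OF summable_mult2[OF sum], of 0 _ "norm h"]) (use D(2)[OF that] in auto)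
  have "\<exists>g. \<forall>z\<in>ball x d0. (\<lambda>n. cut_incr b j n z) sums g z \<and> (g has_derivative (\<lambda>h. \<Sum>n. D n z h)) (at z within ball x d0)"
  proof (rule has_derivative_series[where f = "cut_incr b j" and f' = D and x = x and l = "\<Sum>n. cut_incr b j n x"])
    show "(cut_incr b j n has_derivative D n z) (at z within ball x d0)" if "z \<in> ball x d0" for n z
      by (rule has_derivative_at_withinI[OF D(1)]) (use d0(2) that in blast)
    show "\<forall>\<^sub>F n in sequentially. \<forall>z\<in>ball x d0. \<forall>h. norm ((\<Sum>i<n. D i z h) - (\<Sum>i. D i z h)) \<le> e * norm h"
      if e: "0 < e" for e
    proof -
      have "(\<lambda>n. \<Sum>i. K * exp (- kp * real (i + n))) \<longlonglongrightarrow> 0"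
        using suminf_exist_split2[OF sum] by simp
      then have "\<forall>\<^sub>F n in sequentially. (\<Sum>i. K * exp (- kp * real (i + n))) < e" using e by (rule order_tendstoD)
      then show ?thesis
      proof eventually_elim
        case (elim n)
        show ?case
        proof (intro ballI allI)
          fix z h :: 'a assume "z \<in> ball x d0"
          then have z: "V z < 4 * c" using d0 by auto
          have s2: "summable (\<lambda>i. K * exp (- kp * real (i + n)) * norm h)"
            by (intro summable_mult2) (rule summable_ignore_initial_segment[OF sum, of n])
          have "(\<Sum>i. D i z h) = (\<Sum>i. D (i + n) z h) + (\<Sum>i<n. D i z h)"
            by (rule suminf_split_initial_segment[OF sumD[OF z]])
          then have "norm ((\<Sum>i<n. D i z h) - (\<Sum>i. D i z h)) = norm (\<Sum>i. D (i + n) z h)"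
            by (simp add: norm_minus_commute)
          also have "\<dots> \<le> (\<Sum>i. K * exp (- kp * real (i + n)) * norm h)"
            by (rule norm_suminf_le[OF D(2)[OF z] s2])
          also have "\<dots> = (\<Sum>i. K * exp (- kp * real (i + n))) * norm h"
            by (rule suminf_mult2[symmetric]) (rule summable_ignore_initial_segment[OF sum, of n])
          also have "\<dots> \<le> e * norm h" using elim by (intro mult_right_mono) auto
          finally show "norm ((\<Sum>i<n. D i z h) - (\<Sum>i. D i z h)) \<le> e * norm h" .
        qed
      qed
    qed
    show "(\<lambda>n. cut_incr b j n x) sums (\<Sum>n. cut_incr b j n x)" using cut_incr_summable[OF b x] by (rule summable_sums)
  qed (use d0 in auto)
  then obtain g where G: "\<forall>z\<in>ball x d0. (\<lambda>n. cut_incr b j n z) sums g z \<and>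
    (g has_derivative (\<lambda>h. \<Sum>n. D n z h)) (at z within ball x d0)" by blast
  then have g: "\<And>z. z \<in> ball x d0 \<Longrightarrow> (\<lambda>n. cut_incr b j n z) sums g z"
    "(g has_derivative (\<lambda>h. \<Sum>n. D n x h)) (at x within ball x d0)" using d0(1) by auto
  have "((\<lambda>z. \<Sum>n. cut_incr b j n z) has_derivative (\<lambda>h. \<Sum>n. D n x h)) (at x within ball x d0)"
    by (rule has_derivative_transform[OF _ _ g(2)]) (use d0 g(1) in \<open>auto simp: sums_iff\<close>)
  then have "((\<lambda>z. \<Sum>n. cut_incr b j n z) has_derivative (\<lambda>h. \<Sum>n. D n x h)) (at x)"
    using at_within_open[of x "ball x d0"] d0 by simp
  then have "(\<lambda>z. \<Sum>n. cut_incr b j n z) differentiable at x" by (rule differentiableI)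
  moreover have "a j differentiable at x"
    using bounded_linear_imp_has_derivative[OF a_bounded_linear] by (rule differentiableI)
  ultimately show ?thesis unfolding corr_def[abs_def] by (intro differentiable_add)
qed

lemma corr_nil: "m \<le> j \<Longrightarrow> corr b j x = 0"
  by (simp add: corr_def cut_incr_def E_def a_nil J_def)

text \<open>Values prescribed on the section are continued by the Jordan exponential, so linear
  evolution holds by construction. Beyond differentiability, the choice of \<open>corr\<close>
  matters only for the behaviour at 0.\<close>

definition phi :: "real \<Rightarrow> nat \<Rightarrow> 'a \<Rightarrow> complex" where
  "phi b i x = (if x = 0 then 0 else J lam m (tau x) (\<lambda>j. corr b (i + j) (base x)))"

lemma phi_nil: "m \<le> i \<Longrightarrow> phi b i x = 0"
  by (simp add: phi_def corr_nil J_def)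

lemma phi_differentiable:
  assumes b: "0 < b" and x: "x \<noteq> 0"
  shows "phi b i differentiable at x"
proof -
  obtain Dt Db where D: "(tau has_derivative Dt) (at x)" "(base has_derivative Db) (at x)"
    using tau_base_derivative[OF x] by metis
  have t: "(\<lambda>z. complex_of_real (tau z)) differentiable at x"
    using bounded_linear.has_derivative[OF bounded_linear_of_real D(1)] by (rule differentiableI)
  have e: "(\<lambda>z. exp (lam * complex_of_real (tau z))) differentiable at x"
  proof -
    have "exp differentiable at (lam * complex_of_real (tau x))"
      by (intro differentiableI[OF DERIV_exp[unfolded has_field_derivative_def]])
    moreover have "(\<lambda>z. lam * complex_of_real (tau z)) differentiable at x"
      by (intro differentiable_mult differentiable_const t)
    ultimately show ?thesis
      using differentiable_chain_at[of "\<lambda>z. lam * complex_of_real (tau z)" x exp] by (simp add: o_def)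
  qed
  have pow: "(\<lambda>z. complex_of_real (tau z ^ j / fact j)) differentiable at x" for j
  proof -
    have "(\<lambda>z. complex_of_real (tau z) ^ j) differentiable at x"
      by (induction j) (auto intro: differentiable_mult t)
    then have "(\<lambda>z. complex_of_real (tau z) ^ j * (1 / fact j)) differentiable at x"
      by (rule differentiable_mult[OF _ differentiable_const])
    then show ?thesis by simp
  qed
  have yb: "(\<lambda>z. corr b j (base z)) differentiable at x" for j
  proof -
    have "base differentiable at x" using D(2) by (rule differentiableI)
    moreover have "corr b j differentiable at (base x)"
      by (rule corr_differentiable[OF b]) (use V_base[OF x] c_pos in simp)
    ultimately show ?thesis using differentiable_chain_at[of base x "corr b j"] by (simp add: o_def)
  qed
  have "(\<lambda>z. J lam m (tau z) (\<lambda>j. corr b (i + j) (base z))) differentiable at x"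
    unfolding J_def
    by (intro ballI differentiable_mult differentiable_sum differentiable_const e pow yb) auto
  then obtain D where D: "((\<lambda>z. J lam m (tau z) (\<lambda>j. corr b (i + j) (base z))) has_derivative D) (at x)"
    by (auto simp: differentiable_def)
  have "(phi b i has_derivative D) (at x)"
    by (rule has_derivative_transform_within_open[OF D, of "- {0}"]) (use x in \<open>auto simp: phi_def\<close>)
  then show ?thesis by (rule differentiableI)
qed

lemma phi_flow:
  assumes D: "(phi b i has_derivative D) (at x)"
  shows "D (f x) = lam * phi b i x + phi b (Suc i) x"
proof (cases "x = 0")
  case True
  then show ?thesis using linear_0[OF has_derivative_linear[OF D]] by (simp add: f_0 phi_def)
next
  case False
  have "((\<lambda>t. J lam m (tau x + t) (\<lambda>j. corr b (i + j) (base x))) has_vector_derivative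
      of_real 1 * (lam * J lam m (tau x + 0) (\<lambda>j. corr b (i + j) (base x)) + J lam m (tau x + 0) (\<lambda>j. corr b (i + Suc j) (base x)))
      + J lam m (tau x + 0) (\<lambda>j. 0)) (at 0 within {0..1})"
    by (rule J_has_vector_derivative) (auto intro!: derivative_eq_intros simp: corr_nil)
  then have "((\<lambda>t. J lam m (tau x + t) (\<lambda>j. corr b (i + j) (base x))) has_vector_derivative
      lam * phi b i x + phi b (Suc i) x) (at 0 within {0..1})"
    using False by (simp add: phi_def J_def)
  from derivative_along_flow[OF D _ this] show ?thesis
    using False X_nonzero by (simp add: phi_def base_tau_X)
qed

end

section \<open>Tangency of the eigenfunctions to their linear parts\<close>

context eigen_flow begin

text \<open>Moves the reference time from 0 to t, so that increments computed at the section can be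
  compared at the point X x t.\<close>

lemma J_E: "J lam m t (\<lambda>j. E (i + j) 0 s x) = E i t s x"
  unfolding E_def by (subst add.assoc, subst J_J) (auto simp: a_nil)

text \<open>For x = X z t with z = base x, \<open>a i x\<close> is \<open>E i t t z\<close>, and
  \<open>phi b i x\<close> is \<open>E i t 0 z\<close> plus all cut steps. Up to the fraction of a
  step between K and t, the error is the sum of the steps weighted by \<open>cc n\<close>, the
  cutoff value minus the indicator of n < K. A nonzero weight before K means a slow trajectory, by
  \<open>dichotomy\<close>; from K on it means that the cutoff still keeps the step.\<close>

lemma phi_error:
  obtains b C th where "0 < b" "0 < C" "0 < th"
    "\<And>i x. x \<noteq> 0 \<Longrightarrow> V x < c \<Longrightarrow> norm (phi b i x - a i x) \<le> C * exp (- th * tau x) * norm x"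
proof -
  obtain Cd kd where Cd: "0 < Cd" "0 < kd"
    and dich: "\<And>x s. V x = c \<Longrightarrow> 0 \<le> s \<Longrightarrow> (norm (X x s))\<^sup>2 \<le> Cd * exp (- 2 * sig * s) \<or>
      (\<forall>t\<ge>s. kd * exp (- sig * (t - s)) * norm (X x s) \<le> norm (X x t))" using dichotomy by metis
  \<comment> \<open>Calibrated so that the fast alternative of \<open>dichotomy\<close> puts the
    argument of the cutoff at most at 1, where \<open>chi\<close> equals 1.\<close>
  define b where "b = 1 / (q * Cd)"
  have b: "0 < b" using q_pos Cd by (simp add: b_def)
  obtain C1 where C1: "0 < C1" "\<And>j t s0 s1 x y. V x < 4 * c \<Longrightarrow> V y < 4 * c \<Longrightarrow> 0 \<le> s0 \<Longrightarrow> s0 \<le> s1 \<Longrightarrow> s1 \<le> s0 + 1 \<Longrightarrow>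
    norm ((E j t s1 x - E j t s0 x) - (E j t s1 y - E j t s0 y))
      \<le> C1 * exp (Re lam * (t - s0) + eps * \<bar>t - s0\<bar>) * (norm (X x s0) + norm (X y s0)) * norm (X x s0 - X y s0)"
    using E_lip by metis
  have step: "norm (E j t s1 x - E j t s0 x) \<le> C1 * exp (Re lam * (t - s0) + eps * \<bar>t - s0\<bar>) * (norm (X x s0) * norm (X x s0))"
    if "V x < 4 * c" "0 \<le> s0" "s0 \<le> s1" "s1 \<le> s0 + 1" for j t s0 s1 x
    using C1(2)[OF that(1) _ that(2-4), of 0 j t] c_pos that by (simp add: E_zero mult.assoc)
  obtain L where L: "0 < L" "\<And>x y t. V x < 4 * c \<Longrightarrow> V y < 4 * c \<Longrightarrow> 0 \<le> t \<Longrightarrow>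
    exp (- L * t) * norm (x - y) \<le> norm (X x t - X y t)" using dist_lower by metis
  define C3 where "C3 = sqrt (2 / (b * p))"
  have C3: "0 < C3" using b p_pos by (simp add: C3_def)
  have R0: "0 < R0" using c_pos p_pos by (simp add: R0_def)
  define a1 where "a1 = - Re lam - eps - sig"
  have a1: "0 < a1" using sig_up by (simp add: a1_def)
  \<comment> \<open>Half of the smallest rate: one half is spent on decay in t, the other on
    summation over n.\<close>
  define th where "th = min (min a1 r) (min kp sig) / 2"
  have th: "0 < th" "2 * th \<le> a1" "2 * th \<le> r" "2 * th \<le> kp" "2 * th \<le> sig"
    using a1 r_pos kp_pos sig_pos by (auto simp: th_def)
  \<comment> \<open>\<open>M1\<close> bounds the discarded steps before K, \<open>M2\<close> the
    kept steps from K on, and \<open>M3\<close> the fraction of a step between K and t.\<close>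
  define M1 where "M1 = C1 * (kap * R0) / kd"
  define M2 where "M2 = C1 * C3 * (kap + exp L) * exp (2 * eps + kp)"
  define M3 where "M3 = C1 * exp (\<bar>Re lam\<bar> + eps) * exp L * (kap * R0 * exp r)"
  have M: "0 < M1" "0 < M2" "0 < M3"
    using C1(1) kap_pos R0 Cd C3 by (auto simp: M1_def M2_def M3_def add_pos_pos)
  define S where "S = (\<Sum>n. exp (- th * real n))"
  have S: "0 \<le> S" unfolding S_def by (intro suminf_nonneg summable_exp th) auto
  have main: "norm (phi b i x - a i x) \<le> ((M1 + M2) * S + M3) * exp (- th * tau x) * norm x"
    if x: "x \<noteq> 0" "V x < c" for i x
  proof -
    define z where "z = base x"
    define t where "t = tau x"
    have t: "0 < t" using V_tau_nonpos[OF x(1)] x(2) by (force simp: t_def)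
    have Vz: "V z = c" "V z < 4 * c" using V_base[OF x(1)] c_pos by (auto simp: z_def)
    have Xz: "X z t = x" using X_base_tau(1)[OF x(1)] t by (simp add: z_def t_def)
    have nz: "norm z \<le> R0" using in_cball[of z] Vz by simp
    define K where "K = nat \<lfloor>t\<rfloor>"
    have K: "real K \<le> t" "t < real K + 1" using t unfolding K_def by linarith+
    define d where "d n = E i t (real n + 1) z - E i t (real n) z" for n
    define ch where "ch n = chi (b * exp (2 * sig * real n) * V (X z (real n)))" for n
    define cc where "cc n = ch n - (if n < K then 1 else 0)" for n
    have "(\<lambda>n. J lam m t (\<lambda>j. cut_incr b (i + j) n z)) sums J lam m t (\<lambda>j. corr b (i + j) z - a (i + j) z)"
      unfolding corr_def add_diff_cancel_left' by (intro J_sums summable_sums cut_incr_summable b Vz)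
    moreover have "J lam m t (\<lambda>j. cut_incr b (i + j) n z) = ch n *\<^sub>R d n" for n
      unfolding cut_incr_def scaleR_conv_of_real J_cmult J_diff J_E by (simp add: ch_def d_def scaleR_conv_of_real add.commute)
    moreover have "J lam m t (\<lambda>j. corr b (i + j) z - a (i + j) z) = phi b i x - E i t 0 z"
      unfolding J_diff using x by (simp add: phi_def z_def t_def E_def)
    ultimately have "(\<lambda>n. ch n *\<^sub>R d n) sums (phi b i x - E i t 0 z)" by simp
    moreover have "(\<lambda>n. (if n < K then 1 else 0) *\<^sub>R d n) sums (E i t K z - E i t 0 z)"
    proof -
      have "(\<lambda>n. (if n < K then 1 else 0) *\<^sub>R d n) sums (\<Sum>n<K. (if n < K then 1 else 0) *\<^sub>R d n)"
        by (rule sums_finite) auto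
      also have "(\<Sum>n<K. (if n < K then 1 else 0) *\<^sub>R d n) = (\<Sum>n<K. E i t (real (Suc n)) z - E i t (real n) z)"
        by (intro sum.cong) (auto simp: d_def add.commute)
      also have "\<dots> = E i t K z - E i t 0 z" using sum_lessThan_telescope[of "\<lambda>n. E i t (real n) z" K] by simp
      finally show ?thesis .
    qed
    ultimately have sums: "(\<lambda>n. cc n *\<^sub>R d n) sums (phi b i x - E i t K z)"
      using sums_diff by (fastforce simp: cc_def scaleR_diff_left)
    have Et: "E i t t z = a i x" unfolding E_def Xz by (simp add: J_0 a_nil)
    have dle: "norm (d n) \<le> C1 * exp (Re lam * (t - n) + eps * \<bar>t - n\<bar>) * (norm (X z n) * norm (X z n))" for n
      unfolding d_def by (rule step[OF Vz(2)]) auto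
    have Xn: "norm (X z s) \<le> kap * exp (- r * s) * R0" if "0 \<le> s" for s
      using norm_decay[OF Vz(2) that] nz kap_pos by (meson mult_left_mono order_trans mult_nonneg_nonneg less_imp_le exp_ge_zero)
    \<comment> \<open>Covers the last time unit before t, where forward decay from x says
      nothing.\<close>
    have norm_before: "norm (X z s) \<le> exp L * norm x" if "0 \<le> s" "s \<le> t" "t \<le> s + 1" for s
    proof -
      have "exp (- L) * norm (X z s) \<le> exp (- L * (t - s)) * norm (X z s - 0)"
        using that L(1) by (intro mult_mono) auto
      also have "\<dots> \<le> norm (X (X z s) (t - s) - X 0 (t - s))"
        using that Vz c_pos by (intro L X_in_region) auto
      also have "\<dots> = norm x" using that Xz by (simp add: X_add)
      finally have "exp L * (exp (- L) * norm (X z s)) \<le> exp L * norm x" by (intro mult_left_mono) auto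
      then show ?thesis by (simp add: mult.assoc[symmetric] flip: exp_add)
    qed
    have ex: "exp (- (th * t + th * real n)) = exp (- th * t) * exp (- th * n)" for n :: nat by (simp flip: exp_add)
    have trm: "norm (cc n *\<^sub>R d n) \<le> (M1 + M2) * exp (- th * t) * norm x * exp (- th * n)" for n
    proof (cases "n < K")
      case True
      then have nt: "real n \<le> t" using K by linarith
      show ?thesis
      proof (cases "(norm (X z n))\<^sup>2 \<le> Cd * exp (- 2 * sig * n)")
        case True
        have "b * exp (2 * sig * n) * V (X z n) \<le> b * exp (2 * sig * n) * (q * (Cd * exp (- 2 * sig * n)))"
          using b q_pos True by (intro mult_left_mono order_trans[OF V_le]) auto
        also have "\<dots> = (b * q * Cd) * (exp (2 * sig * n) * exp (- 2 * sig * n))" by simp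
        also have "\<dots> = 1" using q_pos Cd by (simp add: b_def flip: exp_add)
        finally have "cc n = 0" using \<open>n < K\<close> by (simp add: cc_def ch_def chi_1)
        then show ?thesis using M by simp
      next
        case False
        \<comment> \<open>Slowness bounds one factor |X z n| through x, so that |x| enters linearly;
          the other factor is bounded by plain decay in n.\<close>
        then have "kd * exp (- sig * (t - n)) * norm (X z n) \<le> norm x" using dich[OF Vz(1), of "real n"] nt Xz by auto
        then have A1: "exp (sig * (t - n)) * (exp (- sig * (t - n)) * (kd * norm (X z n))) \<le> exp (sig * (t - n)) * norm x"
          by (intro mult_left_mono) (auto simp: mult_ac)
        have e1: "exp (sig * (t - n)) * (exp (- sig * (t - n)) * w) = w" for w
          by (simp add: mult.assoc[symmetric] flip: exp_add)
        from A1[unfolded e1] have X1: "norm (X z n) \<le> exp (sig * (t - n)) * norm x / kd"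
          unfolding pos_le_divide_eq[OF Cd(2)] by (simp only: mult.commute[of kd])
        have "norm (cc n *\<^sub>R d n) \<le> 1 * norm (d n)"
          using chi_bound[of "b * exp (2 * sig * real n) * V (X z (real n))"] \<open>n < K\<close>
          unfolding norm_scaleR cc_def ch_def by (intro mult_right_mono) auto
        also have "\<dots> \<le> 1 * (C1 * exp (Re lam * (t - n) + eps * \<bar>t - n\<bar>) * ((exp (sig * (t - n)) * norm x / kd) * (kap * exp (- r * n) * R0)))"
          using C1(1) Cd by (intro mult_left_mono order_trans[OF dle] mult_mono X1 Xn) auto
        also have "\<dots> = M1 * (exp (Re lam * (t - n) + eps * \<bar>t - n\<bar>) * exp (sig * (t - n)) * exp (- r * n)) * norm x"
          by (simp add: M1_def)
        also have "\<dots> = M1 * exp (- (a1 * (t - n) + r * n)) * norm x"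
          using nt by (simp add: a1_def algebra_simps flip: exp_add)
        also have "\<dots> \<le> M1 * exp (- (th * t + th * n)) * norm x"
        proof -
          have "2 * th * (t - n) + 2 * th * n \<le> a1 * (t - n) + r * n"
            using th nt by (intro add_mono mult_right_mono) auto
          moreover have "th * n \<le> th * t" using th nt by (intro mult_left_mono) auto
          ultimately have "th * t + th * n \<le> a1 * (t - n) + r * n" by (simp add: algebra_simps)
          then show ?thesis using M by (intro mult_right_mono mult_left_mono) auto
        qed
        also have "\<dots> \<le> (M1 + M2) * exp (- (th * t + th * n)) * norm x" using M by (intro mult_right_mono) auto
        finally show ?thesis unfolding ex by (simp only: mult_ac)
      qed
    next
      case False
      then have Kn: "K \<le> n" by simp
      show ?thesis
      proof (cases "b * exp (2 * sig * n) * V (X z n) < 2")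
        case True
        have X1: "norm (X z n) \<le> C3 * exp (- sig * n)" unfolding C3_def by (rule cutoff_norm[OF True b])
        have X2: "norm (X z n) \<le> (kap + exp L) * exp (- r * (n - t)) * norm x"
        proof (cases "t \<le> n")
          case True
          have "norm (X z n) = norm (X x (n - t))" using Xz True t by (metis X_add add_diff_cancel_left' diff_ge_0_iff_ge diff_add_cancel add.commute less_imp_le)
          also have "\<dots> \<le> kap * exp (- r * (n - t)) * norm x" using True x c_pos by (intro norm_decay) auto
          also have "\<dots> \<le> (kap + exp L) * exp (- r * (n - t)) * norm x" by (intro mult_right_mono) auto
          finally show ?thesis .
        next
          case False
          have "norm (X z n) \<le> exp L * 1 * norm x" using norm_before[of "real n"] False K Kn by auto
          also have "\<dots> \<le> (kap + exp L) * exp (- r * (n - t)) * norm x"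
            using False r_pos kap_pos by (intro mult_right_mono mult_mono) (auto simp: mult_nonneg_nonpos2 mult_le_0_iff)
          finally show ?thesis .
        qed
        have "norm (cc n *\<^sub>R d n) \<le> 1 * norm (d n)"
          using chi_bound[of "b * exp (2 * sig * real n) * V (X z (real n))"] False
          unfolding norm_scaleR cc_def ch_def by (intro mult_right_mono) auto
        also have "\<dots> \<le> 1 * (C1 * exp (Re lam * (t - n) + eps * \<bar>t - n\<bar>) *
            ((C3 * exp (- sig * n)) * ((kap + exp L) * exp (- r * (n - t)) * norm x)))"
          using C1(1) C3 by (intro mult_left_mono order_trans[OF dle] mult_mono X1 X2) auto
        also have "\<dots> = C1 * C3 * (kap + exp L) *
            (exp (Re lam * (t - n) + eps * \<bar>t - n\<bar>) * exp (- sig * n) * exp (- r * (n - t))) * norm x" by simp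
        also have "\<dots> \<le> C1 * C3 * (kap + exp L) * (exp (2 * eps + kp) * exp (- (th * t + th * n))) * norm x"
        proof -
          have e: "eps * \<bar>t - n\<bar> \<le> eps * (n - t) + 2 * eps"
          proof -
            have "\<bar>t - n\<bar> \<le> (n - t) + 2" using K Kn by (auto simp: abs_if)
            then have "eps * \<bar>t - n\<bar> \<le> eps * ((n - t) + 2)" using eps_pos by (intro mult_left_mono) auto
            then show ?thesis by (simp add: algebra_simps)
          qed
          \<comment> \<open>A step with n \<ge> K may start up to one time unit before t; the
            summand \<open>kp\<close> covers that case.\<close>
          have g: "th * t + th * n \<le> kp * (n - t) + sig * t + kp"
          proof (cases "t \<le> n")
            case True
            have "2 * th * (n - t) + 2 * th * t \<le> kp * (n - t) + sig * t"
              using th True t by (intro add_mono mult_right_mono) auto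
            moreover have "th * t \<le> th * n" using th True by (intro mult_left_mono) auto
            ultimately show ?thesis using kp_pos by (simp add: algebra_simps)
          next
            case False
            have "kp * (- 1) \<le> kp * (n - t)" using kp_pos K Kn by (intro mult_left_mono) auto
            moreover have "2 * th * t \<le> sig * t" using th t by (intro mult_right_mono) auto
            moreover have "th * n \<le> th * t" using th False by (intro mult_left_mono) auto
            ultimately show ?thesis by simp
          qed
          have "Re lam * (t - n) + eps * \<bar>t - n\<bar> + (- sig * n) + (- r * (n - t))
              \<le> (2 * eps + kp) + (- (th * t + th * n))"
            using e g by (simp add: kp_def algebra_simps)
          then have "exp (Re lam * (t - n) + eps * \<bar>t - n\<bar> + (- sig * n) + (- r * (n - t)))
              \<le> exp ((2 * eps + kp) + (- (th * t + th * n)))" by simp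
          then show ?thesis unfolding exp_add[symmetric]
            using C1(1) C3 kap_pos by (intro mult_right_mono mult_left_mono) auto
        qed
        also have "\<dots> = M2 * exp (- (th * t + th * n)) * norm x" by (simp add: M2_def)
        also have "\<dots> \<le> (M1 + M2) * exp (- (th * t + th * n)) * norm x" using M by (intro mult_right_mono) auto
        finally show ?thesis unfolding ex by (simp only: mult_ac)
      next
        case False
        then have "cc n = 0" using \<open>\<not> n < K\<close> chi_0 by (simp add: cc_def ch_def)
        then show ?thesis using M by simp
      qed
    qed
    have "norm (phi b i x - E i t K z) = norm (\<Sum>n. cc n *\<^sub>R d n)" using sums by (simp add: sums_iff)
    also have "\<dots> \<le> (\<Sum>n. (M1 + M2) * exp (- th * t) * norm x * exp (- th * n))"
      by (intro norm_suminf_le trm summable_mult summable_exp th)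
    also have "\<dots> = (M1 + M2) * exp (- th * t) * norm x * S"
      unfolding S_def by (intro suminf_mult summable_exp th)
    finally have A: "norm (phi b i x - E i t K z) \<le> (M1 + M2) * exp (- th * t) * norm x * S" .
    have "norm (E i t t z - E i t K z) \<le> C1 * exp (Re lam * (t - K) + eps * \<bar>t - K\<bar>) * (norm (X z K) * norm (X z K))"
      using K by (intro step[OF Vz(2)]) auto
    also have "\<dots> \<le> C1 * exp (\<bar>Re lam\<bar> + eps) * ((exp L * norm x) * (kap * R0 * exp r * exp (- th * t)))"
    proof -
      have "Re lam * (t - K) \<le> \<bar>Re lam\<bar> * 1"
        by (rule order_trans[OF abs_ge_self]) (use K in \<open>auto simp: abs_mult intro!: mult_left_le\<close>)
      moreover have "eps * \<bar>t - K\<bar> \<le> eps * 1" using K eps_pos by (intro mult_left_mono) auto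
      ultimately have e: "exp (Re lam * (t - K) + eps * \<bar>t - K\<bar>) \<le> exp (\<bar>Re lam\<bar> + eps)" by simp
      have er: "exp (- r * K) \<le> exp r * exp (- th * t)"
      proof -
        have "r * t \<le> r * (K + 1)" using K r_pos by (intro mult_left_mono) auto
        moreover have "th * t \<le> r * t" using th t by (intro mult_right_mono) auto
        ultimately show ?thesis by (simp add: algebra_simps flip: exp_add)
      qed
      have "norm (X z K) \<le> kap * exp (- r * K) * R0" by (rule Xn) simp
      also have "\<dots> \<le> kap * (exp r * exp (- th * t)) * R0"
        using kap_pos R0 by (intro mult_right_mono mult_left_mono er) auto
      finally have x2: "norm (X z K) \<le> kap * R0 * exp r * exp (- th * t)" by (simp only: mult_ac)
      have x1: "norm (X z K) \<le> exp L * norm x" using K by (intro norm_before) auto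
      show ?thesis using C1(1) by (intro mult_mono e x1 x2 mult_left_mono) auto
    qed
    also have "\<dots> = M3 * exp (- th * t) * norm x" by (simp add: M3_def)
    finally have B: "norm (E i t t z - E i t K z) \<le> M3 * exp (- th * t) * norm x" .
    have "norm (phi b i x - a i x) \<le> norm (phi b i x - E i t K z) + norm (E i t t z - E i t K z)"
      unfolding Et[symmetric] using norm_triangle_ineq4[of "phi b i x - E i t K z" "E i t t z - E i t K z"] by simp
    then show ?thesis using A B by (simp add: t_def algebra_simps)
  qed
  show ?thesis
    by (rule that[OF b _ th(1) main]) (use M S in \<open>auto intro: add_nonneg_pos\<close>)
qed

text \<open>By \<open>norm_ge_tau\<close> the time \<open>tau x\<close> grows without bound as x
  approaches 0, so the factor exp (- th tau x) turns the error into o(|x|).\<close>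

lemma phi_exists:
  obtains phi where "\<And>i x. phi i differentiable at x" "\<And>i. (phi i has_derivative a i) (at 0)"
    "\<And>i x D. (phi i has_derivative D) (at x) \<Longrightarrow> D (f x) = lam * phi i x + phi (Suc i) x"
    "\<And>i x. m \<le> i \<Longrightarrow> phi i x = 0"
proof -
  obtain b C th where b: "0 < b" "0 < C" "0 < th"
    and err: "\<And>i x. x \<noteq> 0 \<Longrightarrow> V x < c \<Longrightarrow> norm (phi b i x - a i x) \<le> C * exp (- th * tau x) * norm x"
    using phi_error by metis
  obtain L k where L: "0 < L" "0 < k"
    "\<And>x. x \<noteq> 0 \<Longrightarrow> V x < c \<Longrightarrow> 0 < tau x \<and> k * exp (- L * tau x) \<le> norm x" using norm_ge_tau by metis
  have der0: "(phi b i has_derivative a i) (at 0)" for i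
    unfolding has_derivative_at_alt
  proof (intro conjI allI impI)
    fix e :: real assume e: "0 < e"
    define t0 where "t0 = ln (C / e) / th"
    have t0: "C * exp (- th * t0) = e" using e b by (simp add: t0_def exp_minus field_simps)
    define d where "d = min (sqrt (c / q)) (k * exp (- L * t0))"
    show "\<exists>d>0. \<forall>x. norm (x - 0) < d \<longrightarrow> norm (phi b i x - phi b i 0 - a i (x - 0)) \<le> e * norm (x - 0)"
    proof (intro exI[of _ d] conjI allI impI)
      show "0 < d" using c_pos q_pos L by (simp add: d_def)
      fix x :: 'a assume x: "norm (x - 0) < d"
      show "norm (phi b i x - phi b i 0 - a i (x - 0)) \<le> e * norm (x - 0)"
      proof (cases "x = 0")
        case False
        have "(norm x)\<^sup>2 < (sqrt (c / q))\<^sup>2" using x by (intro power_strict_mono) (auto simp: d_def)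
        then have "q * (norm x)\<^sup>2 < c" using c_pos q_pos by (simp add: field_simps)
        then have V: "V x < c" using V_le[of x] by linarith
        have "k * exp (- L * tau x) < k * exp (- L * t0)" using L(3)[OF False V] x by (simp add: d_def)
        then have "L * t0 < L * tau x" using L(2) by simp
        then have "t0 \<le> tau x" using L(1) by simp
        then have "C * exp (- th * tau x) \<le> C * exp (- th * t0)" using b by (intro mult_left_mono) auto
        then have "C * exp (- th * tau x) * norm x \<le> e * norm x" unfolding t0 by (intro mult_right_mono) auto
        then show ?thesis using err[OF False V, of i] by (simp add: phi_def)
      qed (simp add: phi_def linear_0[OF a_linear])
    qed
  qed (rule a_bounded_linear)
  show ?thesis
  proof (rule that[of "phi b"])
    show "phi b i differentiable at x" for i x
      using phi_differentiable[OF b(1)] differentiableI[OF der0] by (cases "x = 0") auto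
  qed (use der0 phi_flow phi_nil in auto)
qed

end

section \<open>Finite linear systems of observables\<close>

text \<open>The Euler step G = 1 + h F contracts \<open>V\<close>, while the eigenfunctional sees
  its iterates as powers of 1 + h lam. Hence |1 + h lam| < 1, and Re lam < 0, without solving the
  linear equation.\<close>

lemma eigenvalue_Re_neg:
  fixes F :: "'a::euclidean_space \<Rightarrow> 'a" and P :: "'a \<Rightarrow>\<^sub>L 'a" and u :: "'a \<Rightarrow> complex"
  assumes F: "linear F" and u: "linear u"
    and P_sym: "\<And>x y. x \<bullet> P y = y \<bullet> P x"
    and p: "0 < p" "\<And>x. p * (norm x)\<^sup>2 \<le> x \<bullet> P x" and r: "0 < r"
    and contr: "\<And>x. x \<bullet> P (F x) \<le> - r * (x \<bullet> P x)"
    and eig: "\<And>x. u (F x) = lam * u x" and nz: "u x0 \<noteq> 0"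
  shows "Re lam < 0"
proof -
  define V where "V x = x \<bullet> P x" for x
  have V_nn: "0 \<le> V x" for x
    unfolding V_def by (rule order_trans[OF _ p(2)]) (use p(1) in simp)
  obtain B where B: "0 < B" "\<And>x. norm (F x) \<le> norm x * B"
    using bounded_linear.pos_bounded[of F] F linear_conv_bounded_linear by blast
  obtain D where D: "0 < D" "\<And>x. norm (u x) \<le> norm x * D"
    using bounded_linear.pos_bounded[of u] u linear_conv_bounded_linear by blast
  define K where "K = norm P * B\<^sup>2 / p"
  have VF: "V (F x) \<le> K * V x" for x
  proof -
    have "V (F x) \<le> norm (F x) * norm (P (F x))" unfolding V_def by (rule norm_cauchy_schwarz)
    also have "\<dots> \<le> norm (F x) * (norm P * norm (F x))" by (intro mult_left_mono norm_blinfun) auto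
    also have "\<dots> = norm P * (norm (F x))\<^sup>2" by (simp add: power2_eq_square)
    also have "\<dots> \<le> norm P * (norm x * B)\<^sup>2" by (intro mult_left_mono power_mono B) auto
    also have "\<dots> = K * (p * (norm x)\<^sup>2)" using p(1) by (simp add: K_def power_mult_distrib)
    also have "\<dots> \<le> K * V x" unfolding V_def using p(1) by (intro mult_left_mono p) (auto simp: K_def)
    finally show ?thesis .
  qed
  have K: "0 \<le> K" using p(1) by (simp add: K_def)
  \<comment> \<open>Small enough that the second-order term consumes at most half of the first-order
    gain 2 h r V x.\<close>
  define h where "h = r / (K + 1)"
  have h: "0 < h" "h * K \<le> r" using r K by (auto simp: h_def field_simps)
  define G where "G x = x + h *\<^sub>R F x" for x
  have VG: "V (G x) \<le> (1 - r * h) * V x" for x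
  proof -
    have "V (G x) = V x + 2 * h * (x \<bullet> P (F x)) + h * (h * V (F x))"
      by (simp add: V_def G_def blinfun.add_right blinfun.scaleR_right inner_add_left inner_add_right P_sym[of "F x" x] algebra_simps)
    also have "\<dots> \<le> V x + 2 * h * (- r * V x) + h * (h * (K * V x))"
      using h(1) contr[of x] VF[of x] unfolding V_def[symmetric]
      by (intro add_mono mult_left_mono) auto
    also have "h * (h * (K * V x)) \<le> h * (r * V x)"
      using h V_nn[of x] by (intro mult_left_mono) (auto simp: mult.assoc[symmetric] intro: mult_right_mono)
    finally show ?thesis by (simp add: algebra_simps)
  qed
  have V0: "0 < V x0"
  proof -
    have "x0 \<noteq> 0" using nz linear_0[OF u] by auto
    then have "0 < p * (norm x0)\<^sup>2" using p(1) by simp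
    then show ?thesis unfolding V_def using p(2)[of x0] by linarith
  qed
  have "0 \<le> (1 - r * h) * V x0" using VG[of x0] V_nn[of "G x0"] by linarith
  then have s0: "0 \<le> 1 - r * h" using V0 by (simp add: zero_le_mult_iff)
  have s1: "1 - r * h < 1" using r h by simp
  have Vk: "V ((G ^^ k) x0) \<le> (1 - r * h) ^ k * V x0" for k
  proof (induction k)
    case (Suc k)
    have "V ((G ^^ Suc k) x0) \<le> (1 - r * h) * V ((G ^^ k) x0)" using VG by simp
    also have "\<dots> \<le> (1 - r * h) * ((1 - r * h) ^ k * V x0)" by (intro mult_left_mono Suc s0)
    finally show ?case by simp
  qed simp
  have uk: "u ((G ^^ k) x0) = (1 + of_real h * lam) ^ k * u x0" for k
  proof (induction k)
    case (Suc k)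
    have "u (G x) = (1 + of_real h * lam) * u x" for x
      using u by (simp add: G_def linear_add linear_scale eig scaleR_conv_of_real algebra_simps)
    then show ?case using Suc by simp
  qed simp
  have "norm (1 + of_real h * lam) < 1"
  proof (rule ccontr)
    assume "\<not> ?thesis"
    then have ge: "1 \<le> norm (1 + of_real h * lam)" by simp
    have "(norm (u x0))\<^sup>2 \<le> D\<^sup>2 / p * V x0 * (1 - r * h) ^ k" for k
    proof -
      have "1 * norm (u x0) \<le> norm (1 + of_real h * lam) ^ k * norm (u x0)"
        using ge by (intro mult_right_mono one_le_power) auto
      also have "\<dots> = norm (u ((G ^^ k) x0))" by (simp add: uk norm_mult norm_power)
      also have "\<dots> \<le> norm ((G ^^ k) x0) * D" by (rule D)
      finally have "(norm (u x0))\<^sup>2 \<le> (norm ((G ^^ k) x0) * D)\<^sup>2" by (intro power_mono) auto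
      also have "\<dots> = D\<^sup>2 / p * (p * (norm ((G ^^ k) x0))\<^sup>2)" using p(1) by (simp add: power_mult_distrib)
      also have "\<dots> \<le> D\<^sup>2 / p * ((1 - r * h) ^ k * V x0)"
        using p(1) p(2)[of "(G ^^ k) x0"] Vk[of k] by (intro mult_left_mono) (auto simp: V_def)
      finally show ?thesis by (simp add: mult_ac)
    qed
    moreover have "(\<lambda>k. D\<^sup>2 / p * V x0 * (1 - r * h) ^ k) \<longlonglongrightarrow> D\<^sup>2 / p * V x0 * 0"
      using s0 s1 by (intro tendsto_mult tendsto_const LIMSEQ_power_zero) auto
    ultimately have "(norm (u x0))\<^sup>2 \<le> D\<^sup>2 / p * V x0 * 0" by (intro LIMSEQ_le_const) auto
    then show False using nz by simp
  qed
  then have "1 + h * Re lam < 1" using complex_Re_le_cmod[of "1 + of_real h * lam"] by simp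
  then show ?thesis using h(1) by (simp add: mult_less_0_iff)
qed

text \<open>The last nonzero member of the chain is a genuine eigenfunctional.\<close>

lemma generalized_eigenvalue_Re_neg:
  fixes F :: "'a::euclidean_space \<Rightarrow> 'a" and P :: "'a \<Rightarrow>\<^sub>L 'a" and u :: "'a \<Rightarrow> complex"
  assumes F: "linear F" and u: "linear u"
    and P: "\<And>x y. x \<bullet> P y = y \<bullet> P x" "0 < p" "\<And>x. p * (norm x)\<^sup>2 \<le> x \<bullet> P x" "0 < r"
      "\<And>x. x \<bullet> P (F x) \<le> - r * (x \<bullet> P x)"
    and nil: "(nshift F lam ^^ m) u = (\<lambda>_. 0)" and nz: "u \<noteq> (\<lambda>_. 0)"
  shows "Re lam < 0"
proof -
  define k where "k = (LEAST k. (nshift F lam ^^ k) u = (\<lambda>_. 0))"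
  have k: "(nshift F lam ^^ k) u = (\<lambda>_. 0)" unfolding k_def by (rule LeastI[of _ m]) (rule nil)
  have "k \<noteq> 0" using k nz by (cases k) auto
  then obtain j where j: "k = Suc j" by (cases k) auto
  define w where "w = (nshift F lam ^^ j) u"
  have "w \<noteq> (\<lambda>_. 0)" unfolding w_def using not_less_Least[of j "\<lambda>k. (nshift F lam ^^ k) u = (\<lambda>_. 0)"] j
    by (simp add: k_def)
  then obtain x0 where x0: "w x0 \<noteq> 0" by auto
  have "nshift F lam w = (\<lambda>_. 0)" using k by (simp add: j w_def)
  then have eig: "w (F x) = lam * w x" for x unfolding nshift_def by (auto dest!: fun_cong[of _ _ x])
  have "linear w" unfolding w_def by (intro linear_nshift_pow F u)
  then show ?thesis using eigenvalue_Re_neg[OF F _ P(1-5) eig x0] by blast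
qed

text \<open>Observables form an indexed family that may contain repetitions and dependent members,
  so a system can be enlarged without normalization.\<close>

definition lin_sys :: "('a::real_normed_vector \<Rightarrow> 'a) \<Rightarrow> nat \<Rightarrow> (nat \<Rightarrow> 'a \<Rightarrow> real) \<Rightarrow> (nat \<Rightarrow> nat \<Rightarrow> real) \<Rightarrow> bool" where
  "lin_sys f N gs A \<longleftrightarrow> hurwitz N A \<and> (\<forall>i<N. \<forall>x. gs i differentiable at x \<and>
     (\<forall>D. (gs i has_derivative D) (at x) \<longrightarrow> D (f x) = (\<Sum>j<N. A i j * gs j x)))"

definition has_fun :: "nat \<Rightarrow> (nat \<Rightarrow> 'a \<Rightarrow> real) \<Rightarrow> ('a \<Rightarrow> real) \<Rightarrow> bool" where
  "has_fun N gs g \<longleftrightarrow> (\<exists>i<N. gs i = g)"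

definition extends :: "nat \<Rightarrow> (nat \<Rightarrow> 'a \<Rightarrow> real) \<Rightarrow> nat \<Rightarrow> (nat \<Rightarrow> 'a \<Rightarrow> real) \<Rightarrow> bool" where
  "extends N gs N' gs' \<longleftrightarrow> N \<le> N' \<and> (\<forall>i<N. gs' i = gs i)"

lemma extends_refl: "extends N gs N gs" by (simp add: extends_def)

lemma extends_trans: "extends N gs N' gs' \<Longrightarrow> extends N' gs' N'' gs'' \<Longrightarrow> extends N gs N'' gs''"
  by (auto simp: extends_def)

lemma has_fun_extends: "has_fun N gs g \<Longrightarrow> extends N gs N' gs' \<Longrightarrow> has_fun N' gs' g"
  unfolding has_fun_def extends_def by (metis order_less_le_trans)

text \<open>Quantifying over all systems makes the property composable: such functions can be put
  into one system one after the other.\<close>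

definition adjoinable :: "('a::real_normed_vector \<Rightarrow> 'a) \<Rightarrow> ('a \<Rightarrow> real) \<Rightarrow> bool" where
  "adjoinable f g \<longleftrightarrow> (\<forall>N gs A. lin_sys f N gs A \<longrightarrow>
     (\<exists>N' gs' A'. lin_sys f N' gs' A' \<and> extends N gs N' gs' \<and> has_fun N' gs' g))"

lemma has_fun_combination:
  assumes "h = (\<lambda>_. 0) \<or> has_fun N gs h"
  shows "\<exists>k. \<forall>x. h x = (\<Sum>j<N. k j * gs j x)"
  using assms
proof
  assume "h = (\<lambda>_. 0)" then show ?thesis by (intro exI[of _ "\<lambda>_. 0"]) simp
next
  assume "has_fun N gs h"
  then obtain i where i: "i < N" "gs i = h" by (auto simp: has_fun_def)
  have "(\<Sum>j<N. (if j = i then 1 else 0) * gs j x) = h x" for x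
  proof -
    have "(\<Sum>j<N. (if j = i then 1 else 0) * gs j x) = (\<Sum>j<N. if j = i then gs j x else 0)"
      by (intro sum.cong) auto
    then show ?thesis using i by simp
  qed
  then show ?thesis by (intro exI[of _ "\<lambda>j. if j = i then 1 else 0"]) simp
qed

text \<open>The enlarged matrix is block triangular. The new diagonal block is the real form of
  multiplication by \<open>lam\<close>; \<open>H\<close> contributes only entries in the old
  columns. An eigenvector either restricts to an eigenvector of A or is supported on the new
  block.\<close>

lemma lin_sys_adjoin:
  fixes G H :: "'a::real_normed_vector \<Rightarrow> complex"
  assumes sys: "lin_sys f N gs A" and lam: "Re lam < 0"
    and G: "\<And>x. G differentiable at x"
    and GH: "\<And>x D. (G has_derivative D) (at x) \<Longrightarrow> D (f x) = lam * G x + H x"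
    and H: "(\<lambda>x. Re (H x)) = (\<lambda>_. 0) \<or> has_fun N gs (\<lambda>x. Re (H x))"
      "(\<lambda>x. Im (H x)) = (\<lambda>_. 0) \<or> has_fun N gs (\<lambda>x. Im (H x))"
  shows "\<exists>N' gs' A'. lin_sys f N' gs' A' \<and> extends N gs N' gs' \<and>
    has_fun N' gs' (\<lambda>x. Re (G x)) \<and> has_fun N' gs' (\<lambda>x. Im (G x))"
proof -
  obtain k where k: "\<And>x. Re (H x) = (\<Sum>j<N. k j * gs j x)" using has_fun_combination[OF H(1)] by blast
  obtain l where l: "\<And>x. Im (H x) = (\<Sum>j<N. l j * gs j x)" using has_fun_combination[OF H(2)] by blast
  define gs' where "gs' i = (if i < N then gs i else if i = N then (\<lambda>x. Re (G x)) else (\<lambda>x. Im (G x)))" for i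
  define A' where "A' i j = (if i < N then (if j < N then A i j else 0)
     else if i = N then (if j < N then k j else if j = N then Re lam else - Im lam)
     else (if j < N then l j else if j = N then Im lam else Re lam))" for i j
  have sum2: "(\<Sum>j<Suc (Suc N). e j) = (\<Sum>j<N. e j) + e N + e (Suc N)" for e :: "nat \<Rightarrow> 'b::comm_monoid_add"
    by simp
  have hur: "hurwitz (Suc (Suc N)) A'" unfolding hurwitz_def
  proof (intro allI impI, elim conjE)
    fix mu :: complex and v :: "nat \<Rightarrow> complex"
    assume v: "\<exists>i<Suc (Suc N). v i \<noteq> 0"
      and ev: "\<forall>i<Suc (Suc N). (\<Sum>j<Suc (Suc N). complex_of_real (A' i j) * v j) = mu * v i"
    show "Re mu < 0"
    proof (cases "\<exists>i<N. v i \<noteq> 0")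
      case True
      have "(\<Sum>j<N. complex_of_real (A i j) * v j) = mu * v i" if "i < N" for i
      proof -
        have "(\<Sum>j<N. complex_of_real (A i j) * v j) = (\<Sum>j<N. complex_of_real (A' i j) * v j)"
          using that by (intro sum.cong) (auto simp: A'_def)
        also have "\<dots> = (\<Sum>j<Suc (Suc N). complex_of_real (A' i j) * v j)"
          unfolding sum2 using that by (simp add: A'_def)
        finally show ?thesis using ev that by simp
      qed
      then show ?thesis using True sys unfolding lin_sys_def hurwitz_def by blast
    next
      case False
      then have z: "(\<Sum>j<N. complex_of_real (A' i j) * v j) = 0" for i by (intro sum.neutral) auto
      define p where "p = v N"
      define q where "q = v (Suc N)"
      have "(\<Sum>j<Suc (Suc N). complex_of_real (A' N j) * v j) = mu * p"
        "(\<Sum>j<Suc (Suc N). complex_of_real (A' (Suc N) j) * v j) = mu * q" using ev by (auto simp: p_def q_def)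
      then have e: "of_real (Re lam) * p - of_real (Im lam) * q = mu * p"
        "of_real (Im lam) * p + of_real (Re lam) * q = mu * q"
        unfolding sum2 z by (auto simp: A'_def p_def q_def)
      \<comment> \<open>p + i q and p - i q diagonalize the new block, with eigenvalues
        \<open>lam\<close> and its conjugate.\<close>
      have "lam = of_real (Re lam) + \<i> * of_real (Im lam)" "cnj lam = of_real (Re lam) - \<i> * of_real (Im lam)"
        by (auto simp: complex_eq_iff)
      then have "lam * (p + \<i> * q) = (of_real (Re lam) * p - of_real (Im lam) * q) + \<i> * (of_real (Im lam) * p + of_real (Re lam) * q)"
        "cnj lam * (p - \<i> * q) = (of_real (Re lam) * p - of_real (Im lam) * q) - \<i> * (of_real (Im lam) * p + of_real (Re lam) * q)"
        by (auto simp: algebra_simps complex_eq_iff)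
      then have "(mu - lam) * (p + \<i> * q) = 0" "(mu - cnj lam) * (p - \<i> * q) = 0"
        unfolding e by (auto simp: algebra_simps)
      moreover have "p + \<i> * q \<noteq> 0 \<or> p - \<i> * q \<noteq> 0"
      proof (rule ccontr)
        assume "\<not> ?thesis"
        then have "p + \<i> * q = 0" "p - \<i> * q = 0" by auto
        then have "(p + \<i> * q) + (p - \<i> * q) = 0" by simp
        then have "p = 0" by simp
        moreover from this have "q = 0" using \<open>p + \<i> * q = 0\<close> by simp
        ultimately have "v N = 0" "v (Suc N) = 0" by (auto simp: p_def q_def)
        then show False using v False less_Suc_eq by metis
      qed
      ultimately have "mu = lam \<or> mu = cnj lam" by auto
      then show ?thesis using lam by auto
    qed
  qed
  have Re_d: "((\<lambda>x. Re (G x)) has_derivative (\<lambda>h. Re (D h))) (at x)"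
    and Im_d: "((\<lambda>x. Im (G x)) has_derivative (\<lambda>h. Im (D h))) (at x)"
    if "(G has_derivative D) (at x)" for D x
    using bounded_linear.has_derivative[OF bounded_linear_Re that]
      bounded_linear.has_derivative[OF bounded_linear_Im that] by auto
  have "lin_sys f (Suc (Suc N)) gs' A'" unfolding lin_sys_def
  proof (intro conjI allI impI hur)
    fix i x assume i: "i < Suc (Suc N)"
    obtain DG where DG: "(G has_derivative DG) (at x)" using G by (auto simp: differentiable_def)
    note eq = GH[OF DG]
    show "gs' i differentiable at x"
      using i sys Re_d[OF DG] Im_d[OF DG] by (auto simp: gs'_def lin_sys_def intro: differentiableI)
    fix D assume D: "(gs' i has_derivative D) (at x)"
    have gsum: "(\<Sum>j<N. c j * gs' j x) = (\<Sum>j<N. c j * gs j x)" for c by (intro sum.cong) (auto simp: gs'_def)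
    consider "i < N" | "i = N" | "i = Suc N" using i by linarith
    then show "D (f x) = (\<Sum>j<Suc (Suc N). A' i j * gs' j x)"
    proof cases
      case 1
      then have "D (f x) = (\<Sum>j<N. A i j * gs j x)" using sys D by (auto simp: lin_sys_def gs'_def)
      also have "\<dots> = (\<Sum>j<N. A' i j * gs j x)" using 1 by (intro sum.cong) (auto simp: A'_def)
      finally show ?thesis unfolding sum2 gsum using 1 by (simp add: A'_def)
    next
      case 2
      have "D = (\<lambda>h. Re (DG h))"
        by (rule has_derivative_unique[OF _ Re_d[OF DG]]) (use D 2 in \<open>simp add: gs'_def\<close>)
      then have "D (f x) = Re lam * Re (G x) - Im lam * Im (G x) + (\<Sum>j<N. k j * gs j x)" by (simp add: eq k)
      moreover have "(\<Sum>j<N. A' i j * gs j x) = (\<Sum>j<N. k j * gs j x)" using 2 by (intro sum.cong) (auto simp: A'_def)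
      ultimately show ?thesis unfolding sum2 gsum using 2 by (simp add: A'_def gs'_def)
    next
      case 3
      have "D = (\<lambda>h. Im (DG h))"
        by (rule has_derivative_unique[OF _ Im_d[OF DG]]) (use D 3 in \<open>simp add: gs'_def\<close>)
      then have "D (f x) = Re lam * Im (G x) + Im lam * Re (G x) + (\<Sum>j<N. l j * gs j x)" by (simp add: eq l)
      moreover have "(\<Sum>j<N. A' i j * gs j x) = (\<Sum>j<N. l j * gs j x)" using 3 by (intro sum.cong) (auto simp: A'_def)
      ultimately show ?thesis unfolding sum2 gsum using 3 by (simp add: A'_def gs'_def)
    qed
  qed
  moreover have "extends N gs (Suc (Suc N)) gs'" by (auto simp: extends_def gs'_def)
  moreover have "has_fun (Suc (Suc N)) gs' (\<lambda>x. Re (G x))" unfolding has_fun_def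
    by (intro exI[of _ N]) (auto simp: gs'_def)
  moreover have "has_fun (Suc (Suc N)) gs' (\<lambda>x. Im (G x))" unfolding has_fun_def
    by (intro exI[of _ "Suc N"]) (auto simp: gs'_def)
  ultimately show ?thesis by blast
qed

text \<open>The evolution of each member involves the next one, so the chain is adjoined from its
  end down to index 0.\<close>

lemma adjoinable_chain:
  fixes phi :: "nat \<Rightarrow> 'a::real_normed_vector \<Rightarrow> complex"
  assumes lam: "Re lam < 0" and phi: "\<And>i x. phi i differentiable at x"
    and flow: "\<And>i x D. (phi i has_derivative D) (at x) \<Longrightarrow> D (f x) = lam * phi i x + phi (Suc i) x"
    and nil: "\<And>i x. m \<le> i \<Longrightarrow> phi i x = 0" and m: "0 < m"
  shows "adjoinable f (\<lambda>x. Re (phi 0 x))" "adjoinable f (\<lambda>x. Im (phi 0 x))"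
proof -
  have "\<exists>N' gs' A'. lin_sys f N' gs' A' \<and> extends N gs N' gs' \<and>
      has_fun N' gs' (\<lambda>x. Re (phi i x)) \<and> has_fun N' gs' (\<lambda>x. Im (phi i x))"
    if "lin_sys f N gs A" "i < m" for N gs A i
    using that
  proof (induction "m - i" arbitrary: N gs A i)
    case (Suc d)
    obtain N' gs' A' where s: "lin_sys f N' gs' A'" "extends N gs N' gs'"
      "(\<lambda>x. Re (phi (Suc i) x)) = (\<lambda>_. 0) \<or> has_fun N' gs' (\<lambda>x. Re (phi (Suc i) x))"
      "(\<lambda>x. Im (phi (Suc i) x)) = (\<lambda>_. 0) \<or> has_fun N' gs' (\<lambda>x. Im (phi (Suc i) x))"
    proof (cases "Suc i < m")
      case True
      have "d = m - Suc i" using Suc.hyps(2) by simp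
      from Suc.hyps(1)[OF this Suc.prems(1) True] show ?thesis using that by blast
    next
      case False
      then have "phi (Suc i) x = 0" for x by (intro nil) simp
      then show ?thesis using that[OF Suc.prems(1) extends_refl] by simp
    qed
    have "\<exists>N'' gs'' A''. lin_sys f N'' gs'' A'' \<and> extends N' gs' N'' gs'' \<and>
        has_fun N'' gs'' (\<lambda>x. Re (phi i x)) \<and> has_fun N'' gs'' (\<lambda>x. Im (phi i x))"
      by (rule lin_sys_adjoin[where G = "phi i" and H = "phi (Suc i)"],
          rule s(1), rule lam, rule phi, erule flow, rule s(3), rule s(4))
    then show ?case using s(2) extends_trans by blast
  qed simp
  then show "adjoinable f (\<lambda>x. Re (phi 0 x))" "adjoinable f (\<lambda>x. Im (phi 0 x))"
    unfolding adjoinable_def using m by blast+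
qed

text \<open>Starting system of arbitrary size; it secures the lower bound on the dimension.\<close>

lemma lin_sys_zero: "lin_sys f N (\<lambda>_ _. 0) (\<lambda>i j. if i = j then - 1 else 0)"
proof -
  have "Re lam < 0" if "i < N" "v i \<noteq> 0"
    "\<forall>i<N. (\<Sum>j<N. complex_of_real (if i = j then - 1 else 0) * v j) = lam * v i" for lam v i
  proof -
    have "(\<Sum>j<N. complex_of_real (if i = j then - 1 else 0) * v j) = (\<Sum>j<N. if i = j then - v j else 0)"
      by (intro sum.cong) auto
    then have "- v i = lam * v i" using that(1,3) by simp
    then have "lam = - 1" using that(2) by (metis mult_cancel_right mult_minus1)
    then show ?thesis by simp
  qed
  then have "hurwitz N (\<lambda>i j. if i = j then - 1 else 0)" unfolding hurwitz_def by blast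
  moreover have "D v = 0" if "((\<lambda>_. 0) has_derivative D) (at x)" for D :: "'a \<Rightarrow> real" and x v
    using has_derivative_unique[OF that has_derivative_const] by simp
  ultimately show ?thesis by (auto simp: lin_sys_def)
qed

lemma adjoin_finite:
  assumes "finite \<G>" "\<And>g. g \<in> \<G> \<Longrightarrow> adjoinable f g"
  shows "\<exists>N gs A. lin_sys f N gs A \<and> n \<le> N \<and> (\<forall>g\<in>\<G>. has_fun N gs g)"
  using assms
proof (induction \<G> rule: finite_induct)
  case empty
  show ?case using lin_sys_zero by blast
next
  case (insert g \<G>)
  then obtain N gs A where N: "lin_sys f N gs A" "n \<le> N" "\<forall>g\<in>\<G>. has_fun N gs g" by auto
  obtain N' gs' A' where "lin_sys f N' gs' A'" "extends N gs N' gs'" "has_fun N' gs' g"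
    using insert.prems[of g] N(1) unfolding adjoinable_def by blast
  moreover from this have "n \<le> N'" using N(2) by (simp add: extends_def)
  ultimately show ?case using N(3) has_fun_extends by blast
qed

section \<open>Observables of the contracting flow\<close>

context contracting_flow begin

text \<open>The contraction inequality at t x, divided by t^2; the quadratic remainder of
  \<open>f\<close> then contributes a term of order t, which the choice of t keeps below e.\<close>

lemma linearization_contracting: "x \<bullet> P (f' 0 x) \<le> - r * (x \<bullet> P x)"
proof (rule field_le_epsilon)
  fix e :: real assume e: "0 < e"
  obtain C where C: "0 < C" "\<And>x y. x \<in> cball 0 R0 \<Longrightarrow> y \<in> cball 0 R0 \<Longrightarrow>
    norm (f x - f y - f' y (x - y)) \<le> C * norm (x - y)^2" using f_taylor by blast
  define K where "K = q * (norm x * (C * (norm x)\<^sup>2))"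
  have K: "0 \<le> K" using q_pos C by (simp add: K_def)
  define t where "t = min 1 (min (c / (V x + 1)) (e / (K + 1)))"
  have t: "0 < t" "t \<le> 1" using c_pos e K V_nonneg[of x] by (auto simp: t_def add_nonneg_pos)
  have "t \<le> c / (V x + 1)" "t \<le> e / (K + 1)" by (auto simp: t_def)
  then have tV: "t * (V x + 1) \<le> c" and tK: "t * (K + 1) \<le> e"
    using V_nonneg[of x] K by (auto simp: pos_le_divide_eq add_nonneg_pos)
  have "V (t *\<^sub>R x) = t * (t * V x)" by (simp add: V_def blinfun.scaleR_right)
  also have "\<dots> \<le> 1 * (t * V x)" using t V_nonneg[of x] by (intro mult_right_mono) auto
  also have "\<dots> \<le> c" using tV t by (simp add: algebra_simps)
  finally have Vt: "V (t *\<^sub>R x) < 4 * c" using c_pos by simp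
  define w where "w = f (t *\<^sub>R x) - f' 0 (t *\<^sub>R x)"
  have w: "norm w \<le> C * (t * norm x)\<^sup>2"
    using C(2)[of "t *\<^sub>R x" 0] in_cball[of "t *\<^sub>R x"] in_cball[of 0] Vt c_pos t by (simp add: w_def f_0)
  have "t *\<^sub>R x \<bullet> P (f (t *\<^sub>R x)) \<le> - r * V (t *\<^sub>R x)"
    using contracting[of "t *\<^sub>R x" 0] Vt c_pos by (simp add: V_def f_0)
  moreover have "f (t *\<^sub>R x) = t *\<^sub>R f' 0 x + w" by (simp add: w_def blinfun.scaleR_right)
  ultimately have "t * (t * (x \<bullet> P (f' 0 x)) + x \<bullet> P w) \<le> t * (- r * (t * V x))"
    by (simp add: V_def blinfun.scaleR_right blinfun.add_right inner_add_right algebra_simps)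
  then have 1: "t * (x \<bullet> P (f' 0 x)) + x \<bullet> P w \<le> - r * (t * V x)" using t(1) by (simp only: mult_le_cancel_left_pos)
  have "\<bar>x \<bullet> P w\<bar> \<le> q * (norm x * (C * (t * norm x)\<^sup>2))"
    using q_pos by (intro order_trans[OF inner_P_le] mult_left_mono w) auto
  also have "\<dots> = t * (t * K)" by (simp add: K_def power2_eq_square)
  also have "\<dots> \<le> t * e" using tK t by (intro mult_left_mono) (auto simp: algebra_simps)
  finally have "t * (x \<bullet> P (f' 0 x)) \<le> t * (- r * V x + e)" using 1 by (simp add: algebra_simps)
  then show "x \<bullet> P (f' 0 x) \<le> - r * (x \<bullet> P x) + e" using t(1) by (simp add: V_def)
qed

lemma smaller_region:
  assumes "0 < d" "d \<le> c"
  shows "contracting_flow f f' X P p r d"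
proof unfold_locales
  show "(x - y) \<bullet> P (f x - f y) \<le> - r * ((x - y) \<bullet> P (x - y))" if "x \<bullet> P x < 4 * d" "y \<bullet> P y < 4 * d" for x y
    using contracting[of x y] that assms by simp
qed (use f_0 P_sym p_pos P_ge r_pos assms attracting in auto)

text \<open>Fixes the parameters of the cutoff construction. The section level is chosen for this
  functional alone, which is harmless because only \<open>phi\<close> leaves the lemma.\<close>

lemma generalized_eigenfunction:
  assumes u: "linear u" and nil: "(nshift (f' 0) lam ^^ m) u = (\<lambda>_. 0)" and nz: "u \<noteq> (\<lambda>_. 0)"
  obtains phi where "\<And>i x. phi i differentiable at x" "(phi 0 has_derivative u) (at 0)"
    "\<And>i x D. (phi i has_derivative D) (at x) \<Longrightarrow> D (f x) = lam * phi i x + phi (Suc i) x"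
    "\<And>i x. m \<le> i \<Longrightarrow> phi i x = 0" "Re lam < 0"
proof -
  have Re: "Re lam < 0"
    by (rule generalized_eigenvalue_Re_neg[OF linear_f'0 u P_sym p_pos P_ge r_pos linearization_contracting nil nz])
  obtain L :: "real set" where L: "finite L"
    "\<And>s. s \<notin> L \<Longrightarrow> \<exists>Q Q'. quad Q Q' \<and> (\<forall>x. (norm x)\<^sup>2 \<le> Q' x (f' 0 x + s *\<^sub>R x))"
    using hyperbolic_quad[OF linear_f'0] by blast
  \<comment> \<open>The admissible interval for \<open>sig\<close> is open and nonempty, hence
    infinite, and so not contained in the finite exceptional set.\<close>
  have "max 0 (- Re lam - r) < - Re lam" using Re r_pos by auto
  then have "infinite {max 0 (- Re lam - r) <..< - Re lam}" by (rule infinite_Ioo)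
  then have "\<not> {max 0 (- Re lam - r) <..< - Re lam} \<subseteq> L" using L(1) finite_subset by blast
  then obtain sig where "sig \<in> {max 0 (- Re lam - r) <..< - Re lam}" "sig \<notin> L" by blast
  then have sig: "0 < sig" "- Re lam - r < sig" "sig < - Re lam" "sig \<notin> L" by auto
  obtain Q Q' where Q: "quad Q Q'" "\<And>x. (norm x)\<^sup>2 \<le> Q' x (f' 0 x + sig *\<^sub>R x)" using L(2)[OF sig(4)] by blast
  define eps where "eps = min (sig + r + Re lam) (- Re lam - sig) / 2"
  have eps: "0 < eps" "eps < sig + r + Re lam" "eps < - Re lam - sig" using sig by (auto simp: eps_def min_def)
  obtain K0 where K0: "\<And>x h. \<bar>Q' x h\<bar> \<le> K0 * norm x * norm h" using Q(1) unfolding quad_def by metis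
  obtain C where C: "0 < C" "\<And>x y. x \<in> cball 0 R0 \<Longrightarrow> y \<in> cball 0 R0 \<Longrightarrow>
    norm (f x - f y - f' y (x - y)) \<le> C * norm (x - y)^2" using f_taylor by blast
  define K where "K = \<bar>K0\<bar> + 1"
  \<comment> \<open>Within radius B the nonlinear part satisfies \<open>Q'_rem\<close>, as K C B = 1
    / 2; the level d keeps the region inside this ball.\<close>
  define B where "B = 1 / (2 * K * C)"
  have K: "0 < K" by (simp add: K_def)
  have B: "0 < B" using K C by (simp add: B_def)
  define d where "d = min c (p * B\<^sup>2 / 4)"
  have d: "0 < d" "d \<le> c" using c_pos p_pos B by (auto simp: d_def)
  interpret D: contracting_flow f f' X P p r d by (rule smaller_region[OF d])
  interpret eigen_flow f f' X P p r d lam m u Q Q' sig eps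
  proof unfold_locales
    fix x assume "D.V x < 4 * d"
    then have x: "V x < 4 * d" by (simp add: V_def D.V_def)
    then have "V x \<le> p * B\<^sup>2" by (simp add: d_def)
    then have "p * (norm x)\<^sup>2 \<le> p * B\<^sup>2" using V_ge[of x] by linarith
    then have "(norm x)\<^sup>2 \<le> B\<^sup>2" using p_pos by simp
    then have nx: "norm x \<le> B" by (rule power2_le_imp_le) (use B in simp)
    have "norm (f x - f' 0 x) \<le> C * (norm x)\<^sup>2"
      using C(2)[of x 0] in_cball[of x] in_cball[of 0] x d c_pos by (simp add: f_0)
    also have "\<dots> \<le> C * (B * norm x)" unfolding power2_eq_square using C nx by (intro mult_left_mono mult_right_mono) auto
    finally have n: "norm (f x - f' 0 x) \<le> C * (B * norm x)" .
    have "\<bar>Q' x (f x - f' 0 x)\<bar> \<le> K0 * norm x * norm (f x - f' 0 x)" by (rule K0)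
    also have "\<dots> \<le> K * norm x * (C * (B * norm x))"
      using K C B by (intro mult_mono n) (auto simp: K_def)
    also have "\<dots> = (K * C * B) * (norm x)\<^sup>2" by (simp add: power2_eq_square)
    also have "K * C * B = 1 / 2" using K C by (simp add: B_def)
    finally show "\<bar>Q' x (f x - f' 0 x)\<bar> \<le> 1 / 2 * (norm x)\<^sup>2" .
  qed (use u nil sig eps Q linear_add[OF u] linear_scale[OF u] in auto)
  obtain phi where phi: "\<And>i x. phi i differentiable at x" "\<And>i. (phi i has_derivative a i) (at 0)"
    "\<And>i x D. (phi i has_derivative D) (at x) \<Longrightarrow> D (f x) = lam * phi i x + phi (Suc i) x"
    "\<And>i x. m \<le> i \<Longrightarrow> phi i x = 0" using phi_exists by metis
  have "a 0 = u" by (simp add: a_def)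
  then have "(phi 0 has_derivative u) (at 0)" using phi(2)[of 0] by simp
  then show ?thesis using that phi Re by blast
qed

text \<open>Collects real and imaginary parts of the eigenfunctions of all summands; if their
  derivatives at 0 kill h, then so does each summand.\<close>

lemma gsum_adjoinable:
  assumes "gsum (f' 0) u"
  shows "\<exists>\<G>. finite \<G> \<and> (\<forall>g\<in>\<G>. adjoinable f g) \<and>
    (\<forall>h. (\<forall>g\<in>\<G>. \<forall>D. (g has_derivative D) (at 0) \<longrightarrow> D h = 0) \<longrightarrow> u h = 0)"
  using assms
proof (induction rule: gsum.induct)
  case zero
  then show ?case by (intro exI[of _ "{}"]) simp
next
  case (add u lam m v)
  then obtain \<G> where G: "finite \<G>" "\<forall>g\<in>\<G>. adjoinable f g"
    "\<And>h. (\<forall>g\<in>\<G>. \<forall>D. (g has_derivative D) (at 0) \<longrightarrow> D h = 0) \<Longrightarrow> v h = 0" by blast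
  show ?case
  proof (cases "u = (\<lambda>_. 0)")
    case True
    then show ?thesis using G by (intro exI[of _ \<G>]) auto
  next
    case False
    obtain phi where phi: "\<And>i x. phi i differentiable at x" "(phi 0 has_derivative u) (at 0)"
      "\<And>i x D. (phi i has_derivative D) (at x) \<Longrightarrow> D (f x) = lam * phi i x + phi (Suc i) x"
      "\<And>i x. m \<le> i \<Longrightarrow> phi i x = 0" "Re lam < 0"
      using generalized_eigenfunction[OF add(1,2) False] by blast
    have m: "0 < m" using add(2) False by (cases m) auto
    let ?g = "\<lambda>x. Re (phi 0 x)" and ?h = "\<lambda>x. Im (phi 0 x)"
    have adj: "adjoinable f ?g" "adjoinable f ?h"
      by (rule adjoinable_chain[where phi = phi], rule phi(5), rule phi(1), erule phi(3), erule phi(4), rule m)+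
    have der: "(?g has_derivative (\<lambda>x. Re (u x))) (at 0)" "(?h has_derivative (\<lambda>x. Im (u x))) (at 0)"
      using bounded_linear.has_derivative[OF bounded_linear_Re phi(2)]
        bounded_linear.has_derivative[OF bounded_linear_Im phi(2)] by auto
    show ?thesis
    proof (intro exI[of _ "insert ?g (insert ?h \<G>)"] conjI allI impI)
      fix h assume h: "\<forall>g\<in>insert ?g (insert ?h \<G>). \<forall>D. (g has_derivative D) (at 0) \<longrightarrow> D h = 0"
      then have "Re (u h) = 0" "Im (u h) = 0" using der by blast+
      moreover have "v h = 0" using h by (intro G(3)) auto
      ultimately show "u h + v h = 0" by (simp add: complex_eq_iff)
    qed (use G adj in auto)
  qed
qed

definition decay_fun :: "real \<Rightarrow> ('a \<Rightarrow> real) \<Rightarrow> 'a \<Rightarrow> real" where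
  "decay_fun K w x = (if x = 0 then 0 else exp (- K * tau x) * w (base x))"

lemma decay_fun_deriv:
  assumes w: "bounded_linear w'" and x: "x \<noteq> 0"
    and Dt: "(tau has_derivative Dt) (at x)" and Db: "(base has_derivative Db) (at x)"
  shows "(decay_fun K (\<lambda>z. w' z + e) has_derivative
    (\<lambda>h. exp (- K * tau x) * w' (Db h) - K * Dt h * exp (- K * tau x) * (w' (base x) + e))) (at x)"
proof -
  have ex: "((\<lambda>z. exp (- K * tau z)) has_derivative (\<lambda>h. exp (- K * tau x) * (- K * Dt h))) (at x)"
    by (rule has_derivative_eq_rhs[OF has_derivative_exp[OF has_derivative_mult_right[OF Dt, of "- K"]]])
       (simp add: fun_eq_iff)
  have wd: "((\<lambda>z. w' (base z) + e) has_derivative (\<lambda>h. w' (Db h))) (at x)"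
    using has_derivative_add_const[OF bounded_linear.has_derivative[OF w Db]] .
  have d: "((\<lambda>z. exp (- K * tau z) * (w' (base z) + e)) has_derivative
      (\<lambda>h. exp (- K * tau x) * w' (Db h) - K * Dt h * exp (- K * tau x) * (w' (base x) + e))) (at x)"
    by (rule has_derivative_eq_rhs[OF has_derivative_mult[OF ex wd]]) (simp add: fun_eq_iff algebra_simps)
  show ?thesis
    by (rule has_derivative_transform_within_open[OF d, of "- {0}"]) (use x in \<open>auto simp: decay_fun_def\<close>)
qed

text \<open>With K = 2 L, exp (- K tau x) is at most a multiple of |x|^2 near 0, which gives
  differentiability at 0 with derivative 0. Along the flow the function is scaled by exp (- K
  t).\<close>

lemma decay_fun_adjoinable:
  obtains K where "0 < K" "\<And>w' e. bounded_linear w' \<Longrightarrow> adjoinable f (decay_fun K (\<lambda>z. w' z + e))"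
proof -
  obtain L k where L: "0 < L" "0 < k"
    "\<And>x. x \<noteq> 0 \<Longrightarrow> V x < c \<Longrightarrow> 0 < tau x \<and> k * exp (- L * tau x) \<le> norm x" using norm_ge_tau by metis
  define K where "K = 2 * L"
  have K: "0 < K" using L by (simp add: K_def)
  have "adjoinable f (decay_fun K (\<lambda>z. w' z + e))" if w: "bounded_linear w'" for w' e
  proof -
    define g where "g = decay_fun K (\<lambda>z. w' z + e)"
    obtain B where B: "0 < B" "\<And>z. \<bar>w' z\<bar> \<le> norm z * B" using bounded_linear.pos_bounded[OF w] by auto
    have zero: "(g has_derivative (\<lambda>_. 0)) (at 0)"
    proof (rule quadratic_error_imp_has_derivative)
      show "0 < sqrt (c / q)" using c_pos q_pos by simp
      fix x :: 'a assume x: "norm (x - 0) < sqrt (c / q)"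
      show "norm (g x - g 0 - 0) \<le> ((R0 * B + \<bar>e\<bar>) / k\<^sup>2) * (norm (x - 0))\<^sup>2"
      proof (cases "x = 0")
        case False
        have "(norm x)\<^sup>2 < (sqrt (c / q))\<^sup>2" using x by (intro power_strict_mono) auto
        then have "q * (norm x)\<^sup>2 < c" using c_pos q_pos by (simp add: field_simps)
        then have V: "V x < c" using V_le[of x] by linarith
        have "(k * exp (- L * tau x))\<^sup>2 \<le> (norm x)\<^sup>2" using L(3)[OF False V] L(2) by (intro power_mono) auto
        then have "k\<^sup>2 * exp (- K * tau x) \<le> (norm x)\<^sup>2"
          by (simp add: power_mult_distrib K_def mult.assoc flip: exp_double)
        then have 1: "exp (- K * tau x) \<le> (norm x)\<^sup>2 / k\<^sup>2" using L(2) by (simp add: field_simps)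
        have "norm (base x) \<le> R0" using in_cball[of "base x"] V_base[OF False] c_pos by simp
        then have "norm (base x) * B \<le> R0 * B" using B by (intro mult_right_mono) auto
        then have 2: "\<bar>w' (base x) + e\<bar> \<le> R0 * B + \<bar>e\<bar>" using B(2)[of "base x"] by linarith
        have "norm (g x) = exp (- K * tau x) * \<bar>w' (base x) + e\<bar>" using False by (simp add: g_def decay_fun_def abs_mult)
        also have "\<dots> \<le> (norm x)\<^sup>2 / k\<^sup>2 * (R0 * B + \<bar>e\<bar>)" by (intro mult_mono 1 2) auto
        finally show ?thesis by (simp add: g_def decay_fun_def mult.commute)
      qed (simp add: g_def decay_fun_def)
    qed (rule bounded_linear_zero)
    have diff: "g differentiable at x" for x
    proof (cases "x = 0")
      case True then show ?thesis using differentiableI[OF zero] by simp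
    next
      case False
      obtain Dt Db where "(tau has_derivative Dt) (at x)" "(base has_derivative Db) (at x)"
        using tau_base_derivative[OF False] by metis
      from decay_fun_deriv[OF w False this] show ?thesis unfolding g_def by (rule differentiableI)
    qed
    have flow: "D (f x) = - K * g x" if D: "(g has_derivative D) (at x)" for D x
    proof (cases "x = 0")
      case True
      then show ?thesis using linear_0[OF has_derivative_linear[OF D]] by (simp add: f_0 g_def decay_fun_def)
    next
      case False
      have "((\<lambda>t. exp (- K * (tau x + t)) * (w' (base x) + e)) has_vector_derivative
          - K * g x) (at 0 within {0..1})"
        unfolding has_real_derivative_iff_has_vector_derivative[symmetric]
        using False by (auto intro!: derivative_eq_intros simp: g_def decay_fun_def)
      from derivative_along_flow[OF D _ this] show ?thesis
        using False X_nonzero by (simp add: g_def decay_fun_def base_tau_X)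
    qed
    have cdiff: "(\<lambda>x. complex_of_real (g x)) differentiable at x" for x
      using diff[of x] bounded_linear.has_derivative[OF bounded_linear_of_real] unfolding differentiable_def by blast
    have cflow: "D (f x) = complex_of_real (- K) * complex_of_real (g x) + 0"
      if D: "((\<lambda>x. complex_of_real (g x)) has_derivative D) (at x)" for D x
    proof -
      obtain D' where D': "(g has_derivative D') (at x)" using diff[of x] by (auto simp: differentiable_def)
      have "D = (\<lambda>h. complex_of_real (D' h))"
        by (rule has_derivative_unique[OF D bounded_linear.has_derivative[OF bounded_linear_of_real D']])
      then show ?thesis using flow[OF D'] by simp
    qed
    have "adjoinable f g" unfolding adjoinable_def
    proof (intro allI impI)
      fix N gs A assume sys: "lin_sys f N gs A"
      have "\<exists>N' gs' A'. lin_sys f N' gs' A' \<and> extends N gs N' gs' \<and>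
          has_fun N' gs' (\<lambda>x. Re (complex_of_real (g x))) \<and> has_fun N' gs' (\<lambda>x. Im (complex_of_real (g x)))"
        by (rule lin_sys_adjoin[where G = "\<lambda>x. complex_of_real (g x)" and H = "\<lambda>_. 0" and lam = "complex_of_real (- K)"],
            rule sys, use K in simp, rule cdiff, erule cflow) auto
      then show "\<exists>N' gs' A'. lin_sys f N' gs' A' \<and> extends N gs N' gs' \<and> has_fun N' gs' g" by auto
    qed
    then show ?thesis by (simp add: g_def)
  qed
  then show ?thesis using that K by blast
qed

text \<open>Off 0 the constant weight detects \<open>Dt h\<close>, and once this vanishes the
  coordinate weights detect \<open>Db h\<close>. At 0 the eigenfunctions of the coordinate
  functionals take over.\<close>

lemma koopman_embedding:
  "\<exists>N gs A. lin_sys f N gs A \<and> n \<le> N \<and>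
    (\<forall>x h. (\<forall>i<N. \<forall>D. (gs i has_derivative D) (at x) \<longrightarrow> D h = 0) \<longrightarrow> h = 0)"
proof -
  obtain K where K: "0 < K" "\<And>w' e. bounded_linear w' \<Longrightarrow> adjoinable f (decay_fun K (\<lambda>z. w' z + e))"
    using decay_fun_adjoinable by metis
  have "\<forall>b. \<exists>\<G>. finite \<G> \<and> (\<forall>g\<in>\<G>. adjoinable f g) \<and>
    (\<forall>h. (\<forall>g\<in>\<G>. \<forall>D. (g has_derivative D) (at 0) \<longrightarrow> D h = 0) \<longrightarrow> complex_of_real (b \<bullet> h) = 0)"
    using gsum_adjoinable[OF gsum_coordinate[OF linear_f'0]] by blast
  then obtain GG where GG: "\<And>b. finite (GG b)" "\<And>b g. g \<in> GG b \<Longrightarrow> adjoinable f g"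
    "\<And>b h. (\<forall>g\<in>GG b. \<forall>D. (g has_derivative D) (at 0) \<longrightarrow> D h = 0) \<Longrightarrow> complex_of_real (b \<bullet> h) = 0"
    by metis
  let ?one = "decay_fun K (\<lambda>z. 0 + 1)" and ?co = "\<lambda>b. decay_fun K (\<lambda>z. z \<bullet> b + 0)"
  define \<G> where "\<G> = insert ?one (?co ` Basis) \<union> (\<Union>b\<in>Basis. GG b)"
  have "finite \<G>" by (simp add: \<G>_def GG(1))
  moreover have "adjoinable f g" if "g \<in> \<G>" for g
    using that K(2)[of "\<lambda>_. 0" 1] K(2)[OF bounded_linear_inner_left, of _ 0] GG(2) by (auto simp: \<G>_def bounded_linear_zero)
  ultimately have "\<exists>N gs A. lin_sys f N gs A \<and> n \<le> N \<and> (\<forall>g\<in>\<G>. has_fun N gs g)"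
    by (rule adjoin_finite)
  then obtain N gs A where N: "lin_sys f N gs A" "n \<le> N" "\<forall>g\<in>\<G>. has_fun N gs g" by blast
  have "h = 0" if h: "\<forall>i<N. \<forall>D. (gs i has_derivative D) (at x) \<longrightarrow> D h = 0" for x h
  proof -
    have h': "D h = 0" if "g \<in> \<G>" "(g has_derivative D) (at x)" for g D
      using that h N(3) unfolding has_fun_def by metis
    show ?thesis
    proof (cases "x = 0")
      case True
      have bh: "h \<bullet> b = 0" if "b \<in> Basis" for b
      proof -
        have "complex_of_real (b \<bullet> h) = 0"
        proof (rule GG(3), intro ballI allI impI)
          fix g D assume g: "g \<in> GG b" and D: "(g has_derivative D) (at 0)"
          have "g \<in> \<G>" using g that by (auto simp: \<G>_def)
          then show "D h = 0" by (rule h') (use D True in simp)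
        qed
        then show ?thesis by (simp add: inner_commute)
      qed
      show ?thesis by (rule euclidean_eqI) (simp add: bh)
    next
      case False
      obtain Dt Db where D: "(tau has_derivative Dt) (at x)" "(base has_derivative Db) (at x)"
        "\<And>h. Dt h = 0 \<Longrightarrow> Db h = 0 \<Longrightarrow> h = 0"
        using tau_base_derivative[OF False] by metis
      have "exp (- K * tau x) * 0 - K * Dt h * exp (- K * tau x) * (0 + 1) = 0"
        by (rule h'[OF _ decay_fun_deriv[OF bounded_linear_zero False D(1,2)]]) (simp add: \<G>_def)
      then have t: "Dt h = 0" using K by simp
      have bh: "Db h \<bullet> b = 0" if "b \<in> Basis" for b
      proof -
        have "exp (- K * tau x) * (Db h \<bullet> b) - K * Dt h * exp (- K * tau x) * (base x \<bullet> b + 0) = 0"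
          by (rule h'[OF _ decay_fun_deriv[OF bounded_linear_inner_left False D(1,2)]]) (use that in \<open>auto simp: \<G>_def\<close>)
        then show ?thesis using t by simp
      qed
      have "Db h = 0" by (rule euclidean_eqI) (simp add: bh)
      then show ?thesis using D(3) t by blast
    qed
  qed
  then show ?thesis using N(1,2) by blast
qed

end

section \<open>The theorem\<close>

lemma C2_derivative_lipschitz:
  fixes f' :: "'a::euclidean_space \<Rightarrow> 'b::real_normed_vector"
  assumes der: "\<And>x. (f' has_derivative blinfun_apply (f'' x)) (at x)" and cont: "continuous_on UNIV f''"
  shows "\<exists>L. \<forall>x\<in>cball 0 R. \<forall>y\<in>cball 0 R. norm (f' x - f' y) \<le> L * norm (x - y)"
proof -
  have "compact (f'' ` cball 0 R)"
    by (intro compact_continuous_image continuous_on_subset[OF cont]) auto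
  then obtain L where L: "\<forall>z\<in>f'' ` cball 0 R. norm z \<le> L" using compact_imp_bounded bounded_iff by metis
  have "norm (f' x - f' y) \<le> L * norm (x - y)" if "x \<in> cball 0 R" "y \<in> cball 0 R" for x y
    by (rule differentiable_bound[OF convex_cball has_derivative_at_withinI[OF der] _ that])
      (use L in \<open>simp add: norm_blinfun.rep_eq[symmetric]\<close>)
  then show ?thesis by blast
qed

context smooth_flow begin

text \<open>On a small ball the nonlinear part, measured in the form, has Lipschitz constant at most
  r, so the rate 2 r of the linearization leaves r for the field itself.\<close>

lemma local_contraction_exists:
  fixes P :: "'a \<Rightarrow>\<^sub>L 'a"
  assumes f0: "f 0 = 0" and P_sym: "\<And>x y. x \<bullet> P y = y \<bullet> P x"
    and p: "0 < p" "\<And>x. p * (norm x)\<^sup>2 \<le> x \<bullet> P x" and r: "0 < r"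
    and lin: "\<And>x. x \<bullet> P (f' 0 x) \<le> - (2 * r) * (x \<bullet> P x)"
  obtains c where "local_contraction f f' X P p r c"
proof -
  obtain C where C: "0 < C" "\<And>x y. x \<in> cball 0 1 \<Longrightarrow> y \<in> cball 0 1 \<Longrightarrow>
    norm ((f x - f' 0 x) - (f y - f' 0 y)) \<le> C * (norm x + norm y) * norm (x - y)" using remainder_lip_ball[of 1] by auto
  define K where "K = (norm P + 1) * (2 * C) / p"
  have K: "0 < K" using C p by (simp add: K_def add_nonneg_pos)
  define d where "d = min 1 (r / K)"
  have d: "0 < d" "d \<le> 1" "K * d \<le> r" using r K by (auto simp: d_def min_def field_simps)
  have contr: "(x - y) \<bullet> P (f x - f y) \<le> - r * ((x - y) \<bullet> P (x - y))" if xy: "norm x \<le> d" "norm y \<le> d" for x y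
  proof -
    define z where "z = x - y"
    define w where "w = (f x - f' 0 x) - (f y - f' 0 y)"
    have "norm w \<le> C * (norm x + norm y) * norm z" unfolding w_def z_def using xy d by (intro C) auto
    also have "\<dots> \<le> C * (2 * d) * norm z" using xy C by (intro mult_right_mono mult_left_mono) auto
    finally have w: "norm w \<le> 2 * C * d * norm z" by simp
    have "z \<bullet> P w \<le> norm z * norm (P w)" by (rule norm_cauchy_schwarz)
    also have "\<dots> \<le> norm z * (norm P * norm w)" by (intro mult_left_mono norm_blinfun) auto
    also have "\<dots> \<le> norm z * ((norm P + 1) * (2 * C * d * norm z))" by (intro mult_left_mono mult_mono w) auto
    also have "\<dots> = (K * d) * (p * (norm z)\<^sup>2)" using p by (simp add: K_def power2_eq_square)
    also have "\<dots> \<le> r * (z \<bullet> P z)" using d p r by (intro mult_mono) auto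
    finally have "z \<bullet> P w \<le> r * (z \<bullet> P z)" .
    moreover have "f x - f y = f' 0 z + w" by (simp add: w_def z_def blinfun.diff_right)
    ultimately show ?thesis using lin[of z] unfolding z_def[symmetric]
      by (simp add: blinfun.add_right inner_add_right)
  qed
  have "local_contraction f f' X P p r (p * d\<^sup>2 / 4)"
  proof unfold_locales
    have n: "norm x \<le> d" if "x \<bullet> P x < 4 * (p * d\<^sup>2 / 4)" for x
    proof -
      have "p * (norm x)\<^sup>2 \<le> p * d\<^sup>2" using p(2)[of x] that by simp
      then have "(norm x)\<^sup>2 \<le> d\<^sup>2" using p(1) by simp
      then show ?thesis by (rule power2_le_imp_le) (use d in simp)
    qed
    show "(x - y) \<bullet> P (f x - f y) \<le> - r * ((x - y) \<bullet> P (x - y))"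
      if "x \<bullet> P x < 4 * (p * d\<^sup>2 / 4)" "y \<bullet> P y < 4 * (p * d\<^sup>2 / 4)" for x y
      using contr n that by blast
  qed (use f0 P_sym p r d in auto)
  then show ?thesis by (rule that)
qed

end

lemma bounded_bilinear_matrix_vector_mult: "bounded_bilinear ((*v) :: real^'n^'m \<Rightarrow> real^'n \<Rightarrow> real^'m)"
  unfolding bilinear_conv_bounded_bilinear[symmetric] bilinear_def
  by (auto intro!: linearI simp: matrix_vector_mult_add_rdistrib matrix_vector_right_distrib
      scaleR_matrix_vector_assoc[symmetric] matrix_vector_mult_scaleR)

text \<open>\<open>N\<close> is found in the proof, so the target space is not a type; vectors and
  matrices over it are functions on natural numbers, read below \<open>N\<close>. The vectors
  \<open>D\<phi> x i\<close> are the rows of the Jacobian.\<close>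

theorem theorem2:
  fixes f :: "real^'n \<Rightarrow> real^'n"
    and F :: "real^'n \<Rightarrow> real^'n^'n"
    and M :: "real^'n \<Rightarrow> real^'n^'n"
    and DM :: "real^'n \<Rightarrow> real^'n \<Rightarrow> real^'n^'n"
    and a1 a2 \<rho> :: real
  assumes f_C2: "C2 f"
    and fc: "forward_complete f"
    and F_jac: "\<And>x. (f has_derivative (\<lambda>v. F x *v v)) (at x)"
    and M_diff: "\<And>x. (M has_derivative DM x) (at x)"
    and M_sym: "\<And>x. transpose (M x) = M x"
    and a_pos: "0 < a1" and a_le: "a1 \<le> a2"
    and M_lower: "\<And>x. loewner_le (a1 *\<^sub>R mat 1) (M x)"
    and M_upper: "\<And>x. loewner_le (M x) (a2 *\<^sub>R mat 1)"
    and rho_pos: "0 < \<rho>"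
    and contr: "\<And>x. loewner_le (DM x (f x) + transpose (F x) ** M x + M x ** F x)
                                 (- \<rho> *\<^sub>R M x)"
  shows "\<exists>(N::nat) (\<phi>::real^'n \<Rightarrow> nat \<Rightarrow> real) (D\<phi>::real^'n \<Rightarrow> nat \<Rightarrow> real^'n)
            (A::nat \<Rightarrow> nat \<Rightarrow> real).
           N \<ge> CARD('n) \<and> hurwitz N A \<and>
           (\<forall>x. \<forall>i<N. ((\<lambda>y. \<phi> y i) has_derivative (\<lambda>v. D\<phi> x i \<bullet> v)) (at x)) \<and>
           (\<forall>x. \<forall>c::real^'n. (\<forall>i<N. (\<Sum>j\<in>UNIV. (D\<phi> x i $ j) * (c $ j)) = 0) \<longrightarrow> c = 0) \<and>
           (\<forall>x. \<forall>i<N. D\<phi> x i \<bullet> f x = (\<Sum>j<N. A i j * \<phi> x j))"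
proof -
  obtain f' :: "real^'n \<Rightarrow> ((real^'n) \<Rightarrow>\<^sub>L (real^'n))" and f'' where
    f': "\<And>x. (f has_derivative blinfun_apply (f' x)) (at x)"
    and f'': "\<And>x. (f' has_derivative blinfun_apply (f'' x)) (at x)" "continuous_on UNIV f''"
    using f_C2 unfolding C2_def by blast
  have Ff': "F x *v v = f' x v" for x v
    using has_derivative_unique[OF F_jac[of x] f'[of x]] by (rule fun_cong)
  have "\<forall>x0. \<exists>s. s 0 = x0 \<and> is_solution f s" using fc unfolding forward_complete_def by blast
  then obtain X where X: "\<And>x. X x 0 = x" "\<And>x. is_solution f (X x)" by metis
  interpret smooth_flow f f' X
    by unfold_locales (use f' X C2_derivative_lipschitz[OF f''] in \<open>auto simp: is_solution_def\<close>)
  have M_ge: "a1 * (norm v)\<^sup>2 \<le> v \<bullet> (M x *v v)" and M_le: "v \<bullet> (M x *v v) \<le> a2 * (norm v)\<^sup>2" for x v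
    using M_lower[of x] M_upper[of x] unfolding loewner_le_def power2_norm_eq_inner
    by (auto simp: scaleR_matrix_vector_assoc[symmetric])
  have quad_contr: "(DM x (f x) *v v) \<bullet> v + 2 * ((M x *v v) \<bullet> (F x *v v)) \<le> - \<rho> * (v \<bullet> (M x *v v))" for x v
  proof -
    have sym: "(M x *v w) \<bullet> v = w \<bullet> (M x *v v)" for w
      using dot_lmul_matrix[of w "transpose (M x)" v] M_sym[of x] by (metis transpose_matrix_vector)
    have "v \<bullet> ((DM x (f x) + transpose (F x) ** M x + M x ** F x) *v v) \<le> v \<bullet> ((- \<rho> *\<^sub>R M x) *v v)"
      using contr[of x] unfolding loewner_le_def by blast
    moreover have "(- \<rho> *\<^sub>R M x) *v v = - \<rho> *\<^sub>R (M x *v v)" by (rule scaleR_matrix_vector_assoc[symmetric])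
    moreover have "v \<bullet> ((transpose (F x) ** M x) *v v) = (M x *v v) \<bullet> (F x *v v)"
      using dot_lmul_matrix[of "M x *v v" "F x" v]
      by (simp add: matrix_vector_mul_assoc[symmetric] inner_commute)
    moreover have "v \<bullet> ((M x ** F x) *v v) = (M x *v v) \<bullet> (F x *v v)"
      using sym[of "F x *v v"] by (simp add: matrix_vector_mul_assoc[symmetric] inner_commute)
    ultimately show ?thesis
      by (simp add: matrix_vector_mult_add_rdistrib inner_add_right scaleR_matrix_vector_assoc[symmetric] inner_commute)
  qed
  have M_inner: "v \<bullet> (M x *v w) = w \<bullet> (M x *v v)" for x v w
    using dot_lmul_matrix[of v "transpose (M x)" w] M_sym[of x] by (metis transpose_matrix_vector inner_commute)
  have limit: "\<exists>e. f e = 0 \<and> (X x \<longlongrightarrow> e) at_top" for x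
  proof -
    \<comment> \<open>Along a trajectory, \<open>f\<close> solves the variational equation, so its
      squared length in the metric M obeys the contraction inequality.\<close>
    define w where "w t = f (X x t) \<bullet> (M (X x t) *v f (X x t))" for t
    have fX: "((\<lambda>t. f (X x t)) has_vector_derivative F (X x t) *v f (X x t)) (at t within {0..})" if "0 \<le> t" for t
      using has_derivative_compose[of "X x" _ t "{0..}" f, OF X_der[OF that, unfolded has_vector_derivative_def] F_jac]
      unfolding has_vector_derivative_def by (simp add: matrix_vector_mult_scaleR)
    have MX: "((\<lambda>t. M (X x t)) has_vector_derivative DM (X x t) (f (X x t))) (at t within {0..})" if "0 \<le> t" for t
      using has_derivative_compose[of "X x" _ t "{0..}" M, OF X_der[OF that, unfolded has_vector_derivative_def] M_diff]
      unfolding has_vector_derivative_def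
      using linear_scale[OF has_derivative_linear[OF M_diff]] by simp
    have wd: "(w has_real_derivative (DM (X x t) (f (X x t)) *v f (X x t)) \<bullet> f (X x t)
        + 2 * ((M (X x t) *v f (X x t)) \<bullet> (F (X x t) *v f (X x t)))) (at t within {0..})" if "0 \<le> t" for t
      unfolding w_def[abs_def] has_real_derivative_iff_has_vector_derivative
      by (rule has_vector_derivative_eq_rhs,
          rule bounded_bilinear.has_vector_derivative[OF bounded_bilinear_inner fX[OF that]
            bounded_bilinear.has_vector_derivative[OF bounded_bilinear_matrix_vector_mult MX[OF that] fX[OF that]]])
         (simp add: inner_add_right inner_commute M_inner[of "f (X x t)" _ "F (X x t) *v f (X x t)"])
    have decay: "w t \<le> exp (- \<rho> * t) * w 0" if t: "0 \<le> t" for t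
    proof -
      have "w t \<le> exp (- \<rho> * (t - 0)) * w 0"
      proof (rule growth_le[OF t])
        show "(w has_real_derivative (DM (X x s) (f (X x s)) *v f (X x s)) \<bullet> f (X x s)
          + 2 * ((M (X x s) *v f (X x s)) \<bullet> (F (X x s) *v f (X x s)))) (at s within {0..t})" if "s \<in> {0..t}" for s
          by (rule DERIV_subset[OF wd]) (use that in auto)
        show "(DM (X x s) (f (X x s)) *v f (X x s)) \<bullet> f (X x s)
          + 2 * ((M (X x s) *v f (X x s)) \<bullet> (F (X x s) *v f (X x s))) \<le> - \<rho> * w s" for s
          unfolding w_def by (rule quad_contr)
      qed
      then show ?thesis by simp
    qed
    have "norm (f (X x t)) \<le> sqrt (w 0 / a1) * exp (- (\<rho> / 2) * t)" if "0 \<le> t" for t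
    proof (rule power2_le_imp_le)
      have w0: "0 \<le> w 0" using M_ge[of "f (X x 0)" "X x 0"] a_pos unfolding w_def
        by (meson mult_nonneg_nonneg less_imp_le order_trans zero_le_power2)
      then show "0 \<le> sqrt (w 0 / a1) * exp (- (\<rho> / 2) * t)" using a_pos by simp
      have "a1 * (norm (f (X x t)))\<^sup>2 \<le> exp (- \<rho> * t) * w 0"
        using M_ge[of "f (X x t)" "X x t"] decay[OF that] by (simp add: w_def)
      then have "(norm (f (X x t)))\<^sup>2 \<le> w 0 / a1 * exp (- \<rho> * t)" using a_pos by (simp add: field_simps)
      also have "\<dots> = (sqrt (w 0 / a1) * exp (- (\<rho> / 2) * t))\<^sup>2"
        using w0 a_pos by (simp add: power_mult_distrib flip: exp_double)
      finally show "(norm (f (X x t)))\<^sup>2 \<le> (sqrt (w 0 / a1) * exp (- (\<rho> / 2) * t))\<^sup>2" .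
    qed
    from equilibrium_limit[OF half_gt_zero[OF rho_pos] this] show ?thesis by blast
  qed
  have local: "\<exists>P p r c. local_contraction (\<lambda>x. f (x + e)) (\<lambda>x. f' (x + e)) (\<lambda>x t. X (x + e) t - e) P p r c"
    if e: "f e = 0" for e
  proof -
    define P where "P = Blinfun ((*v) (M e))"
    have P: "blinfun_apply P = (*v) (M e)" unfolding P_def by (rule bounded_linear_Blinfun_apply) simp
    interpret S: smooth_flow "\<lambda>x. f (x + e)" "\<lambda>x. f' (x + e)" "\<lambda>x t. X (x + e) t - e" by (rule shift)
    obtain c where "local_contraction (\<lambda>x. f (x + e)) (\<lambda>x. f' (x + e)) (\<lambda>x t. X (x + e) t - e) P a1 (\<rho> / 4) c"
    proof (rule S.local_contraction_exists[of P a1 "\<rho> / 4"])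
      \<comment> \<open>At an equilibrium the derivative of M along f vanishes, and the contraction
        inequality becomes a Lyapunov inequality for the constant form M e with rate \<rho> / 2,
        twice the rate \<rho> / 4 that is kept.\<close>
      have "DM e 0 = 0" using linear_0[OF has_derivative_linear[OF M_diff]] .
      then show "x \<bullet> P (f' (0 + e) x) \<le> - (2 * (\<rho> / 4)) * (x \<bullet> P x)" for x
        using quad_contr[of e x] by (simp add: P Ff' e M_inner[of x e "f' e x"] inner_commute)
    qed (use e P M_inner a_pos M_ge rho_pos in auto)
    then show ?thesis by blast
  qed
  define Ba where "Ba e = {x. (X x \<longlongrightarrow> e) at_top}" for e
  have Ba_open: "open (Ba e)" if e: "f e = 0" for e
  proof -
    obtain P p r c where "local_contraction (\<lambda>x. f (x + e)) (\<lambda>x. f' (x + e)) (\<lambda>x t. X (x + e) t - e) P p r c"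
      using local[OF e] by blast
    then interpret S: local_contraction "\<lambda>x. f (x + e)" "\<lambda>x. f' (x + e)" "\<lambda>x t. X (x + e) t - e" P p r c .
    define U where "U = {x. S.V (x - e) < 4 * c}"
    have U: "open U" unfolding U_def
      by (intro open_Collect_less continuous_on_compose2[OF S.V_cont[of UNIV]] continuous_intros) auto
    have eU: "e \<in> U" using S.c_pos by (simp add: U_def)
    have UB: "(X x \<longlongrightarrow> e) at_top" if "x \<in> U" for x
      using S.X_tendsto_0[of "x - e"] that by (simp add: U_def LIM_zero_iff)
    \<comment> \<open>A trajectory and its time shift have the same limit, so entering U once
      suffices.\<close>
    have ev_shift: "(X y \<longlongrightarrow> e) at_top" if "0 \<le> T" "(X (X y T) \<longlongrightarrow> e) at_top" for y T
    proof -
      have "filterlim (\<lambda>t. t - T) at_top at_top"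
        using filterlim_tendsto_add_at_top[OF tendsto_const[of "- T"] filterlim_ident] by simp
      from filterlim_compose[OF that(2) this] have "((\<lambda>t. X (X y T) (t - T)) \<longlongrightarrow> e) at_top" .
      moreover have "\<forall>\<^sub>F t in at_top. X (X y T) (t - T) = X y t"
        using eventually_ge_at_top[of T] by eventually_elim (use that(1) in \<open>simp add: X_add\<close>)
      ultimately show ?thesis by (rule Lim_transform_eventually)
    qed
    show ?thesis unfolding open_subopen[of "Ba e"]
    proof
      fix x assume "x \<in> Ba e"
      then have "\<forall>\<^sub>F t in at_top. X x t \<in> U" using U eU by (auto simp: Ba_def dest: topological_tendstoD)
      then have "\<forall>\<^sub>F t in at_top. X x t \<in> U \<and> 0 \<le> t" using eventually_ge_at_top by (rule eventually_conj)
      then obtain T where T: "X x T \<in> U" "0 \<le> T" using eventually_happens by fastforce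
      have "open ((\<lambda>y. X y T) -` U)"
        using X_cont[OF T(2)] U by (intro open_vimage) (auto simp: continuous_at_imp_continuous_on)
      moreover have "(\<lambda>y. X y T) -` U \<subseteq> Ba e" using ev_shift[OF T(2)] UB by (auto simp: Ba_def)
      ultimately show "\<exists>T. open T \<and> x \<in> T \<and> T \<subseteq> Ba e" using T(1) by blast
    qed
  qed
  obtain e where e: "f e = 0" "(X 0 \<longlongrightarrow> e) at_top" using limit by blast
  \<comment> \<open>Every trajectory converges to an equilibrium and limits are unique, so the
    complement of one basin is the union of the others.\<close>
  have "- Ba e = \<Union> (Ba ` {d. f d = 0 \<and> d \<noteq> e})"
  proof (intro equalityI subsetI)
    fix x assume x: "x \<in> - Ba e"
    obtain d where "f d = 0" "(X x \<longlongrightarrow> d) at_top" using limit by blast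
    then show "x \<in> \<Union> (Ba ` {d. f d = 0 \<and> d \<noteq> e})" using x by (auto simp: Ba_def)
  next
    fix x assume "x \<in> \<Union> (Ba ` {d. f d = 0 \<and> d \<noteq> e})"
    then obtain d where "d \<noteq> e" "(X x \<longlongrightarrow> d) at_top" by (auto simp: Ba_def)
    then show "x \<in> - Ba e" using tendsto_unique[of at_top "X x"] by (auto simp: Ba_def)
  qed
  moreover have "open (\<Union> (Ba ` {d. f d = 0 \<and> d \<noteq> e}))" using Ba_open by (intro open_Union) auto
  ultimately have "open (- Ba e)" by simp
  then have "closed (Ba e)" by (simp add: closed_open)
  then have "Ba e = UNIV" using Ba_open[OF e(1)] clopen[of "Ba e"] e(2) by (auto simp: Ba_def)
  then have attr: "(X x \<longlongrightarrow> e) at_top" for x by (auto simp: Ba_def)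
  obtain P p r c where "local_contraction (\<lambda>x. f (x + e)) (\<lambda>x. f' (x + e)) (\<lambda>x t. X (x + e) t - e) P p r c"
    using local[OF e(1)] by blast
  then interpret S: local_contraction "\<lambda>x. f (x + e)" "\<lambda>x. f' (x + e)" "\<lambda>x t. X (x + e) t - e" P p r c .
  interpret C: contracting_flow "\<lambda>x. f (x + e)" "\<lambda>x. f' (x + e)" "\<lambda>x t. X (x + e) t - e" P p r c
    by unfold_locales (simp add: LIM_zero attr)
  obtain N gs A where N: "lin_sys (\<lambda>x. f (x + e)) N gs A" "CARD('n) \<le> N"
    "\<And>x h. (\<forall>i<N. \<forall>D. (gs i has_derivative D) (at x) \<longrightarrow> D h = 0) \<Longrightarrow> h = 0"
    using C.koopman_embedding[of "CARD('n)"] by blast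
  define D where "D x i = frechet_derivative (gs i) (at (x - e))" for x i
  have D: "(gs i has_derivative D x i) (at (x - e))" if "i < N" for i x
    unfolding D_def using N(1) that by (simp add: lin_sys_def frechet_derivative_works[symmetric])
  \<comment> \<open>The gradient of the component, as the adjoint of its derivative evaluated at
    1.\<close>
  define D\<phi> where "D\<phi> x i = adjoint (D x i) 1" for x i
  have D\<phi>: "D\<phi> x i \<bullet> v = D x i v" if "i < N" for x i v
    using adjoint_works[OF has_derivative_linear[OF D[OF that, of x]], of v 1] by (simp add: D\<phi>_def inner_commute)
  define \<phi> where "\<phi> x i = gs i (x - e)" for x i
  show ?thesis
  proof (intro exI[of _ N] exI[of _ \<phi>] exI[of _ D\<phi>] exI[of _ A] conjI allI impI)
    show "hurwitz N A" using N(1) by (simp add: lin_sys_def)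
    fix x :: "real^'n"
    show "((\<lambda>y. \<phi> y i) has_derivative (\<lambda>v. D\<phi> x i \<bullet> v)) (at x)" if i: "i < N" for i
    proof -
      have "((\<lambda>y. gs i (y - e)) has_derivative D x i) (at x)"
      proof -
        have "((\<lambda>y. y - e) has_derivative (\<lambda>h. h)) (at x)" by (auto intro!: derivative_eq_intros)
        from has_derivative_compose[OF this D[OF i]] show ?thesis .
      qed
      then show ?thesis using D\<phi>[OF i] by (simp add: \<phi>_def fun_eq_iff[symmetric])
    qed
    show "c = 0" if c: "\<forall>i<N. (\<Sum>j\<in>UNIV. (D\<phi> x i $ j) * (c $ j)) = 0" for c :: "real^'n"
    proof (rule N(3)[of "x - e"], intro allI impI)
      fix i D' assume i: "i < N" and D': "(gs i has_derivative D') (at (x - e))"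
      have "D\<phi> x i \<bullet> c = 0" using c i by (simp add: inner_vec_def)
      then show "D' c = 0" using D\<phi>[OF i] has_derivative_unique[OF D' D[OF i]] by simp
    qed
    show "D\<phi> x i \<bullet> f x = (\<Sum>j<N. A i j * \<phi> x j)" if i: "i < N" for i
    proof -
      have "D x i (f (x - e + e)) = (\<Sum>j<N. A i j * gs j (x - e))"
        using N(1) D[OF i] i unfolding lin_sys_def by blast
      then show ?thesis by (simp add: D\<phi>[OF i] \<phi>_def)
    qed
  qed (rule N(2))
qed

end
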